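(* Let $(T(t))_{t\ge 0}$ be a bounded $C_0$-semigroup on a Hilbert space $X$ with generator $-A$. Assume that $\sigma(A)\cap i\mathbb{R}=\{0\}$, let $\alpha\ge 1$, and let $B(A)=A(I+A)^{-1}$. The following are equivalent: (i) $\|(is+A)^{-1}\|=O(|s|^{-\alpha})$ as $s\to 0$, and $\|(is+A)^{-1}\|=O(1)$ as $|s|\to\infty$ ($s\in\mathbb{R}$); (ii) $\|T(t)B(A)^{\alpha}\|=O(t^{-1})$ as $t\to\infty$; (iii) $\|T(t)B(A)\|=O(t^{-1/\alpha})$ as $t\to\infty$.
   Context: The generator of the semigroup is $-A$. The operator $B(A)=A(I+A)^{-1}$ is bounded and sectorial, and $B(A)^{\alpha}$ is its usual fractional power, $B(A)^\alpha=A^\alpha(I+A)^{-\alpha}$. *)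

theory Defs
  imports "HOL-Analysis.Analysis" "HOL-Library.Landau_Symbols"
begin

class complex_vector = real_vector +
  fixes scaleC :: "complex \<Rightarrow> 'a \<Rightarrow> 'a" (infixr "*\<^sub>C" 75)
  assumes scaleC_add_right: "c *\<^sub>C (x + y) = c *\<^sub>C x + c *\<^sub>C y"
    and scaleC_add_left: "(c + d) *\<^sub>C x = c *\<^sub>C x + d *\<^sub>C x"
    and scaleC_scaleC: "c *\<^sub>C d *\<^sub>C x = (c * d) *\<^sub>C x"
    and scaleC_one: "1 *\<^sub>C x = x"
    and scaleR_scaleC: "r *\<^sub>R x = complex_of_real r *\<^sub>C x"

text \<open>The complex inner product is linear in its first argument. The norm is the one of
  \<^class>\<open>real_inner\<close>, so \<open>norm x = sqrt (Re (cinner x x))\<close>.\<close>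

class complex_inner = complex_vector + real_inner +
  fixes cinner :: "'a \<Rightarrow> 'a \<Rightarrow> complex"
  assumes cinner_commute: "cinner x y = cnj (cinner y x)"
    and cinner_add_left: "cinner (x + y) z = cinner x z + cinner y z"
    and cinner_scaleC_left: "cinner (c *\<^sub>C x) y = c * cinner x y"
    and inner_eq_Re_cinner: "inner x y = Re (cinner x y)"

class complex_hilbert = complex_inner + banach

instantiation complex :: complex_hilbert
begin

definition scaleC_complex :: "complex \<Rightarrow> complex \<Rightarrow> complex"
  where "scaleC_complex c x = c * x"

definition cinner_complex :: "complex \<Rightarrow> complex \<Rightarrow> complex"
  where "cinner_complex x y = x * cnj y"

instance
  by standard
    (simp_all add: scaleC_complex_def cinner_complex_def algebra_simps scaleR_conv_of_real
      inner_complex_def)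

end

definition bounded_clinear :: "('a::complex_inner \<Rightarrow> 'a) \<Rightarrow> bool"
  where "bounded_clinear F \<longleftrightarrow> bounded_linear F \<and> (\<forall>c x. F (c *\<^sub>C x) = c *\<^sub>C F x)"

text \<open>Only the values \<open>T t\<close> with \<open>t \<ge> 0\<close> are relevant.\<close>

definition C0_semigroup :: "(real \<Rightarrow> 'a::complex_inner \<Rightarrow> 'a) \<Rightarrow> bool"
  where "C0_semigroup T \<longleftrightarrow>
    (\<forall>t\<ge>0. bounded_clinear (T t)) \<and>
    T 0 = id \<and>
    (\<forall>s\<ge>0. \<forall>t\<ge>0. T (s + t) = T s \<circ> T t) \<and>
    (\<forall>x. ((\<lambda>t. T t x) \<longlongrightarrow> x) (at_right 0))"

definition bounded_C0_semigroup :: "(real \<Rightarrow> 'a::complex_inner \<Rightarrow> 'a) \<Rightarrow> bool"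
  where "bounded_C0_semigroup T \<longleftrightarrow>
    C0_semigroup T \<and> (\<exists>M. \<forall>t\<ge>0. onorm (T t) \<le> M)"

text \<open>An unbounded operator is given by its domain \<open>D\<close> and a function whose values outside
  \<open>D\<close> are irrelevant.\<close>

definition is_generator ::
    "(real \<Rightarrow> 'a::complex_inner \<Rightarrow> 'a) \<Rightarrow> 'a set \<Rightarrow> ('a \<Rightarrow> 'a) \<Rightarrow> bool"
  where "is_generator T D G \<longleftrightarrow>
    D = {x. \<exists>y. ((\<lambda>h. (T h x - x) /\<^sub>R h) \<longlongrightarrow> y) (at_right 0)} \<and>
    (\<forall>x\<in>D. ((\<lambda>h. (T h x - x) /\<^sub>R h) \<longlongrightarrow> G x) (at_right 0))"

definition op_resolvent_set :: "'a::complex_inner set \<Rightarrow> ('a \<Rightarrow> 'a) \<Rightarrow> complex set"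
  where "op_resolvent_set D A =
    {z. bij_betw (\<lambda>x. z *\<^sub>C x - A x) D UNIV \<and>
        bounded_clinear (inv_into D (\<lambda>x. z *\<^sub>C x - A x))}"

definition op_spectrum :: "'a::complex_inner set \<Rightarrow> ('a \<Rightarrow> 'a) \<Rightarrow> complex set"
  where "op_spectrum D A = - op_resolvent_set D A"

text \<open>\<open>(z + A)\<^sup>-\<^sup>1\<close>, meaningful when \<open>- z\<close> is in the resolvent set.\<close>

definition shift_inverse ::
    "'a::complex_inner set \<Rightarrow> ('a \<Rightarrow> 'a) \<Rightarrow> complex \<Rightarrow> 'a \<Rightarrow> 'a"
  where "shift_inverse D A z = inv_into D (\<lambda>x. z *\<^sub>C x + A x)"

definition B_op :: "'a::complex_inner set \<Rightarrow> ('a \<Rightarrow> 'a) \<Rightarrow> 'a \<Rightarrow> 'a"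
  where "B_op D A = A \<circ> shift_inverse D A 1"

text \<open>Fractional powers of a bounded sectorial operator \<open>B\<close>. For \<open>0 < \<theta> < 1\<close> this is
  Balakrishnan's formula
  \<open>B\<^sup>\<theta> x = (sin (\<pi> \<theta>) / \<pi>) \<integral>\<^sub>0\<^sup>\<infinity> s\<^bsup>\<theta>-1\<^esup> (s + B)\<^sup>-\<^sup>1 B x ds\<close>,
  where the integral converges absolutely in norm by sectoriality, and
  \<open>B\<^bsup>n+\<theta>\<^esup> = B\<^sup>n B\<^sup>\<theta>\<close>. The Henstock-Kurzweil integral is used since the Bochner integral
  of the library requires a separable space.\<close>

definition balakrishnan_power :: "real \<Rightarrow> ('a::complex_hilbert \<Rightarrow> 'a) \<Rightarrow> 'a \<Rightarrow> 'a"
  where "balakrishnan_power \<theta> B x =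
    (sin (pi * \<theta>) / pi) *\<^sub>R
      integral {0<..} (\<lambda>s. s powr (\<theta> - 1) *\<^sub>R shift_inverse UNIV B (complex_of_real s) (B x))"

definition frac_power :: "real \<Rightarrow> ('a::complex_hilbert \<Rightarrow> 'a) \<Rightarrow> 'a \<Rightarrow> 'a"
  where "frac_power \<alpha> B =
    (B ^^ nat \<lfloor>\<alpha>\<rfloor>) \<circ> (if frac \<alpha> = 0 then id else balakrishnan_power (frac \<alpha>) B)"

end

theory Submission
  imports Defs
begin

text \<open>
  Why the theorem holds. Both decay statements are shown to be equivalent to the resolvent
  condition (i), which is used throughout in the form
  \<open>\<parallel>x\<parallel> \<le> k (1 + \<bar>s\<bar>\<^bsup>-\<alpha>\<^esup>) \<parallel>(i s + A) x\<parallel>\<close> for \<open>s \<noteq> 0\<close> and \<open>x\<close> in the domain of \<open>A\<close>.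

  The link between the resolvent and \<open>B = B(A)\<close> is a perturbed eigenvalue equation: if
  \<open>(i s + A) x = y\<close>, then \<open>B x = \<mu> x + w\<close>, where \<open>\<mu> = - i s / (1 - i s)\<close> has modulus comparable
  to \<open>min 1 \<bar>s\<bar>\<close> and \<open>\<parallel>w\<parallel> \<le> M \<parallel>y\<parallel>\<close>. For a function \<open>F\<close> that is Lipschitz in the right half of the unit disc one
  expects \<open>F(B) x = F(\<mu>) x + O(\<parallel>y\<parallel>)\<close>. For \<open>F(z) = z\<^sup>\<alpha>\<close> with \<open>\<alpha> \<ge> 1\<close> this is \<open>frac_power_approx\<close>,
  where \<open>F(\<mu>)\<close> appears as a number whose modulus is comparable to \<open>\<bar>\<mu>\<bar>\<^sup>\<alpha>\<close>.

  From decay to the resolvent (\<open>resolvent_growth_if_decay\<close>): integrating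
  \<open>d/dt e\<^bsup>-ist\<^esup> T(t) x = - e\<^bsup>-ist\<^esup> T(t) y\<close> gives \<open>\<parallel>x\<parallel> \<le> \<parallel>T(t) x\<parallel> + M t \<parallel>y\<parallel>\<close>. Since
  \<open>F(\<mu>) x\<close> is \<open>F(B) x\<close> up to \<open>O(\<parallel>y\<parallel>)\<close>, the decay of \<open>T(t) F(B)\<close> bounds \<open>\<parallel>T(t) x\<parallel>\<close> by
  \<open>\<parallel>x\<parallel> / 2\<close> up to a multiple of \<open>\<parallel>y\<parallel>\<close> as soon as \<open>t\<close> is of the order \<open>\<bar>s\<bar>\<^bsup>-\<alpha>\<^esup>\<close>.

  From the resolvent to decay. This is where the Hilbert space enters, through
  \<open>dominated_operator.decay\<close>: if a bounded operator \<open>C\<close> commutes with the semigroup and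
  \<open>\<parallel>C x\<parallel> \<le> K \<parallel>(i s + A) x\<parallel>\<close> for all \<open>s \<noteq> 0\<close>, then \<open>\<parallel>T(t) C\<parallel> = O(K / t)\<close>. The reason is a
  Fourier multiplier argument. If \<open>\<phi>\<close> vanishes at both ends of an interval, \<open>g = \<phi> T x\<close> solves
  \<open>g' + A g = \<phi>' T x\<close>, so Parseval's identity bounds \<open>C g\<close> by \<open>K \<phi>' T x\<close> in quadratic mean;
  with a tent function \<open>\<phi>\<close> of height \<open>t\<close> and slopes \<open>1\<close> and \<open>-1\<close> the assertion follows, because
  \<open>\<parallel>T(t) C x\<parallel> \<le> M \<parallel>T(r) C x\<parallel>\<close> for \<open>r \<le> t\<close>.
  To work with finite sums only, the argument is carried out for the implicit Euler
  scheme \<open>V = (1 + h A)\<^sup>-\<^sup>1\<close> and the finite Fourier transform, and the step size tends to \<open>0\<close> at the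
  end. The scheme suits this purpose because \<open>(1 - z V)\<^sup>-\<^sup>1 V = (1 - z + h A)\<^sup>-\<^sup>1\<close> is again a resolvent of
  \<open>A\<close>, at the point \<open>(1 - z) / h\<close>, which lies in the right half-plane for \<open>\<bar>z\<bar> < 1\<close>.

  With \<open>C = B\<^sup>\<alpha>\<close> the multiplier estimate yields (ii), because \<open>\<bar>\<mu>\<bar>\<^sup>\<alpha> (1 + \<bar>s\<bar>\<^bsup>-\<alpha>\<^esup>) \<le> 2\<close>. For (iii) it is
  applied with \<open>C = B (B (r + B)\<^sup>-\<^sup>1)\<^sup>n\<close>, which differs from \<open>B\<close> by \<open>O(r)\<close> and for which
  \<open>K = O(r\<^bsup>1-\<alpha>\<^esup>)\<close>; the choice \<open>r = t\<^bsup>-1/\<alpha>\<^esup>\<close> makes both contributions \<open>O(t\<^bsup>-1/\<alpha>\<^esup>)\<close>.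
\<close>

section \<open>Complex inner product spaces\<close>

lemma cinner_scaleC_right: "cinner x (c *\<^sub>C y) = cnj c * cinner x y"
proof -
  have "cinner x (c *\<^sub>C y) = cnj (c * cinner y x)"
    by (simp only: cinner_commute[of x] cinner_scaleC_left)
  also have "\<dots> = cnj c * cinner x y"
    by (simp only: complex_cnj_mult cinner_commute[of x y])
  finally show ?thesis .
qed

lemma norm_scaleC: "norm (c *\<^sub>C x) = cmod c * norm (x::'a::complex_inner)"
proof -
  have "(norm (c *\<^sub>C x))\<^sup>2 = Re (cinner (c *\<^sub>C x) (c *\<^sub>C x))"
    by (simp add: power2_norm_eq_inner inner_eq_Re_cinner)
  also have "cinner (c *\<^sub>C x) (c *\<^sub>C x) = c * cnj c * cinner x x"
    by (simp add: cinner_scaleC_left cinner_scaleC_right)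
  also have "Re (c * cnj c * cinner x x) = (cmod c)\<^sup>2 * (norm x)\<^sup>2"
    by (simp add: complex_norm_square[symmetric] power2_norm_eq_inner[of x] inner_eq_Re_cinner[of x]
        flip: of_real_power)
  finally show ?thesis
    by (simp flip: power_mult_distrib)
qed

interpretation scaleC: bounded_bilinear "scaleC :: complex \<Rightarrow> 'a::complex_inner \<Rightarrow> 'a"
proof
  show "\<exists>K. \<forall>c (x::'a). norm (c *\<^sub>C x) \<le> norm c * norm x * K"
    by (rule exI[of _ 1]) (simp add: norm_scaleC)
next
  fix r :: real and c :: complex and x :: 'a
  show "(r *\<^sub>R c) *\<^sub>C x = r *\<^sub>R c *\<^sub>C x"
    by (simp only: scaleR_scaleC[of r "c *\<^sub>C x"] scaleC_scaleC scaleR_conv_of_real)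
  show "c *\<^sub>C r *\<^sub>R x = r *\<^sub>R c *\<^sub>C x"
    by (simp only: scaleR_scaleC[of r "c *\<^sub>C x"] scaleR_scaleC[of r x] scaleC_scaleC mult.commute)
qed (simp_all add: scaleC_add_left scaleC_add_right)

lemmas [simp] = scaleC_scaleC scaleC_one

lemma scaleC_of_real [simp]: "complex_of_real r *\<^sub>C x = r *\<^sub>R x"
  by (simp only: scaleR_scaleC)

lemma scaleC_scaleR: "c *\<^sub>C r *\<^sub>R x = r *\<^sub>R c *\<^sub>C x"
  for x :: "'a::complex_inner"
  by (simp add: scaleC.scaleR_right)

lemma bounded_clinear_bounded_linear: "bounded_clinear F \<Longrightarrow> bounded_linear F"
  by (simp add: bounded_clinear_def)

lemma bounded_clinear_scaleC: "bounded_clinear F \<Longrightarrow> F (c *\<^sub>C x) = c *\<^sub>C F x"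
  by (simp add: bounded_clinear_def)

lemma bounded_clinearI:
  fixes F :: "'a::complex_inner \<Rightarrow> 'a"
  assumes "\<And>x y. F (x + y) = F x + F y" "\<And>c x. F (c *\<^sub>C x) = c *\<^sub>C F x"
    "\<And>x. norm (F x) \<le> norm x * K"
  shows "bounded_clinear F"
  unfolding bounded_clinear_def using assms
  by (auto intro!: bounded_linear_intro[of F K] simp flip: scaleC_of_real)

lemma bounded_clinear_ident: "bounded_clinear (\<lambda>x. x)"
  by (simp add: bounded_clinear_def)

lemma bounded_clinear_id: "bounded_clinear id"
  by (simp add: bounded_clinear_def id_def)

lemma bounded_clinear_compose:
  "bounded_clinear F \<Longrightarrow> bounded_clinear G \<Longrightarrow> bounded_clinear (F \<circ> G)"
  by (auto simp: bounded_clinear_def o_def intro: bounded_linear_compose)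

lemma bounded_clinear_diff:
  "bounded_clinear F \<Longrightarrow> bounded_clinear G \<Longrightarrow> bounded_clinear (\<lambda>x. F x - G x)"
  by (auto simp: bounded_clinear_def scaleC.diff_right intro: bounded_linear_sub)

lemma bounded_clinear_scaleR:
  "bounded_clinear F \<Longrightarrow> bounded_clinear (\<lambda>x. r *\<^sub>R F x)"
  by (auto simp: bounded_clinear_def scaleC_scaleR
      intro: bounded_linear_compose[OF bounded_linear_scaleR_right])

lemma bounded_clinear_funpow: "bounded_clinear F \<Longrightarrow> bounded_clinear (F ^^ n)"
  by (induction n) (simp_all add: bounded_clinear_id bounded_clinear_compose)

lemma funpow_comm_apply: "(\<And>x. F (G x) = G (F x)) \<Longrightarrow> (F ^^ n) (G x) = G ((F ^^ n) x)"
  by (induction n) auto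

section \<open>Parseval's identity for the finite Fourier transform\<close>

lemma cinner_sum_left: "cinner (\<Sum>i\<in>I. f i) y = (\<Sum>i\<in>I. cinner (f i) y)"
  for f :: "'i \<Rightarrow> 'a::complex_inner"
proof (induction I rule: infinite_finite_induct)
  have "cinner 0 y = 0"
    using cinner_add_left[of 0 0 y] by simp
  then show "cinner (\<Sum>i\<in>{}. f i) y = (\<Sum>i\<in>{}. cinner (f i) y)"
    and "infinite I \<Longrightarrow> cinner (\<Sum>i\<in>I. f i) y = (\<Sum>i\<in>I. cinner (f i) y)" for I
    by simp_all
qed (simp add: cinner_add_left)

lemma cinner_sum_right: "cinner y (\<Sum>i\<in>I. f i) = (\<Sum>i\<in>I. cinner y (f i))"
  for f :: "'i \<Rightarrow> 'a::complex_inner"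
  using cinner_commute[of y "\<Sum>i\<in>I. f i"]
  by (simp add: cinner_sum_left cinner_commute[of y])

lemma sum_roots_of_unity_orthogonal:
  assumes "m < N" "n < N"
  shows "(\<Sum>k<N. cis (2 * pi * real k / real N) ^ m * cnj (cis (2 * pi * real k / real N) ^ n))
    = (if m = n then of_nat N else 0)"
proof -
  define z where "z = cis (2 * pi * (real m - real n) / real N)"
  have *: "cis (2 * pi * real k / real N) ^ m * cnj (cis (2 * pi * real k / real N) ^ n) = z ^ k" for k
    unfolding z_def Complex.DeMoivre cis_cnj complex_cnj_power cis_mult
    by (rule arg_cong[of _ _ cis]) (simp add: field_simps diff_divide_distrib)
  have N: "N > 0" using assms by simp
  have "z ^ N = 1"
  proof -
    have "z ^ N = cis (2 * pi * (real m - real n))"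
      using N by (simp add: z_def Complex.DeMoivre)
    also have "\<dots> = cis (2 * pi * of_int (int m - int n))" by simp
    also have "\<dots> = 1" by (rule cis_multiple_2pi) simp
    finally show ?thesis .
  qed
  moreover have "z = 1 \<longleftrightarrow> m = n"
  proof
    assume "z = 1"
    then have "cos (2 * pi * (real m - real n) / real N) = 1"
      by (simp add: z_def complex_eq_iff)
    then obtain j :: int where "2 * pi * (real m - real n) / real N = real_of_int j * 2 * pi"
      by (auto simp: cos_one_2pi_int)
    then have "real m - real n = real_of_int j * real N"
      using N by (simp add: divide_eq_eq right_diff_distrib[symmetric] mult_ac)
    then have "real_of_int (int m - int n) = real_of_int (j * int N)"
      by simp
    then have "int m - int n = j * int N" by (simp only: of_int_eq_iff)
    moreover have "\<bar>int m - int n\<bar> < int N" using assms by auto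
    ultimately have "\<bar>j\<bar> * int N < 1 * int N" by (simp add: abs_mult)
    then have "j = 0" by (simp only: mult_less_cancel_right) auto
    with \<open>int m - int n = j * int N\<close> show "m = n" by simp
  qed (simp add: z_def)
  ultimately show ?thesis
    unfolding * by (cases "m = n") (simp_all add: geometric_sum)
qed

lemma finite_Parseval:
  fixes v :: "nat \<Rightarrow> 'a::complex_inner"
  shows "(\<Sum>k<N. (norm (\<Sum>n<N. cis (2 * pi * real k / real N) ^ n *\<^sub>C v n))\<^sup>2)
    = real N * (\<Sum>n<N. (norm (v n))\<^sup>2)"
proof -
  define w where "w k = cis (2 * pi * real k / real N)" for k
  have "cinner (\<Sum>n<N. w k ^ n *\<^sub>C v n) (\<Sum>n<N. w k ^ n *\<^sub>C v n)
      = (\<Sum>m<N. \<Sum>n<N. w k ^ m * cnj (w k ^ n) * cinner (v m) (v n))" for k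
    by (simp only: cinner_sum_left)
      (simp add: cinner_sum_right cinner_scaleC_left cinner_scaleC_right mult_ac)
  then have "(\<Sum>k<N. (norm (\<Sum>n<N. w k ^ n *\<^sub>C v n))\<^sup>2)
      = Re (\<Sum>k<N. \<Sum>m<N. \<Sum>n<N. w k ^ m * cnj (w k ^ n) * cinner (v m) (v n))"
    by (simp only: power2_norm_eq_inner inner_eq_Re_cinner Re_sum)
  also have "(\<Sum>k<N. \<Sum>m<N. \<Sum>n<N. w k ^ m * cnj (w k ^ n) * cinner (v m) (v n))
      = (\<Sum>m<N. \<Sum>n<N. (\<Sum>k<N. w k ^ m * cnj (w k ^ n)) * cinner (v m) (v n))"
  proof -
    have "(\<Sum>k<N. \<Sum>m<N. \<Sum>n<N. w k ^ m * cnj (w k ^ n) * cinner (v m) (v n))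
      = (\<Sum>m<N. \<Sum>k<N. \<Sum>n<N. w k ^ m * cnj (w k ^ n) * cinner (v m) (v n))"
      by (rule sum.swap)
    also have "\<dots> = (\<Sum>m<N. \<Sum>n<N. \<Sum>k<N. w k ^ m * cnj (w k ^ n) * cinner (v m) (v n))"
      by (rule sum.cong[OF refl], rule sum.swap)
    finally show ?thesis by (simp only: sum_distrib_right)
  qed
  also have "\<dots> = (\<Sum>m<N. \<Sum>n<N. if m = n then of_nat N * cinner (v m) (v m) else 0)"
    unfolding w_def
    by (rule sum.cong[OF refl], rule sum.cong[OF refl])
      (simp only: lessThan_iff sum_roots_of_unity_orthogonal, simp)
  also have "\<dots> = (\<Sum>m<N. of_nat N * cinner (v m) (v m))"
    by (rule sum.cong[OF refl]) simp
  also have "Re \<dots> = real N * (\<Sum>n<N. (norm (v n))\<^sup>2)"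
    by (simp add: power2_norm_eq_inner inner_eq_Re_cinner sum_distrib_left)
  finally show ?thesis unfolding w_def .
qed

section \<open>Bounded semigroups and the resolvents of their generators\<close>

lemma has_vector_derivative_right_quotient:
  fixes F :: "real \<Rightarrow> 'b::real_normed_vector"
  assumes "(F has_vector_derivative y) (at t within {a..b})" "a \<le> t" "t < b"
  shows "((\<lambda>h. (F (t + h) - F t) /\<^sub>R h) \<longlongrightarrow> y) (at_right 0)"
proof -
  have "(F has_vector_derivative y) (at t within {t..b})"
    by (rule has_vector_derivative_within_subset[OF assms(1)]) (use assms in auto)
  then have "((\<lambda>u. (1 / norm (u - t)) *\<^sub>R (F u - (F t + (u - t) *\<^sub>R y))) \<longlongrightarrow> 0) (at_right t)"
    using assms(3) by (simp add: has_vector_derivative_def has_derivative_within at_within_Icc_at_right)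
  then have "((\<lambda>h. (1 / norm (h + t - t)) *\<^sub>R (F (h + t) - (F t + (h + t - t) *\<^sub>R y)) + y)
      \<longlongrightarrow> 0 + y) (at_right 0)"
    by (intro tendsto_add tendsto_const) (simp only: filterlim_at_right_to_0[of _ _ t])
  moreover have "\<forall>\<^sub>F h in at_right 0.
      (1 / norm (h + t - t)) *\<^sub>R (F (h + t) - (F t + (h + t - t) *\<^sub>R y)) + y
      = (F (t + h) - F t) /\<^sub>R h"
    using eventually_at_right_less[of "0::real"]
    by eventually_elim (simp add: algebra_simps divide_inverse)
  ultimately show ?thesis
    by (simp add: Lim_transform_eventually)
qed

locale bounded_semigroup =
  fixes T :: "real \<Rightarrow> 'a::complex_hilbert \<Rightarrow> 'a" and D :: "'a set" and A :: "'a \<Rightarrow> 'a" and M :: real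
  assumes semigroup: "C0_semigroup T"
    and M_ge_1: "1 \<le> M"
    and norm_T: "0 \<le> t \<Longrightarrow> norm (T t x) \<le> M * norm x"
    and generator: "is_generator T D (\<lambda>x. - A x)"
begin

lemma T_clinear: "0 \<le> t \<Longrightarrow> bounded_clinear (T t)"
  using semigroup by (simp add: C0_semigroup_def)

lemma T_linear: "0 \<le> t \<Longrightarrow> bounded_linear (T t)"
  by (simp add: T_clinear bounded_clinear_bounded_linear)

lemma T_0: "T 0 x = x"
  using semigroup by (simp add: C0_semigroup_def)

lemma T_add: "0 \<le> s \<Longrightarrow> 0 \<le> t \<Longrightarrow> T (s + t) x = T s (T t x)"
  using semigroup by (simp add: C0_semigroup_def)

lemma T_comm: "0 \<le> s \<Longrightarrow> 0 \<le> t \<Longrightarrow> T s (T t x) = T t (T s x)"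
  by (metis T_add add.commute)

lemma T_right: "((\<lambda>t. T t x) \<longlongrightarrow> x) (at_right 0)"
  using semigroup by (simp add: C0_semigroup_def)

lemma M_ge_0: "0 \<le> M"
  using M_ge_1 by simp

lemma quotient_tendsto: "x \<in> D \<Longrightarrow> ((\<lambda>h. (T h x - x) /\<^sub>R h) \<longlongrightarrow> - A x) (at_right 0)"
  using generator by (simp add: is_generator_def)

lemma D_intro:
  assumes "((\<lambda>h. (T h x - x) /\<^sub>R h) \<longlongrightarrow> y) (at_right 0)"
  shows "x \<in> D" and "A x = - y"
proof -
  show x: "x \<in> D"
    using generator assms by (auto simp: is_generator_def)
  have "- A x = y"
    by (rule tendsto_unique[OF _ quotient_tendsto[OF x] assms]) simp
  then show "A x = - y" by auto
qed

lemma D_commute: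
  assumes C: "bounded_linear C" and comm: "\<And>t x. 0 \<le> t \<Longrightarrow> C (T t x) = T t (C x)"
    and x: "x \<in> D"
  shows "C x \<in> D" and "A (C x) = C (A x)"
proof -
  interpret C: bounded_linear C by fact
  have "((\<lambda>h. C ((T h x - x) /\<^sub>R h)) \<longlongrightarrow> C (- A x)) (at_right 0)"
    by (rule C.tendsto[OF quotient_tendsto[OF x]])
  moreover have "\<forall>\<^sub>F h in at_right 0. C ((T h x - x) /\<^sub>R h) = (T h (C x) - C x) /\<^sub>R h"
    using eventually_at_right_less[of "0::real"]
    by eventually_elim (simp add: C.scaleR C.diff comm)
  ultimately have "((\<lambda>h. (T h (C x) - C x) /\<^sub>R h) \<longlongrightarrow> C (- A x)) (at_right 0)"
    by (rule Lim_transform_eventually)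
  from D_intro[OF this] show "C x \<in> D" "A (C x) = C (A x)"
    by (simp_all add: C.neg)
qed

lemma D_add:
  assumes x: "x \<in> D" and y: "y \<in> D"
  shows "x + y \<in> D" and "A (x + y) = A x + A y"
proof -
  have "\<forall>\<^sub>F h in at_right 0. (T h x - x) /\<^sub>R h + (T h y - y) /\<^sub>R h = (T h (x + y) - (x + y)) /\<^sub>R h"
    using eventually_at_right_less[of "0::real"]
    by eventually_elim (simp add: linear_simps[OF T_linear] algebra_simps)
  then have "((\<lambda>h. (T h (x + y) - (x + y)) /\<^sub>R h) \<longlongrightarrow> - A x + - A y) (at_right 0)"
    by (rule Lim_transform_eventually[OF tendsto_add[OF quotient_tendsto[OF x] quotient_tendsto[OF y]]])
  from D_intro[OF this] show "x + y \<in> D" "A (x + y) = A x + A y" by simp_all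
qed

lemma D_scaleC:
  assumes x: "x \<in> D"
  shows "c *\<^sub>C x \<in> D" and "A (c *\<^sub>C x) = c *\<^sub>C A x"
  using D_commute[of "\<lambda>x. c *\<^sub>C x", OF scaleC.bounded_linear_right _ x]
  by (simp_all add: bounded_clinear_scaleC[OF T_clinear])

lemma D_scaleR:
  assumes x: "x \<in> D"
  shows "r *\<^sub>R x \<in> D" and "A (r *\<^sub>R x) = r *\<^sub>R A x"
  using D_scaleC[OF x, of "complex_of_real r"] by simp_all

lemma D_diff:
  assumes x: "x \<in> D" and y: "y \<in> D"
  shows "x - y \<in> D" and "A (x - y) = A x - A y"
  using D_add[OF x D_scaleR(1)[OF y, of "-1"]] D_scaleR(2)[OF y, of "-1"] by simp_all

lemma T_continuous: "continuous_on {0..} (\<lambda>t. T t x)"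
proof -
  have *: "norm (T t x - T s x) \<le> M * norm (T (t - s) x - x)" if "0 \<le> s" "s \<le> t" for s t
  proof -
    have "T t x - T s x = T s (T (t - s) x - x)"
      using that T_add[of s "t - s" x] by (simp add: linear_simps[OF T_linear])
    then show ?thesis using norm_T[of s] that by simp
  qed
  have **: "norm (T t x - T s x) \<le> M * norm (T \<bar>t - s\<bar> x - x)" if "0 \<le> s" "0 \<le> t" for s t
  proof (cases "s \<le> t")
    case True
    then show ?thesis using *[of s t] that by simp
  next
    case False
    then show ?thesis using *[of t s] that by (simp add: norm_minus_commute)
  qed
  show ?thesis
  proof (rule continuous_onI)
    fix s e :: real assume s: "s \<in> {0..}" and e: "e > 0"
    have "e / M > 0" using e M_ge_1 by simp
    from tendstoD[OF T_right[of x] this] obtain d where d: "d > 0"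
      "\<And>h. 0 < h \<Longrightarrow> h < d \<Longrightarrow> dist (T h x) x < e / M"
      by (auto simp: eventually_at_right_field)
    have "dist (T t x) (T s x) \<le> e" if "t \<in> {0..}" "dist t s < d" for t
    proof (cases "t = s")
      case False
      then have "norm (T \<bar>t - s\<bar> x - x) < e / M"
        using d(2)[of "\<bar>t - s\<bar>"] that(2) by (simp add: dist_norm)
      then have "M * norm (T \<bar>t - s\<bar> x - x) \<le> e"
        using M_ge_1 by (simp add: field_simps)
      with **[of s t] s that show ?thesis by (simp add: dist_norm)
    qed (use e in simp)
    with d(1) show "\<exists>d>0. \<forall>t\<in>{0..}. dist t s < d \<longrightarrow> dist (T t x) (T s x) \<le> e"
      by blast
  qed
qed

text \<open>Truncated Laplace transforms produce elements of the domain: they show that the domain is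
  dense and, up to an invertible factor, that \<open>l + A\<close> is onto.\<close>

lemma laplace_truncated:
  fixes l :: real
  defines "f \<equiv> \<lambda>x s. exp (- l * s) *\<^sub>R T s x"
  defines "U \<equiv> \<lambda>x t. integral {0..t} (f x)"
  shows laplace_truncated_D: "0 \<le> t \<Longrightarrow> U x t \<in> D"
    and laplace_truncated_A: "0 \<le> t \<Longrightarrow> l *\<^sub>R U x t + A (U x t) = x - exp (- l * t) *\<^sub>R T t x"
    and laplace_truncated_tendsto: "((\<lambda>h. U x h /\<^sub>R h) \<longlongrightarrow> x) (at_right 0)"
proof -
  have cont: "continuous_on {0..} (f x)" for x
    unfolding f_def by (intro continuous_intros T_continuous)
  have cont': "continuous_on {a..b} (f x)" if "0 \<le> a" for a b x
    by (rule continuous_on_subset[OF cont]) (use that in auto)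
  have quot: "((\<lambda>h. (U x (t + h) - U x t) /\<^sub>R h) \<longlongrightarrow> f x t) (at_right 0)" if "0 \<le> t" for x t
    unfolding U_def
    by (rule has_vector_derivative_right_quotient[OF integral_has_vector_derivative, of 0 "t + 1"])
      (use that cont' in auto)
  have lim0: "((\<lambda>h. U x h /\<^sub>R h) \<longlongrightarrow> x) (at_right 0)" for x
    using quot[of 0 x] by (simp add: U_def f_def T_0)
  then show "((\<lambda>h. U x h /\<^sub>R h) \<longlongrightarrow> x) (at_right 0)" .
  \<comment> \<open>\<open>T h\<close> shifts the integrand, so the difference quotient of \<open>U x t\<close> reduces to averages of \<open>f x\<close>
      over short intervals at the two ends of integration.\<close>
  have TU: "T h (U x t) = exp (l * h) *\<^sub>R (U x (t + h) - U x h)" if "0 \<le> t" "0 \<le> h" for h t x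
  proof -
    have "T h (U x t) = integral {0..t} (T h \<circ> f x)"
      unfolding U_def using that
      by (intro integral_linear[symmetric] integrable_continuous_real cont' T_linear) auto
    also have "\<dots> = integral {0..t} (\<lambda>s. exp (l * h) *\<^sub>R f x (s + h))"
    proof (rule integral_cong)
      fix s assume "s \<in> {0..t}"
      then have "T h (T s x) = T (s + h) x"
        using that by (simp add: T_add T_comm)
      then show "(T h \<circ> f x) s = exp (l * h) *\<^sub>R f x (s + h)"
        using that by (simp add: f_def linear_simps[OF T_linear] algebra_simps flip: exp_add)
    qed
    also have "\<dots> = exp (l * h) *\<^sub>R integral {0..t} (f x \<circ> (\<lambda>s. s + h))"
      by (simp add: o_def)
    also have "integral {0..t} (f x \<circ> (\<lambda>s. s + h)) = integral {0 + h..t + h} (f x)"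
      using integral_shift_Icc_real[of 0 t "f x" h] by (simp add: o_def add.commute)
    also have "\<dots> = U x (t + h) - U x h"
      using Henstock_Kurzweil_Integration.integral_combine[of 0 h "t + h" "f x"] that cont'[of 0]
      by (simp add: U_def integrable_continuous_real algebra_simps)
    finally show ?thesis .
  qed
  show "U x t \<in> D" "l *\<^sub>R U x t + A (U x t) = x - exp (- l * t) *\<^sub>R T t x" if t: "0 \<le> t"
  proof -
    have e: "((\<lambda>h. (exp (l * h) - 1) / h) \<longlongrightarrow> l) (at_right 0)"
    proof -
      have "((\<lambda>h. exp (l * h)) has_real_derivative l) (at 0)"
        by (auto intro!: derivative_eq_intros)
      then have "((\<lambda>h. (exp (l * h) - 1) / h) \<longlongrightarrow> l) (at 0)"
        by (simp add: DERIV_def)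
      then show ?thesis by (rule filterlim_mono) (simp_all add: at_le)
    qed
    have "((\<lambda>h. exp (l * h) *\<^sub>R ((U x (t + h) - U x t) /\<^sub>R h - U x h /\<^sub>R h)
        + ((exp (l * h) - 1) / h) *\<^sub>R U x t)
        \<longlongrightarrow> exp (l * 0) *\<^sub>R (f x t - x) + l *\<^sub>R U x t) (at_right 0)"
      by (intro tendsto_intros quot lim0 e t)
    moreover have "\<forall>\<^sub>F h in at_right 0. exp (l * h) *\<^sub>R ((U x (t + h) - U x t) /\<^sub>R h - U x h /\<^sub>R h)
        + ((exp (l * h) - 1) / h) *\<^sub>R U x t = (T h (U x t) - U x t) /\<^sub>R h"
      using eventually_at_right_less[of "0::real"]
      by eventually_elim (use t in \<open>simp add: TU algebra_simps divide_inverse\<close>)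
    ultimately have "((\<lambda>h. (T h (U x t) - U x t) /\<^sub>R h)
        \<longlongrightarrow> exp (l * 0) *\<^sub>R (f x t - x) + l *\<^sub>R U x t) (at_right 0)"
      by (rule Lim_transform_eventually)
    from D_intro[OF this] show "U x t \<in> D" "l *\<^sub>R U x t + A (U x t) = x - exp (- l * t) *\<^sub>R T t x"
      by (simp_all add: f_def)
  qed
qed

lemma D_dense:
  assumes "0 < e"
  obtains y where "y \<in> D" "norm (y - x) < e"
proof -
  have "\<forall>\<^sub>F h in at_right 0. dist (integral {0..h} (\<lambda>s. exp (- 0 * s) *\<^sub>R T s x) /\<^sub>R h) x < e"
    by (rule tendstoD[OF laplace_truncated_tendsto assms])
  then have "\<forall>\<^sub>F h in at_right 0. 0 < (h::real) \<and>
      dist (integral {0..h} (\<lambda>s. exp (- 0 * s) *\<^sub>R T s x) /\<^sub>R h) x < e"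
    using eventually_at_right_less[of "0::real"] by eventually_elim simp
  then obtain h where "0 < h" "dist (integral {0..h} (\<lambda>s. exp (- 0 * s) *\<^sub>R T s x) /\<^sub>R h) x < e"
    using eventually_happens'[of "at_right (0::real)"] by auto
  then show ?thesis
    by (intro that[OF D_scaleR(1)[OF laplace_truncated_D[of h 0 x], of "inverse h"]])
      (simp_all add: dist_norm)
qed

text \<open>A truncated Laplace transform inverts \<open>l + A\<close> up to the factor \<open>1 - e\<^bsup>-lt\<^esup> T(t)\<close>, which is
  invertible by the contraction principle once \<open>M e\<^bsup>-lt\<^esup> = 1/2\<close>.\<close>

lemma surj_shift:
  fixes l :: real
  assumes l: "0 < l"
  obtains x where "x \<in> D" "l *\<^sub>R x + A x = y"
proof -
  define t where "t = ln (2 * M) / l"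
  have t: "0 \<le> t" using l M_ge_1 by (simp add: t_def)
  have q: "exp (- l * t) * M = 1 / 2"
    using l M_ge_1 by (simp add: t_def exp_minus)
  have "\<exists>!z. y + exp (- l * t) *\<^sub>R T t z = z"
  proof (rule banach_fix_type[of "1/2"])
    show "\<forall>z w. dist (y + exp (- l * t) *\<^sub>R T t z) (y + exp (- l * t) *\<^sub>R T t w) \<le> 1 / 2 * dist z w"
    proof (intro allI)
      fix z w
      have "dist (y + exp (- l * t) *\<^sub>R T t z) (y + exp (- l * t) *\<^sub>R T t w)
          = exp (- l * t) * norm (T t (z - w))"
        using t by (simp add: dist_norm linear_simps[OF T_linear] flip: scaleR_diff_right)
      also have "\<dots> \<le> exp (- l * t) * (M * norm (z - w))"
        using norm_T[OF t] by simp
      also have "\<dots> = 1 / 2 * dist z w"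
        using q by (simp add: dist_norm flip: mult.assoc)
      finally show "dist (y + exp (- l * t) *\<^sub>R T t z) (y + exp (- l * t) *\<^sub>R T t w) \<le> 1 / 2 * dist z w" .
    qed
  qed auto
  then obtain z where "z - exp (- l * t) *\<^sub>R T t z = y"
    by (metis add_diff_cancel_right')
  with laplace_truncated_D[OF t] laplace_truncated_A[OF t, of l z] show ?thesis
    using that by metis
qed


text \<open>In the equivalent norm \<open>orbit_norm\<close> the semigroup is contractive, so that the resolvent
  estimate below carries no constant and can be iterated.\<close>

definition orbit_norm :: "'a \<Rightarrow> real"
  where "orbit_norm x = (SUP t\<in>{0..}. norm (T t x))"

lemma norm_T_le_orbit_norm: "0 \<le> t \<Longrightarrow> norm (T t x) \<le> orbit_norm x"
  unfolding orbit_norm_def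
  by (rule cSUP_upper) (auto intro!: bdd_aboveI2[of _ _ "M * norm x"] norm_T)

lemma orbit_norm_least: "(\<And>t. 0 \<le> t \<Longrightarrow> norm (T t x) \<le> c) \<Longrightarrow> orbit_norm x \<le> c"
  unfolding orbit_norm_def by (rule cSUP_least) auto

lemma norm_le_orbit_norm: "norm x \<le> orbit_norm x"
  using norm_T_le_orbit_norm[of 0 x] by (simp add: T_0)

lemma orbit_norm_le: "orbit_norm x \<le> M * norm x"
  by (rule orbit_norm_least) (rule norm_T)

lemma orbit_norm_nonneg: "0 \<le> orbit_norm x"
  using norm_le_orbit_norm[of x] norm_ge_zero[of x] by linarith

lemma orbit_norm_T: "0 \<le> h \<Longrightarrow> orbit_norm (T h x) \<le> orbit_norm x"
  by (rule orbit_norm_least) (simp add: norm_T_le_orbit_norm flip: T_add)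

lemma orbit_norm_add: "orbit_norm (x + y) \<le> orbit_norm x + orbit_norm y"
proof (rule orbit_norm_least)
  fix t :: real assume t: "0 \<le> t"
  have "norm (T t (x + y)) \<le> norm (T t x) + norm (T t y)"
    using t by (simp add: linear_simps[OF T_linear] norm_triangle_ineq)
  with norm_T_le_orbit_norm[OF t, of x] norm_T_le_orbit_norm[OF t, of y]
  show "norm (T t (x + y)) \<le> orbit_norm x + orbit_norm y" by linarith
qed

lemma orbit_norm_scaleC: "cmod c * orbit_norm x \<le> orbit_norm (c *\<^sub>C x)"
proof (cases "c = 0")
  case False
  have "orbit_norm x \<le> orbit_norm (c *\<^sub>C x) / cmod c"
  proof (rule orbit_norm_least)
    fix t :: real assume t: "0 \<le> t"
    have "cmod c * norm (T t x) \<le> orbit_norm (c *\<^sub>C x)"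
      using norm_T_le_orbit_norm[OF t, of "c *\<^sub>C x"] t
      by (simp add: bounded_clinear_scaleC[OF T_clinear] norm_scaleC)
    then show "norm (T t x) \<le> orbit_norm (c *\<^sub>C x) / cmod c"
      using False by (simp add: field_simps)
  qed
  then show ?thesis using False by (simp add: field_simps)
qed (simp add: orbit_norm_nonneg)

lemma orbit_norm_scaleR: "0 \<le> r \<Longrightarrow> orbit_norm (r *\<^sub>R x) \<le> r * orbit_norm x"
  by (rule orbit_norm_least)
    (simp add: linear_simps[OF T_linear] norm_T_le_orbit_norm mult_left_mono)

text \<open>In a norm for which \<open>T\<close> is contractive, \<open>T h x = (1 + l h) x - h (l x + A x) + o(h)\<close> cannot be
  longer than \<open>x\<close>, whereas \<open>\<bar>1 + l h\<bar> \<ge> 1 + h Re l\<close>.\<close>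

lemma orbit_norm_dissipative:
  assumes x: "x \<in> D"
  shows "Re l * orbit_norm x \<le> orbit_norm (l *\<^sub>C x + A x)"
proof -
  define y where "y = l *\<^sub>C x + A x"
  define e where "e h = (T h x - x) /\<^sub>R h + A x" for h
  have "((\<lambda>h. (T h x - x) /\<^sub>R h + A x) \<longlongrightarrow> - A x + A x) (at_right 0)"
    by (intro tendsto_add tendsto_const quotient_tendsto x)
  then have e0: "(e \<longlongrightarrow> 0) (at_right 0)" by (simp add: e_def[abs_def])
  have "Re l * orbit_norm x \<le> orbit_norm y + M * norm (e h)" if h: "0 < h" for h
  proof -
    have "complex_of_real h *\<^sub>C l *\<^sub>C x = h *\<^sub>R l *\<^sub>C x"
      by (rule scaleC_of_real)
    then have eq: "(1 + complex_of_real h * l) *\<^sub>C x = T h x + h *\<^sub>R (y - e h)"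
      using h by (simp add: y_def e_def scaleC_add_left algebra_simps)
    have "(1 + h * Re l) * orbit_norm x \<le> cmod (1 + complex_of_real h * l) * orbit_norm x"
      using complex_Re_le_cmod[of "1 + complex_of_real h * l"]
      by (intro mult_right_mono orbit_norm_nonneg) simp
    also have "\<dots> \<le> orbit_norm (T h x + h *\<^sub>R (y - e h))"
      using orbit_norm_scaleC[of "1 + complex_of_real h * l" x] by (simp only: eq)
    also have "\<dots> \<le> orbit_norm x + h * orbit_norm (y + (- e h))"
      using orbit_norm_add[of "T h x" "h *\<^sub>R (y - e h)"] orbit_norm_T[of h x]
        orbit_norm_scaleR[of h "y - e h"] h by simp
    also have "\<dots> \<le> orbit_norm x + h * (orbit_norm y + M * norm (e h))"
      using orbit_norm_add[of y "- e h"] orbit_norm_le[of "- e h"] h by simp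
    finally have "h * (Re l * orbit_norm x) \<le> h * (orbit_norm y + M * norm (e h))"
      by (simp add: algebra_simps)
    then show ?thesis using h by simp
  qed
  then have "\<forall>\<^sub>F h in at_right 0. Re l * orbit_norm x \<le> orbit_norm y + M * norm (e h)"
    using eventually_at_right_less[of "0::real"] by (auto elim: eventually_mono)
  moreover have "((\<lambda>h. orbit_norm y + M * norm (e h)) \<longlongrightarrow> orbit_norm y + M * norm (0::'a)) (at_right 0)"
    by (intro tendsto_intros e0)
  ultimately show ?thesis
    unfolding y_def[symmetric] by (auto intro: tendsto_lowerbound)
qed

lemma norm_dissipative: "x \<in> D \<Longrightarrow> Re l * norm x \<le> M * norm (l *\<^sub>C x + A x)" if "0 \<le> Re l"
  using orbit_norm_dissipative[of x l] orbit_norm_le[of "l *\<^sub>C x + A x"]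
    mult_left_mono[OF norm_le_orbit_norm[of x] that] by linarith

lemma filterlim_divide_Suc_at_right:
  "0 < t \<Longrightarrow> filterlim (\<lambda>n. t / real (Suc n)) (at_right 0) sequentially"
  using LIMSEQ_Suc[OF lim_const_over_n[of t]]
  by (auto simp: filterlim_at simp del: of_nat_Suc intro!: always_eventually)

text \<open>This is the integrated form of \<open>u' = - e\<^bsup>-isr\<^esup> T(r) (i s + A) x\<close> for \<open>u(r) = e\<^bsup>-isr\<^esup> T(r) x\<close>.
  As \<open>u\<close> is a bounded semigroup applied to \<open>x\<close>, each of \<open>n\<close> equal steps changes it by at most \<open>M\<close>
  times the first step, so that the derivative at \<open>0\<close> is enough.\<close>

lemma norm_le_orbit_plus:
  assumes x: "x \<in> D" and t: "0 \<le> t"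
  shows "norm x \<le> norm (T t x) + M * t * norm ((\<i> * complex_of_real s) *\<^sub>C x + A x)"
proof -
  define y where "y = (\<i> * complex_of_real s) *\<^sub>C x + A x"
  define u where "u h = cis (- (s * h)) *\<^sub>C T h x" for h
  have u_step: "norm (u (h + k) - u h) \<le> M * norm (u k - x)" if "0 \<le> h" "0 \<le> k" for h k
  proof -
    have "u (h + k) - u h = cis (- (s * h)) *\<^sub>C T h (u k - x)"
      using that by (simp add: u_def T_add linear_simps[OF T_linear] scaleC.diff_right
          bounded_clinear_scaleC[OF T_clinear] cis_mult algebra_simps)
    then show ?thesis using norm_T[OF that(1), of "u k - x"] by (simp add: norm_scaleC)
  qed
  have iter: "norm (u (real n * h) - x) \<le> real n * (M * norm (u h - x))" if "0 \<le> h" for n h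
  proof (induction n)
    case 0
    then show ?case by (simp add: u_def T_0)
  next
    case (Suc n)
    have "norm (u (real n * h + h) - u (real n * h)) \<le> M * norm (u h - x)"
      using that by (intro u_step) auto
    with Suc norm_triangle_ineq[of "u (real n * h + h) - u (real n * h)" "u (real n * h) - x"]
    show ?case by (simp add: algebra_simps)
  qed
  have quot: "((\<lambda>h. (u h - x) /\<^sub>R h) \<longlongrightarrow> - y) (at_right 0)"
  proof -
    have "((\<lambda>h. cis (- (s * h))) has_vector_derivative (- \<i> * complex_of_real s)) (at 0 within {0..1})"
    proof -
      have "((\<lambda>z. exp (- (\<i> * complex_of_real s * z))) has_field_derivative (- \<i> * complex_of_real s))
          (at (complex_of_real 0))"
        by (auto intro!: derivative_eq_intros)
      from has_vector_derivative_real_field[OF this, of "{0..1}"] show ?thesis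
        by (simp add: cis_conv_exp mult.assoc)
    qed
    from has_vector_derivative_right_quotient[OF this]
    have *: "((\<lambda>h. (cis (- (s * h)) - 1) /\<^sub>R h) \<longlongrightarrow> - \<i> * complex_of_real s) (at_right 0)"
      by simp
    have c: "((\<lambda>h. cis (- (s * h))) \<longlongrightarrow> cis (- (s * 0))) (at_right 0)"
      unfolding cis_conv_exp by (intro tendsto_intros)
    have "((\<lambda>h. cis (- (s * h)) *\<^sub>C ((T h x - x) /\<^sub>R h) + ((cis (- (s * h)) - 1) /\<^sub>R h) *\<^sub>C x)
        \<longlongrightarrow> cis (- (s * 0)) *\<^sub>C (- A x) + (- \<i> * complex_of_real s) *\<^sub>C x) (at_right 0)"
      by (intro tendsto_add scaleC.tendsto c * tendsto_const quotient_tendsto x)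
    moreover have "cis (- (s * h)) *\<^sub>C ((T h x - x) /\<^sub>R h) + ((cis (- (s * h)) - 1) /\<^sub>R h) *\<^sub>C x
        = (u h - x) /\<^sub>R h" for h
      by (simp add: u_def scaleC.diff_right scaleC.diff_left scaleC.scaleR_right scaleC.scaleR_left
          algebra_simps)
    moreover have "cis (- (s * 0)) *\<^sub>C (- A x) + (- \<i> * complex_of_real s) *\<^sub>C x = - y"
      by (simp add: y_def scaleC.minus_left scaleC.minus_right)
    ultimately show ?thesis by simp
  qed
  have "norm (u t - x) \<le> M * t * norm y"
  proof (cases "t = 0")
    case False
    then have t: "0 < t" using t by simp
    have lim: "filterlim (\<lambda>n. t / real (Suc n)) (at_right 0) sequentially"
      by (rule filterlim_divide_Suc_at_right[OF t])
    have "(\<lambda>n. M * t * norm ((u (t / real (Suc n)) - x) /\<^sub>R (t / real (Suc n))))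
        \<longlonglongrightarrow> M * t * norm (- y)"
      by (intro tendsto_intros filterlim_compose[OF quot lim])
    moreover have "norm (u t - x) \<le> M * t * norm ((u (t / real (Suc n)) - x) /\<^sub>R (t / real (Suc n)))" for n
    proof -
      have "real (Suc n) * (t / real (Suc n)) = t" by simp
      moreover have "norm ((u (t / real (Suc n)) - x) /\<^sub>R (t / real (Suc n)))
          = real (Suc n) / t * norm (u (t / real (Suc n)) - x)"
        using t by (simp add: abs_of_pos del: of_nat_Suc)
      ultimately show ?thesis
        using iter[of "t / real (Suc n)" "Suc n"] t by (simp del: of_nat_Suc add: mult.left_commute)
    qed
    ultimately show ?thesis
      by (auto intro: tendsto_lowerbound)
  qed (simp add: u_def T_0)
  moreover have "norm (u t) = norm (T t x)"
    by (simp add: u_def norm_scaleC)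
  ultimately show ?thesis
    unfolding y_def[symmetric] using norm_triangle_ineq2[of x "u t"] by (simp add: norm_minus_commute)
qed

subsection \<open>Resolvents at positive numbers\<close>

abbreviation R :: "real \<Rightarrow> 'a \<Rightarrow> 'a"
  where "R l \<equiv> shift_inverse D A (complex_of_real l)"

lemma shift_inj:
  assumes l: "0 < l" and "x \<in> D" "y \<in> D" "l *\<^sub>R x + A x = l *\<^sub>R y + A y"
  shows "x = y"
proof -
  have "l *\<^sub>R (x - y) + A (x - y) = 0"
    using assms by (simp add: D_diff algebra_simps)
  then have "l * norm (x - y) \<le> 0"
    using norm_dissipative[of "complex_of_real l" "x - y"] assms by (simp add: D_diff)
  then show ?thesis using l by (simp add: mult_le_0_iff)
qed

lemma R_eq:
  assumes l: "0 < l" and x: "x \<in> D"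
  shows "R l (l *\<^sub>R x + A x) = x"
proof -
  have "inj_on (\<lambda>x. complex_of_real l *\<^sub>C x + A x) D"
    using shift_inj[OF l] by (auto simp: inj_on_def)
  from inv_into_f_f[OF this x] show ?thesis by (simp add: shift_inverse_def)
qed

lemma R_D: "0 < l \<Longrightarrow> R l y \<in> D"
  by (metis R_eq surj_shift)

lemma R_inverse: "0 < l \<Longrightarrow> l *\<^sub>R R l y + A (R l y) = y"
  by (metis R_eq surj_shift)

lemma orbit_norm_R: "0 < l \<Longrightarrow> l * orbit_norm (R l y) \<le> orbit_norm y"
  using orbit_norm_dissipative[OF R_D, of l "complex_of_real l" y] by (simp add: R_inverse)

lemma norm_R: "0 < l \<Longrightarrow> l * norm (R l y) \<le> M * norm y"
  using norm_dissipative[OF _ R_D, of "complex_of_real l" l y] by (simp add: R_inverse)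

lemma R_clinear:
  assumes l: "0 < l"
  shows "bounded_clinear (R l)"
proof (rule bounded_clinearI[of _ "M / l"])
  fix x y c
  show "R l (x + y) = R l x + R l y"
  proof -
    have "l *\<^sub>R (R l x + R l y) + A (R l x + R l y)
        = (l *\<^sub>R R l x + A (R l x)) + (l *\<^sub>R R l y + A (R l y))"
      by (simp add: D_add R_D l algebra_simps)
    then show ?thesis
      using R_eq[OF l D_add(1)[OF R_D[OF l] R_D[OF l]], of x y] by (simp only: R_inverse[OF l])
  qed
  show "R l (c *\<^sub>C x) = c *\<^sub>C R l x"
  proof -
    have "l *\<^sub>R c *\<^sub>C R l x + A (c *\<^sub>C R l x) = c *\<^sub>C (l *\<^sub>R R l x + A (R l x))"
      by (simp add: D_scaleC R_D l scaleC.add_right scaleC.scaleR_right)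
    then show ?thesis
      using R_eq[OF l D_scaleC(1)[OF R_D[OF l]], of c x] by (simp add: R_inverse l)
  qed
  show "norm (R l x) \<le> norm x * (M / l)"
    using norm_R[OF l, of x] l by (simp add: field_simps)
qed

lemma R_commute:
  assumes l: "0 < l" and C: "bounded_linear C"
    and comm: "\<And>t x. 0 \<le> t \<Longrightarrow> C (T t x) = T t (C x)"
  shows "C (R l y) = R l (C y)"
proof -
  interpret C: bounded_linear C by fact
  note DC = D_commute[OF C comm R_D[OF l, of y]]
  have "l *\<^sub>R C (R l y) + A (C (R l y)) = C (l *\<^sub>R R l y + A (R l y))"
    by (simp add: DC C.add C.scaleR)
  then show ?thesis
    using R_eq[OF l DC(1)] by (simp add: R_inverse l)
qed

end

context bounded_semigroup begin

section \<open>The implicit Euler scheme\<close>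

text \<open>\<open>euler h = (1 + h A)\<^sup>-\<^sup>1\<close> is one step of the implicit Euler scheme. Its powers are bounded
  like the semigroup, and its own resolvents are resolvents of the generator.\<close>

definition euler :: "real \<Rightarrow> 'a \<Rightarrow> 'a"
  where "euler h y = (1 / h) *\<^sub>R R (1 / h) y"

context
  fixes h :: real
  assumes h: "0 < h"
begin

lemma euler_D: "euler h y \<in> D"
  unfolding euler_def using h by (intro D_scaleR(1) R_D) simp

lemma euler_inverse: "euler h y + h *\<^sub>R A (euler h y) = y"
  using R_inverse[of "1 / h" y] D_scaleR(2)[OF R_D[of "1 / h" y], of "1 / h"] h
  by (simp add: euler_def)

lemma euler_clinear: "bounded_clinear (euler h)"
  unfolding euler_def[abs_def] using h by (intro bounded_clinear_scaleR R_clinear) simp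

lemma euler_commute:
  assumes "bounded_linear C" "\<And>t x. 0 \<le> t \<Longrightarrow> C (T t x) = T t (C x)"
  shows "C (euler h y) = euler h (C y)"
  using R_commute[of "1 / h" C y] assms h by (simp add: euler_def linear_simps[OF assms(1)])

lemma euler_T: "0 \<le> t \<Longrightarrow> euler h (T t y) = T t (euler h y)"
  by (rule euler_commute[symmetric]) (auto simp: T_linear T_comm)

lemma orbit_norm_euler: "orbit_norm (euler h y) \<le> orbit_norm y"
  using orbit_norm_R[of "1 / h" y] orbit_norm_scaleR[of "1 / h" "R (1 / h) y"] h
  by (simp add: euler_def)

lemma norm_euler_power: "norm ((euler h ^^ n) y) \<le> M * norm y"
proof -
  have "orbit_norm ((euler h ^^ n) y) \<le> orbit_norm y"
    by (induction n) (auto intro: order_trans[OF orbit_norm_euler])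
  with norm_le_orbit_norm[of "(euler h ^^ n) y"] orbit_norm_le[of y] show ?thesis by linarith
qed

lemma euler_A: "y \<in> D \<Longrightarrow> A (euler h y) = euler h (A y)"
  by (metis D_commute(2) bounded_clinear_bounded_linear euler_clinear euler_T)

lemma euler_minus:
  assumes "y \<in> D"
  shows "(euler h y - y) /\<^sub>R h = - euler h (A y)"
  using euler_inverse[of y] euler_A[OF assms] h
  by (metis (no_types, lifting) add_diff_cancel_left' minus_diff_eq scaleR_minus_right
      less_numeral_extra(3) left_inverse scaleR_one scaleR_scaleR)

end

text \<open>On the domain, \<open>V y - y = - h V A y\<close> is of order \<open>h\<close>; density and uniform boundedness extend
  the convergence.\<close>

lemma euler_tendsto: "((\<lambda>h. euler h y) \<longlongrightarrow> y) (at_right 0)"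
proof (rule tendstoI)
  fix e :: real assume e: "0 < e"
  define d where "d = e / (2 * (M + 1))"
  have d: "0 < d" "(M + 1) * d = e / 2" using e M_ge_1 by (auto simp: d_def field_simps)
  obtain z where z: "z \<in> D" "norm (z - y) < d" using D_dense[OF d(1)] by blast
  have "((\<lambda>h. h * (M * norm (A z))) \<longlongrightarrow> 0 * (M * norm (A z))) (at_right 0)"
    by (intro tendsto_intros)
  then have "\<forall>\<^sub>F h in at_right 0. h * (M * norm (A z)) < e / 2"
    using e by (intro order_tendstoD(2)[of _ 0]) auto
  then show "\<forall>\<^sub>F h in at_right 0. dist (euler h y) y < e"
    using eventually_at_right_less[of "0::real"]
  proof eventually_elim
    case (elim h)
    then have h: "0 < h" by simp
    have "euler h z - z = h *\<^sub>R ((euler h z - z) /\<^sub>R h)" using h by simp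
    then have "norm (euler h z - z) = h * norm (euler h (A z))"
      using h by (simp only: euler_minus[OF h z(1)]) simp
    also have "\<dots> \<le> h * (M * norm (A z))"
      using norm_euler_power[OF h, of 1 "A z"] h by simp
    finally have 1: "norm (euler h z - z) < e / 2" using elim by simp
    have 2: "norm (euler h (y - z)) \<le> M * norm (y - z)"
      using norm_euler_power[OF h, of 1 "y - z"] by simp
    have "M * norm (y - z) + norm (y - z) \<le> (M + 1) * d"
      using z(2) M_ge_1 by (simp add: norm_minus_commute flip: distrib_right)
        (simp add: distrib_right mult_mono less_imp_le add_mono)
    with 1 2 d(2) have "norm (euler h (y - z)) + norm (y - z) + norm (euler h z - z) < e"
      by simp
    moreover have "euler h y - y = euler h (y - z) - (y - z) + (euler h z - z)"
      using euler_clinear[OF h] by (simp add: linear_simps[OF bounded_clinear_bounded_linear])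
    ultimately show ?case
      using norm_triangle_ineq[of "euler h (y - z) - (y - z)" "euler h z - z"]
        norm_triangle_ineq4[of "euler h (y - z)" "y - z"]
      by (simp only: dist_norm)
  qed
qed

text \<open>The telescoping sum \<open>V\<^sup>n - T(h)\<^sup>n = \<Sum> T(h)\<^sup>j V\<^bsup>n-1-j\<^esup> (V - T(h))\<close>, with \<open>T(h)\<^sup>j\<close> kept as a single
  operator \<open>T(j h)\<close> so that its norm is at most \<open>M\<close>.\<close>

lemma norm_euler_power_minus_T:
  assumes h: "0 < h"
  shows "norm ((euler h ^^ n) x - T (real n * h) x) \<le> real n * (M\<^sup>2 * norm (euler h x - T h x))"
proof -
  have "norm (T (real j * h) ((euler h ^^ n) x - T (real n * h) x))
      \<le> real n * (M\<^sup>2 * norm (euler h x - T h x))" for j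
  proof (induction n arbitrary: j)
    case 0
    then show ?case by (simp add: T_0 linear_simps[OF T_linear] h less_imp_le)
  next
    case (Suc n)
    have lin: "bounded_linear (euler h ^^ n)"
      by (intro bounded_clinear_bounded_linear bounded_clinear_funpow euler_clinear h)
    have T: "T (real j * h) (T h z) = T (real (Suc j) * h) z" for z j
      using h T_add[of "real j * h" h z] by (simp add: algebra_simps)
    have T': "T (real (Suc n) * h) x = T h (T (real n * h) x)"
      using h T_add[of h "real n * h" x] by (simp add: algebra_simps)
    have comm: "(euler h ^^ n) (T h x) = T h ((euler h ^^ n) x)"
      by (rule funpow_comm_apply) (use h in \<open>simp add: euler_T\<close>)
    have "(euler h ^^ Suc n) x - T (real (Suc n) * h) x
        = (euler h ^^ n) (euler h x - T h x) + T h ((euler h ^^ n) x - T (real n * h) x)"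
      using h unfolding T' by (simp add: linear_simps[OF lin] linear_simps[OF T_linear] comm
          funpow_swap1)
    then have "T (real j * h) ((euler h ^^ Suc n) x - T (real (Suc n) * h) x)
        = T (real j * h) ((euler h ^^ n) (euler h x - T h x))
          + T (real (Suc j) * h) ((euler h ^^ n) x - T (real n * h) x)"
      using h by (simp only: T[symmetric]) (simp add: linear_simps[OF T_linear])
    moreover have "norm (T (real j * h) ((euler h ^^ n) (euler h x - T h x)))
        \<le> M\<^sup>2 * norm (euler h x - T h x)"
    proof -
      have "norm (T (real j * h) ((euler h ^^ n) (euler h x - T h x)))
          \<le> M * norm ((euler h ^^ n) (euler h x - T h x))"
        using h by (intro norm_T) simp
      also have "\<dots> \<le> M * (M * norm (euler h x - T h x))"
        by (intro mult_left_mono norm_euler_power h M_ge_0)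
      finally show ?thesis by (simp add: power2_eq_square mult.assoc)
    qed
    ultimately show ?case
      using Suc.IH[of "Suc j"]
        norm_triangle_ineq[of "T (real j * h) ((euler h ^^ n) (euler h x - T h x))"
          "T (real (Suc j) * h) ((euler h ^^ n) x - T (real n * h) x)"]
      by (simp add: distrib_right)
  qed
  from this[of 0] show ?thesis by (simp add: T_0)
qed

text \<open>Convergence of the scheme. On the domain the consistency error of one step is \<open>o(h)\<close>;
  boundedness of all operators extends the convergence to every vector.\<close>

lemma euler_converges:
  assumes t: "0 < t"
  shows "(\<lambda>n. (euler (t / real (Suc n)) ^^ Suc n) x) \<longlonglongrightarrow> T t x"
proof -
  define h where "h n = t / real (Suc n)" for n
  have h: "0 < h n" and nh: "real (Suc n) * h n = t" for n
    using t by (simp_all add: h_def del: of_nat_Suc)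
  have lim: "filterlim h (at_right 0) sequentially"
    unfolding h_def[abs_def] by (rule filterlim_divide_Suc_at_right[OF t])
  have on_D: "(\<lambda>n. norm ((euler (h n) ^^ Suc n) z - T t z)) \<longlonglongrightarrow> 0" if z: "z \<in> D" for z
  proof (rule tendsto_sandwich[OF _ _ tendsto_const])
    have "((\<lambda>k. - euler k (A z) - (T k z - z) /\<^sub>R k) \<longlongrightarrow> - A z - - A z) (at_right 0)"
      by (intro tendsto_diff tendsto_minus euler_tendsto quotient_tendsto z)
    from filterlim_compose[OF this lim]
    have "(\<lambda>n. - euler (h n) (A z) - (T (h n) z - z) /\<^sub>R h n) \<longlonglongrightarrow> 0" by simp
    from tendsto_mult_right_zero[OF tendsto_norm_zero[OF this], of "t * M\<^sup>2"]
    show "(\<lambda>n. t * M\<^sup>2 * norm (- euler (h n) (A z) - (T (h n) z - z) /\<^sub>R h n)) \<longlonglongrightarrow> 0" by simp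
    have "norm ((euler (h n) ^^ Suc n) z - T t z)
        \<le> t * M\<^sup>2 * norm (- euler (h n) (A z) - (T (h n) z - z) /\<^sub>R h n)" for n
    proof -
      have "euler (h n) z - T (h n) z = h n *\<^sub>R (- euler (h n) (A z) - (T (h n) z - z) /\<^sub>R h n)"
        using h[of n] by (simp add: scaleR_diff_right flip: euler_minus[OF h z])
      then have "real (Suc n) * (M\<^sup>2 * norm (euler (h n) z - T (h n) z))
          = (real (Suc n) * h n) * M\<^sup>2 * norm (- euler (h n) (A z) - (T (h n) z - z) /\<^sub>R h n)"
        using h[of n] by simp
      then show ?thesis
        using norm_euler_power_minus_T[OF h[of n], of "Suc n" z] by (simp only: nh)
    qed
    then show "\<forall>\<^sub>F n in sequentially. norm ((euler (h n) ^^ Suc n) z - T t z)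
        \<le> t * M\<^sup>2 * norm (- euler (h n) (A z) - (T (h n) z - z) /\<^sub>R h n)" by simp
  qed simp
  have "(\<lambda>n. (euler (h n) ^^ Suc n) x) \<longlonglongrightarrow> T t x"
  proof (rule tendstoI)
    fix e :: real assume e: "0 < e"
    define d where "d = e / (4 * M)"
    have d: "0 < d" "M * d = e / 4" using e M_ge_1 by (auto simp: d_def)
    obtain z where z: "z \<in> D" "norm (z - x) < d" using D_dense[OF d(1)] by blast
    have "M * norm (x - z) \<le> e / 4"
      using z(2) d(2) M_ge_1 by (metis M_ge_0 less_imp_le mult_left_mono norm_minus_commute)
    have "\<forall>\<^sub>F n in sequentially. norm ((euler (h n) ^^ Suc n) z - T t z) < e / 4"
      using on_D[OF z(1)] e by (intro order_tendstoD(2)[of _ 0]) auto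
    then show "\<forall>\<^sub>F n in sequentially. dist ((euler (h n) ^^ Suc n) x) (T t x) < e"
    proof eventually_elim
      case (elim n)
      have lin: "bounded_linear (euler (h n) ^^ Suc n)"
        by (intro bounded_clinear_bounded_linear bounded_clinear_funpow euler_clinear h)
      have "(euler (h n) ^^ Suc n) x - T t x = (euler (h n) ^^ Suc n) (x - z) - T t (x - z)
          + ((euler (h n) ^^ Suc n) z - T t z)"
        using t by (simp only: linear_simps[OF lin] linear_simps[OF T_linear] less_imp_le) simp
      moreover have "norm ((euler (h n) ^^ Suc n) (x - z)) \<le> e / 4"
        using norm_euler_power[OF h[of n], of "Suc n" "x - z"] \<open>M * norm (x - z) \<le> e / 4\<close> by linarith
      moreover have "norm (T t (x - z)) \<le> e / 4"
        using norm_T[of t "x - z"] t \<open>M * norm (x - z) \<le> e / 4\<close> by linarith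
      ultimately show ?case
        using elim norm_triangle_ineq[of "(euler (h n) ^^ Suc n) (x - z) - T t (x - z)"
            "(euler (h n) ^^ Suc n) z - T t z"]
          norm_triangle_ineq4[of "(euler (h n) ^^ Suc n) (x - z)" "T t (x - z)"] e
        by (simp only: dist_norm)
    qed
  qed
  then show ?thesis by (simp only: h_def)
qed

end

section \<open>A Fourier multiplier estimate\<close>

lemma cube_le_sum_squares: "real m ^ 3 / 3 \<le> (\<Sum>n\<le>m. (real n)\<^sup>2)"
proof (induction m)
  case (Suc m)
  have "real (Suc m) ^ 3 / 3 \<le> real m ^ 3 / 3 + (real (Suc m))\<^sup>2"
    by (simp add: power2_eq_square power3_eq_cube field_simps)
  with Suc show ?case by simp
qed simp

text \<open>Bounded operators that are controlled by \<open>i s + A\<close> uniformly in \<open>s \<noteq> 0\<close>. The inequality replaces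
  a bound on the operators \<open>C (i s + A)\<^sup>-\<^sup>1\<close> and passes to other points of the half-plane without
  reference to inverses.\<close>

locale dominated_operator = bounded_semigroup T D A M
  for T :: "real \<Rightarrow> 'a::complex_hilbert \<Rightarrow> 'a" and D A M +
  fixes C :: "'a \<Rightarrow> 'a" and K :: real
  assumes C_clinear: "bounded_clinear C"
    and C_commute: "0 \<le> t \<Longrightarrow> C (T t x) = T t (C x)"
    and K_nonneg: "0 \<le> K"
    and imaginary_bound:
      "s \<noteq> 0 \<Longrightarrow> x \<in> D \<Longrightarrow> norm (C x) \<le> K * norm ((\<i> * complex_of_real s) *\<^sub>C x + A x)"
begin

lemma C_linear: "bounded_linear C"
  by (simp add: C_clinear bounded_clinear_bounded_linear)

text \<open>The bound spreads from the imaginary axis to the half-plane, because moving from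
  \<open>i s\<close> to \<open>e + i s\<close> changes \<open>l x + A x\<close> by \<open>e x\<close>, and \<open>e \<parallel>x\<parallel> \<le> M \<parallel>l x + A x\<parallel>\<close>.\<close>

lemma half_plane_bound:
  assumes l: "0 < Re l" and x: "x \<in> D"
  shows "norm (C x) \<le> K * (1 + M) * norm (l *\<^sub>C x + A x)"
proof -
  have nonreal: "norm (C x) \<le> K * (1 + M) * norm (l *\<^sub>C x + A x)"
    if l: "0 < Re l" and im: "Im l \<noteq> 0" for l
  proof -
    define y where "y = l *\<^sub>C x + A x"
    have "l = complex_of_real (Re l) + \<i> * complex_of_real (Im l)"
      by (simp add: complex_eq_iff)
    then have "l *\<^sub>C x = Re l *\<^sub>R x + (\<i> * complex_of_real (Im l)) *\<^sub>C x"
      by (metis scaleC_add_left scaleC_of_real)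
    then have eq: "(\<i> * complex_of_real (Im l)) *\<^sub>C x + A x = y - Re l *\<^sub>R x"
      by (simp add: y_def)
    have "norm (C x) \<le> K * norm (y - Re l *\<^sub>R x)"
      using imaginary_bound[OF im x] by (simp only: eq)
    also have "\<dots> \<le> K * (norm y + M * norm y)"
    proof (rule mult_left_mono[OF _ K_nonneg])
      have "Re l * norm x \<le> M * norm y"
        unfolding y_def using norm_dissipative[OF _ x] l by simp
      then show "norm (y - Re l *\<^sub>R x) \<le> norm y + M * norm y"
        using norm_triangle_ineq4[of y "Re l *\<^sub>R x"] l by simp
    qed
    finally show ?thesis by (simp add: y_def algebra_simps)
  qed
  show ?thesis
  proof (cases "Im l = 0")
    case True
    define y where "y = l *\<^sub>C x + A x"
    have "norm (C x) \<le> K * (1 + M) * (norm y + \<eta> * norm x)" if \<eta>: "0 < \<eta>" for \<eta>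
    proof -
      have "norm (C x) \<le> K * (1 + M) * norm ((l + \<i> * complex_of_real \<eta>) *\<^sub>C x + A x)"
        using \<eta> l True by (intro nonreal) auto
      also have "(l + \<i> * complex_of_real \<eta>) *\<^sub>C x + A x = y + (\<i> * complex_of_real \<eta>) *\<^sub>C x"
        by (simp add: y_def scaleC_add_left)
      also have "norm \<dots> \<le> norm y + norm ((\<i> * complex_of_real \<eta>) *\<^sub>C x)"
        by (rule norm_triangle_ineq)
      also have "norm ((\<i> * complex_of_real \<eta>) *\<^sub>C x) = \<eta> * norm x"
        using \<eta> by (simp add: norm_scaleC norm_mult)
      finally show ?thesis using K_nonneg M_ge_0 by (simp add: mult_left_mono)
    qed
    then have "\<forall>\<^sub>F \<eta> in at_right 0. norm (C x) \<le> K * (1 + M) * (norm y + \<eta> * norm x)"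
      using eventually_at_right_less[of "0::real"] by (auto elim: eventually_mono)
    moreover have "((\<lambda>\<eta>. K * (1 + M) * (norm y + \<eta> * norm x))
        \<longlongrightarrow> K * (1 + M) * (norm y + 0 * norm x)) (at_right 0)"
      by (intro tendsto_intros)
    ultimately show ?thesis
      unfolding y_def[symmetric] by (auto intro: tendsto_lowerbound)
  qed (use nonreal[OF l] in simp)
qed

text \<open>With \<open>g n = \<phi> n r\<^sup>n V\<^sup>n x\<close> and \<open>f n = (\<phi> (n + 1) - \<phi> n) r\<^sup>n V\<^sup>n x\<close> one has \<open>g (n + 1) = r V (f n + g n)\<close>, the
  discrete form of \<open>g' + A g = f\<close>. Because \<open>\<phi>\<close> vanishes at both ends, the finite Fourier transform
  turns this into \<open>(l + A) F g = (z / h) F f\<close> with \<open>z = r w\<close> and \<open>l = (1 - z) / h\<close>, and the half-plane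
  bound for \<open>C\<close> applies frequency by frequency. The damping factor \<open>r < 1\<close> keeps \<open>l\<close> away
  from the origin at the frequency \<open>w = 1\<close>.\<close>

lemma damped_euler_sum_bound:
  fixes m :: nat
  assumes h: "0 < h" and r: "0 < r" "r < 1" and m: "0 < m"
  shows "(\<Sum>n\<le>m. (real n)\<^sup>2 * r ^ (2 * n) * (norm (C ((euler h ^^ n) x)))\<^sup>2)
    \<le> (K * (1 + M) / h)\<^sup>2 * (2 * real m * (M * norm x)\<^sup>2)"
proof -
  define N where "N = 2 * m"
  define K' where "K' = K * (1 + M)"
  define V where "V n = (euler h ^^ n) x" for n
  \<comment> \<open>a tent of height \<open>m\<close> on the interval from \<open>0\<close> to \<open>2 m\<close>\<close>
  define \<phi> where "\<phi> n = real (min n (N - n))" for n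
  define g where "g n = (\<phi> n * r ^ n) *\<^sub>R V n" for n
  define f where "f n = ((\<phi> (Suc n) - \<phi> n) * r ^ n) *\<^sub>R V n" for n
  define w where "w k = cis (2 * pi * real k / real N)" for k
  define F where "F v k = (\<Sum>n<N. w k ^ n *\<^sub>C v n)" for v :: "nat \<Rightarrow> 'a" and k
  have N: "0 < N" using m by (simp add: N_def)
  have K': "0 \<le> K'" using K_nonneg M_ge_0 by (simp add: K'_def)
  have parseval: "(\<Sum>k<N. (norm (F v k))\<^sup>2) = real N * (\<Sum>n<N. (norm (v n))\<^sup>2)" for v
    unfolding F_def w_def by (rule finite_Parseval)
  have lin: "bounded_linear (euler h)"
    by (intro bounded_clinear_bounded_linear euler_clinear h)
  have step: "g (Suc n) = r *\<^sub>R euler h (f n + g n)" for n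
    by (simp add: g_def f_def V_def linear_simps[OF lin] algebra_simps flip: scaleR_add_left)
  have ends: "g 0 = 0" "g N = 0"
    by (simp_all add: g_def \<phi>_def)
  have transform: "F g k = (w k * complex_of_real r) *\<^sub>C euler h (F f k + F g k)" for k
  proof -
    have "F g k = (\<Sum>n<N. w k ^ Suc n *\<^sub>C g (Suc n))"
    proof -
      have "F g k + w k ^ N *\<^sub>C g N = w k ^ 0 *\<^sub>C g 0 + (\<Sum>n<N. w k ^ Suc n *\<^sub>C g (Suc n))"
        unfolding F_def using sum.lessThan_Suc[of "\<lambda>n. w k ^ n *\<^sub>C g n" N]
          sum.lessThan_Suc_shift[of "\<lambda>n. w k ^ n *\<^sub>C g n" N] by (simp only:)
      then show ?thesis by (simp add: ends scaleC.zero_right)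
    qed
    also have "\<dots> = (\<Sum>n<N. (w k * complex_of_real r) *\<^sub>C euler h (w k ^ n *\<^sub>C (f n + g n)))"
    proof (rule sum.cong[OF refl])
      fix n
      have "w k ^ Suc n *\<^sub>C g (Suc n) = w k ^ Suc n *\<^sub>C complex_of_real r *\<^sub>C euler h (f n + g n)"
        by (simp only: step scaleC_of_real)
      then show "w k ^ Suc n *\<^sub>C g (Suc n)
          = (w k * complex_of_real r) *\<^sub>C euler h (w k ^ n *\<^sub>C (f n + g n))"
        by (simp only: bounded_clinear_scaleC[OF euler_clinear[OF h]] scaleC_scaleC power_Suc mult_ac)
    qed
    also have "\<dots> = (w k * complex_of_real r) *\<^sub>C euler h (\<Sum>n<N. w k ^ n *\<^sub>C (f n + g n))"
      by (simp only: scaleC.sum_right linear_sum[OF bounded_linear.linear[OF lin]])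
    also have "(\<Sum>n<N. w k ^ n *\<^sub>C (f n + g n)) = F f k + F g k"
      by (simp add: F_def scaleC_add_right sum.distrib)
    finally show ?thesis .
  qed
  have bound: "norm (C (F g k)) \<le> K' / h * norm (F f k)" for k
  proof -
    define z where "z = w k * complex_of_real r"
    define l where "l = (1 - z) / complex_of_real h"
    have z: "cmod z = r" using r by (simp add: z_def w_def norm_mult)
    have G: "F g k = z *\<^sub>C euler h (F f k + F g k)"
      unfolding z_def by (rule transform)
    have GD: "F g k \<in> D"
      by (subst G) (intro D_scaleC euler_D h)
    have "F g k + h *\<^sub>R A (F g k) = z *\<^sub>C (F f k + F g k)"
    proof -
      have "A (F g k) = z *\<^sub>C A (euler h (F f k + F g k))"
        by (subst G) (intro D_scaleC(2) euler_D h)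
      then have "F g k + h *\<^sub>R A (F g k)
          = z *\<^sub>C (euler h (F f k + F g k) + h *\<^sub>R A (euler h (F f k + F g k)))"
        using G by (simp add: scaleC.add_right scaleC.scaleR_right)
      then show ?thesis by (simp only: euler_inverse[OF h])
    qed
    then have "(1 - z) *\<^sub>C F g k + h *\<^sub>R A (F g k) = z *\<^sub>C F f k"
      by (simp add: scaleC.diff_left scaleC_add_right algebra_simps)
    moreover have "(1 - z) *\<^sub>C F g k = h *\<^sub>R l *\<^sub>C F g k"
      using h by (simp add: l_def flip: scaleC_of_real)
    ultimately have "h *\<^sub>R (l *\<^sub>C F g k + A (F g k)) = z *\<^sub>C F f k"
      by (simp add: scaleR_add_right)
    then have "h * norm (l *\<^sub>C F g k + A (F g k)) = r * norm (F f k)"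
      using h by (metis abs_of_pos norm_scaleC norm_scaleR z)
    also have "\<dots> \<le> norm (F f k)" using r by (simp add: mult_left_le_one_le)
    finally have "norm (l *\<^sub>C F g k + A (F g k)) \<le> norm (F f k) / h"
      using h by (simp add: field_simps)
    moreover have "0 < Re l"
      using complex_Re_le_cmod[of z] z r h by (simp add: l_def Re_divide_of_real)
    ultimately show ?thesis
      using half_plane_bound[OF _ GD, of l] mult_left_mono[OF _ K'] by (fastforce simp: K'_def)
  qed
  have CF: "C (F g k) = F (\<lambda>n. C (g n)) k" for k
    by (simp add: F_def linear_sum[OF bounded_linear.linear[OF C_linear]]
        bounded_clinear_scaleC[OF C_clinear])
  have "real N * (\<Sum>n<N. (norm (C (g n)))\<^sup>2) = (\<Sum>k<N. (norm (C (F g k)))\<^sup>2)"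
    by (simp add: CF parseval)
  also have "\<dots> \<le> (\<Sum>k<N. (K' / h * norm (F f k))\<^sup>2)"
    by (intro sum_mono power_mono bound) simp
  also have "\<dots> = real N * ((K' / h)\<^sup>2 * (\<Sum>n<N. (norm (f n))\<^sup>2))"
    by (simp only: power_mult_distrib sum_distrib_left[symmetric] parseval mult.left_commute)
  finally have main: "(\<Sum>n<N. (norm (C (g n)))\<^sup>2) \<le> (K' / h)\<^sup>2 * (\<Sum>n<N. (norm (f n))\<^sup>2)"
    using N by (simp add: mult_le_cancel_left)
  have "(norm (f n))\<^sup>2 \<le> (M * norm x)\<^sup>2" if "n < N" for n
  proof -
    have "\<bar>\<phi> (Suc n) - \<phi> n\<bar> \<le> 1"
      using that by (auto simp: \<phi>_def min_def)
    moreover have "r ^ n \<le> 1" using r by (simp add: power_le_one)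
    ultimately have "\<bar>(\<phi> (Suc n) - \<phi> n) * r ^ n\<bar> \<le> 1"
      using r by (simp add: abs_mult mult_le_one)
    then have "norm (f n) \<le> 1 * norm (V n)"
      unfolding f_def norm_scaleR by (rule mult_right_mono) simp
    also have "1 * norm (V n) \<le> M * norm x" using norm_euler_power[OF h] by (simp add: V_def)
    finally show ?thesis by (intro power_mono) auto
  qed
  then have "(\<Sum>n<N. (norm (f n))\<^sup>2) \<le> real N * (M * norm x)\<^sup>2"
    using sum_bounded_above[of "{..<N}" "\<lambda>n. (norm (f n))\<^sup>2" "(M * norm x)\<^sup>2"] by simp
  then have "(\<Sum>n<N. (norm (C (g n)))\<^sup>2) \<le> (K' / h)\<^sup>2 * (real N * (M * norm x)\<^sup>2)"
    using main by (meson mult_left_mono order_trans zero_le_power2)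
  moreover have "(\<Sum>n\<le>m. (norm (C (g n)))\<^sup>2) \<le> (\<Sum>n<N. (norm (C (g n)))\<^sup>2)"
    using m by (intro sum_mono2) (auto simp: N_def)
  moreover have "(norm (C (g n)))\<^sup>2 = (real n)\<^sup>2 * r ^ (2 * n) * (norm (C ((euler h ^^ n) x)))\<^sup>2"
    if "n \<le> m" for n
  proof -
    have "\<phi> n = real n" using that by (simp add: \<phi>_def N_def min_def)
    then show ?thesis
      using r by (simp add: g_def V_def linear_simps[OF C_linear] power_mult_distrib power_mult
          mult.commute[of 2] abs_mult)
  qed
  ultimately show ?thesis by (simp add: K'_def N_def)
qed

text \<open>Letting the damping tend to \<open>1\<close> bounds \<open>\<Sum>\<^bsub>n\<le>m\<^esub> n\<^sup>2 \<parallel>C V\<^sup>n x\<parallel>\<^sup>2\<close> by a multiple of \<open>m / h\<^sup>2\<close>. Since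
  \<open>\<parallel>C V\<^sup>m x\<parallel> \<le> M \<parallel>C V\<^sup>n x\<parallel>\<close> for \<open>n \<le> m\<close>, the sum is at least a multiple of \<open>m\<^sup>3 \<parallel>C V\<^sup>m x\<parallel>\<^sup>2\<close>, and the decay
  rate \<open>1 / (m h)\<close> results.\<close>

lemma euler_power_bound:
  assumes h: "0 < h" and m: "0 < m"
  shows "norm (C ((euler h ^^ m) x)) \<le> 3 * K * (1 + M) * M\<^sup>2 / (real m * h) * norm x"
proof -
  define c where "c n = norm (C ((euler h ^^ n) x))" for n
  define b where "b = (K * (1 + M) / h)\<^sup>2 * (2 * real m * (M * norm x)\<^sup>2)"
  have damped: "(\<Sum>n\<le>m. (real n)\<^sup>2 * (c n)\<^sup>2) \<le> b"
  proof -
    have "((\<lambda>r. \<Sum>n\<le>m. (real n)\<^sup>2 * r ^ (2 * n) * (c n)\<^sup>2)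
        \<longlongrightarrow> (\<Sum>n\<le>m. (real n)\<^sup>2 * 1 ^ (2 * n) * (c n)\<^sup>2)) (at_left 1)"
      by (intro tendsto_intros)
    moreover have "\<forall>\<^sub>F r in at_left 1. (\<Sum>n\<le>m. (real n)\<^sup>2 * r ^ (2 * n) * (c n)\<^sup>2) \<le> b"
    proof (rule eventually_mono)
      show "\<forall>\<^sub>F r in at_left 1. r \<in> {0<..<1::real}"
        by (rule eventually_at_left_real) simp
    qed (use damped_euler_sum_bound[OF h _ _ m] in \<open>simp add: b_def c_def\<close>)
    ultimately show ?thesis
      by (auto intro: tendsto_upperbound)
  qed
  have "c m \<le> M * c n" if "n \<le> m" for n
  proof -
    have "(euler h ^^ m) x = (euler h ^^ (m - n)) ((euler h ^^ n) x)"
      using that funpow_add[of "m - n" n "euler h"] by simp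
    moreover have "(euler h ^^ (m - n)) (C y) = C ((euler h ^^ (m - n)) y)" for y
      by (rule funpow_comm_apply) (simp add: euler_commute[OF h C_linear C_commute])
    ultimately show ?thesis
      unfolding c_def using norm_euler_power[OF h, of "m - n" "C ((euler h ^^ n) x)"] by simp
  qed
  then have "(\<Sum>n\<le>m. (real n)\<^sup>2 * (c m)\<^sup>2) \<le> (\<Sum>n\<le>m. (real n)\<^sup>2 * (M * c n)\<^sup>2)"
    by (intro sum_mono mult_left_mono power_mono) (auto simp: c_def)
  moreover have "(\<Sum>n\<le>m. (real n)\<^sup>2 * (M * c n)\<^sup>2) = M\<^sup>2 * (\<Sum>n\<le>m. (real n)\<^sup>2 * (c n)\<^sup>2)"
    by (simp add: power_mult_distrib sum_distrib_left mult.left_commute)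
  moreover have "real m ^ 3 / 3 * (c m)\<^sup>2 \<le> (\<Sum>n\<le>m. (real n)\<^sup>2) * (c m)\<^sup>2"
    by (intro mult_right_mono cube_le_sum_squares) simp
  ultimately have "real m ^ 3 / 3 * (c m)\<^sup>2 \<le> M\<^sup>2 * b"
    using mult_left_mono[OF damped zero_le_power2[of M]] unfolding sum_distrib_right[symmetric]
    by linarith
  then have "real m ^ 3 * (c m)\<^sup>2 \<le> 3 * (M\<^sup>2 * b)" by simp
  also have "\<dots> = real m * (6 * (K * (1 + M) * M\<^sup>2 / h * norm x)\<^sup>2)"
    by (simp add: b_def power_mult_distrib power_divide)
  also have "\<dots> \<le> real m * (9 * (K * (1 + M) * M\<^sup>2 / h * norm x)\<^sup>2)"
    by (intro mult_left_mono) auto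
  also have "\<dots> = real m * (3 * K * (1 + M) * M\<^sup>2 / h * norm x)\<^sup>2"
    by (simp add: power_mult_distrib power_divide)
  finally have "real m * (real m * c m)\<^sup>2 \<le> real m * (3 * K * (1 + M) * M\<^sup>2 / h * norm x)\<^sup>2"
    by (simp add: power_mult_distrib power3_eq_cube power2_eq_square mult_ac)
  then have "(real m * c m)\<^sup>2 \<le> (3 * K * (1 + M) * M\<^sup>2 / h * norm x)\<^sup>2"
    using m by simp
  then have "real m * c m \<le> 3 * K * (1 + M) * M\<^sup>2 / h * norm x"
    by (rule power2_le_imp_le) (use K_nonneg M_ge_0 h in simp)
  then show ?thesis using h m by (simp add: c_def field_simps)
qed

lemma decay:
  assumes t: "0 < t"
  shows "norm (T t (C x)) \<le> 3 * K * (1 + M) * M\<^sup>2 / t * norm x"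
proof -
  have "(\<lambda>n. norm (C ((euler (t / real (Suc n)) ^^ Suc n) x))) \<longlonglongrightarrow> norm (C (T t x))"
    by (intro tendsto_norm bounded_linear.tendsto[OF C_linear] euler_converges t)
  moreover have "norm (C ((euler (t / real (Suc n)) ^^ Suc n) x)) \<le> 3 * K * (1 + M) * M\<^sup>2 / t * norm x" for n
    using euler_power_bound[of "t / real (Suc n)" "Suc n" x] t by (simp del: of_nat_Suc funpow.simps)
  ultimately have "norm (C (T t x)) \<le> 3 * K * (1 + M) * M\<^sup>2 / t * norm x"
    by (intro tendsto_upperbound[of _ _ sequentially]) auto
  then show ?thesis using t by (simp add: C_commute)
qed

end

section \<open>Improper integrals of Banach space valued functions\<close>

lemma convergent_if_Cauchy_filter:
  fixes f :: "'c \<Rightarrow> 'b::banach"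
  assumes F: "F \<noteq> bot"
    and cauchy: "\<And>e. 0 < e \<Longrightarrow> \<exists>P. eventually P F \<and> (\<forall>x y. P x \<and> P y \<longrightarrow> dist (f x) (f y) < e)"
  obtains l where "(f \<longlongrightarrow> l) F"
proof -
  have "cauchy_filter (filtermap f F)"
    using cauchy by (simp add: cauchy_filter_metric_filtermap)
  moreover have "complete (UNIV::'b set)"
    by (meson Cauchy_convergent UNIV_I complete_def convergent_def)
  ultimately obtain l where "filtermap f F \<le> nhds l"
    using F unfolding complete_uniform
    by (metis filtermap_bot_iff principal_UNIV top_greatest)
  then show ?thesis using that by (simp add: filterlim_def)
qed

text \<open>A continuous function on the half-line that is dominated by an integrable real function
  has a primitive with limits at both ends, by the Cauchy criterion, and the fundamental theorem
  of calculus applies to this primitive.\<close>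

lemma integrable_dominated_half_line:
  fixes f :: "real \<Rightarrow> 'b::banach" and g :: "real \<Rightarrow> real"
  assumes f: "continuous_on {0<..} f" and g: "g integrable_on {0<..}"
    and le: "\<And>s. 0 < s \<Longrightarrow> norm (f s) \<le> g s"
  shows "f integrable_on {0<..}"
proof -
  define g' where "g' s = (if 0 < s then g s else 0)" for s
  define \<Gamma> where "\<Gamma> t = integral {0..t} g'" for t
  define \<Psi> where "\<Psi> t = integral {1..t} f - integral {t..1} f" for t
  have g'_UNIV: "g' integrable_on UNIV"
    using g integrable_restrict_UNIV[of "{0<..}" g] by (simp add: g'_def[abs_def])
  have g'_int: "g' integrable_on {a..b}" for a b
    by (rule integrable_on_subinterval[OF g'_UNIV]) simp
  have g'_nonneg: "0 \<le> g' s" for s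
    using le[of s] norm_ge_zero[of "f s"] by (auto simp: g'_def simp del: norm_ge_zero)
  have f_int: "f integrable_on {a..b}" if "0 < a" for a b
    by (rule integrable_continuous_real, rule continuous_on_subset[OF f]) (use that in auto)
  have \<Gamma>_diff: "\<Gamma> t - \<Gamma> s = integral {s..t} g'" if "0 \<le> s" "s \<le> t" for s t
    using Henstock_Kurzweil_Integration.integral_combine[OF that g'_int] by (simp add: \<Gamma>_def)
  have \<Gamma>_mono: "\<Gamma> s \<le> \<Gamma> t" if "0 \<le> s" "s \<le> t" for s t
    using \<Gamma>_diff[OF that] integral_nonneg[OF g'_int, of s t] g'_nonneg by simp
  have empty: "integral {u..v} f = 0" if "v \<le> u" for u v
    using that by (cases "u = v") auto
  have \<Psi>_diff: "\<Psi> t - \<Psi> s = integral {s..t} f" if "0 < s" "s \<le> t" for s t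
  proof -
    consider "t \<le> 1" | "s \<le> 1" "1 \<le> t" | "1 \<le> s" by linarith
    then show ?thesis
    proof cases
      case 1
      have "integral {s..t} f + integral {t..1} f = integral {s..1} f"
        by (rule Henstock_Kurzweil_Integration.integral_combine) (use 1 that f_int in simp_all)
      moreover have "integral {1..t} f = 0" "integral {1..s} f = 0" using 1 that by (simp_all add: empty)
      ultimately show ?thesis unfolding \<Psi>_def by simp (metis add_diff_cancel_right')
    next
      case 2
      have "integral {s..1} f + integral {1..t} f = integral {s..t} f"
        by (rule Henstock_Kurzweil_Integration.integral_combine) (use 2 that f_int in simp_all)
      moreover have "integral {t..1} f = 0" "integral {1..s} f = 0" using 2 that by (simp_all add: empty)
      ultimately show ?thesis unfolding \<Psi>_def by (simp add: add.commute)
    next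
      case 3
      have "integral {1..s} f + integral {s..t} f = integral {1..t} f"
        by (rule Henstock_Kurzweil_Integration.integral_combine) (use 3 that f_int in simp_all)
      moreover have "integral {t..1} f = 0" "integral {s..1} f = 0" using 3 that by (simp_all add: empty)
      ultimately show ?thesis unfolding \<Psi>_def by simp (metis add_diff_cancel_left')
    qed
  qed
  have \<Psi>_le: "norm (\<Psi> t - \<Psi> s) \<le> \<Gamma> t - \<Gamma> s" if "0 < s" "s \<le> t" for s t
    unfolding \<Psi>_diff[OF that] using that
    by (simp add: \<Gamma>_diff, intro integral_norm_bound_integral f_int g'_int)
      (auto simp: g'_def intro: le)
  have \<Psi>_dist: "dist (\<Psi> t) (\<Psi> s) \<le> \<bar>\<Gamma> t - \<Gamma> s\<bar>" if "0 < s" "0 < t" for s t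
    using \<Psi>_le[of s t] \<Psi>_le[of t s] that by (cases "s \<le> t") (auto simp: dist_norm norm_minus_commute)
  have \<Psi>_deriv: "(\<Psi> has_vector_derivative f x) (at x)" if x: "0 < x" for x
  proof -
    have "continuous_on {x/2..x + 1} f"
      by (rule continuous_on_subset[OF f]) (use x in auto)
    then have "((\<lambda>u. integral {x/2..u} f) has_vector_derivative f x) (at x within {x/2..x + 1})"
      by (rule integral_has_vector_derivative) (use x in auto)
    moreover have "at x within {x/2..x + 1} = at x"
      by (rule at_within_Icc_at) (use x in auto)
    ultimately have "((\<lambda>u. integral {x/2..u} f) has_vector_derivative f x) (at x)"
      by (simp only:)
    then have "((\<lambda>u. integral {x/2..u} f + \<Psi> (x/2)) has_vector_derivative f x) (at x)"
      by (simp only: has_vector_derivative_add_const)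
    then show ?thesis
    proof (rule has_vector_derivative_transform_within_open)
      show "open {x/2<..}" "x \<in> {x/2<..}" using x by auto
      show "integral {x/2..u} f + \<Psi> (x/2) = \<Psi> u" if "u \<in> {x/2<..}" for u
        using \<Psi>_diff[of "x/2" u] that x by (auto simp: algebra_simps)
    qed
  qed
  obtain l where l: "(\<Psi> \<longlongrightarrow> l) (at_right 0)"
  proof (rule convergent_if_Cauchy_filter[of "at_right (0::real)" \<Psi>])
    fix e :: real assume e: "0 < e"
    have "continuous_on {0..1} \<Gamma>"
      unfolding \<Gamma>_def by (rule indefinite_integral_continuous_1[OF g'_int])
    then have "(\<Gamma> \<longlongrightarrow> \<Gamma> 0) (at_right 0)"
      by (simp add: continuous_on_Icc_at_rightD)
    moreover have "\<Gamma> 0 = 0" by (simp add: \<Gamma>_def)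
    ultimately have "\<forall>\<^sub>F s in at_right 0. \<Gamma> s < e"
      using e by (intro order_tendstoD(2)[of \<Gamma> 0]) auto
    then have "\<forall>\<^sub>F s in at_right 0. 0 < s \<and> \<Gamma> s < e"
      using eventually_at_right_less[of "0::real"] by eventually_elim simp
    moreover have "dist (\<Psi> t) (\<Psi> s) < e" if "0 < s \<and> \<Gamma> s < e" "0 < t \<and> \<Gamma> t < e" for s t
      using \<Psi>_dist[of s t] \<Gamma>_mono[of 0 s] \<Gamma>_mono[of 0 t] that \<open>\<Gamma> 0 = 0\<close> by auto
    ultimately show "\<exists>P. eventually P (at_right 0) \<and> (\<forall>x y. P x \<and> P y \<longrightarrow> dist (\<Psi> x) (\<Psi> y) < e)"
      by blast
  qed simp_all
  obtain r where r: "(\<Psi> \<longlongrightarrow> r) at_top"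
  proof (rule convergent_if_Cauchy_filter[of "at_top :: real filter" \<Psi>])
    fix e :: real assume e: "0 < e"
    define S where "S = Sup (\<Gamma> ` {0..})"
    have "\<Gamma> t \<le> integral UNIV g'" if "0 \<le> t" for t
      unfolding \<Gamma>_def by (rule integral_subset_le) (use g'_int g'_UNIV g'_nonneg in auto)
    then have bdd: "bdd_above (\<Gamma> ` {0..})" by (intro bdd_aboveI2[of _ _ "integral UNIV g'"]) simp
    have le_S: "\<Gamma> t \<le> S" if "0 \<le> t" for t
      unfolding S_def using that bdd by (intro cSup_upper) simp_all
    have "S - e < Sup (\<Gamma> ` {0..})" using e by (simp add: S_def)
    then obtain t0 where t0: "0 \<le> t0" "S - e < \<Gamma> t0"
      using less_cSup_iff[OF _ bdd, of "S - e"] by auto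
    have near: "S - e < \<Gamma> t \<and> \<Gamma> t \<le> S" if "t0 < t" for t
      using \<Gamma>_mono[of t0 t] le_S[of t] t0 that by auto
    have "dist (\<Psi> s) (\<Psi> t) < e" if "t0 < s" "t0 < t" for s t
      using \<Psi>_dist[of t s] near[OF that(1)] near[OF that(2)] that t0(1) by (auto simp: abs_less_iff)
    then show "\<exists>P. eventually P at_top \<and> (\<forall>x y. P x \<and> P y \<longrightarrow> dist (\<Psi> x) (\<Psi> y) < e)"
      using eventually_gt_at_top[of t0] by blast
  qed simp_all
  define \<Phi> where "\<Phi> t = (if t \<le> 0 then l else \<Psi> t)" for t
  define f' where "f' s = (if s \<in> {0<..} then f s else 0)" for s
  have \<Phi>_deriv: "(\<Phi> has_vector_derivative f' x) (at x)" if "0 < x" for x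
  proof -
    have "(\<Phi> has_vector_derivative f x) (at x)"
      by (rule has_vector_derivative_transform_within_open[OF \<Psi>_deriv[OF that], of "{0<..}"])
        (use that in \<open>auto simp: \<Phi>_def\<close>)
    then show ?thesis using that by (simp add: f'_def)
  qed
  have \<Phi>_cont: "(\<Phi> \<longlongrightarrow> \<Phi> x) (at x)" if "0 < x" for x
    using has_vector_derivative_continuous[OF \<Phi>_deriv[OF that]] by (simp only: continuous_at)
  have int_right: "(f' has_integral \<Phi> b - l) {0..b}" if b: "0 < b" for b
  proof -
    have "continuous_on {0..b} \<Phi>"
    proof (rule continuous_on_IccI)
      show "(\<Phi> \<longlongrightarrow> \<Phi> 0) (at_right 0)"
      proof (rule Lim_transform_eventually)
        show "(\<Psi> \<longlongrightarrow> \<Phi> 0) (at_right 0)" using l by (simp add: \<Phi>_def)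
        show "\<forall>\<^sub>F t in at_right 0. \<Psi> t = \<Phi> t"
          using eventually_at_right_less[of "0::real"] by eventually_elim (simp add: \<Phi>_def)
      qed
      show "(\<Phi> \<longlongrightarrow> \<Phi> b) (at_left b)"
        by (rule tendsto_mono[OF at_le \<Phi>_cont[OF b]]) simp
      show "\<Phi> \<midarrow>x\<rightarrow> \<Phi> x" if "0 < x" "x < b" for x
        by (rule \<Phi>_cont[OF that(1)])
    qed (use b in simp)
    from fundamental_theorem_of_calculus_interior[OF _ this, of f'] show ?thesis
      using \<Phi>_deriv b by (simp add: \<Phi>_def)
  qed
  have int_box: "(f' has_integral \<Phi> b - l) {a..b}" if "a \<le> 0" "0 < b" for a b
  proof -
    have "(f' has_integral 0) {a..0}"
      by (rule has_integral_is_0) (auto simp: f'_def)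
    from has_integral_combine[OF that(1) _ this int_right[OF that(2)]] that show ?thesis by simp
  qed
  have not_box: "\<nexists>a b. {0<..} = cbox a (b::real)"
  proof safe
    fix a b :: real assume eq: "{0<..} = cbox a b"
    have "max b 0 + 1 \<in> {0<..}" by auto
    then have "max b 0 + 1 \<in> cbox a b" by (simp only: eq)
    then show False by auto
  qed
  have "(f has_integral r - l) {0<..}"
  proof (subst has_integral_alt, subst if_not_P[OF not_box], intro allI impI)
    fix e :: real assume e: "0 < e"
    obtain t0 where t0: "\<And>t. t0 \<le> t \<Longrightarrow> dist (\<Psi> t) r < e"
      using tendstoD[OF r e] by (auto simp: eventually_at_top_linorder)
    have "\<exists>z. ((\<lambda>x. if x \<in> {0<..} then f x else 0) has_integral z) (cbox a b) \<and> norm (z - (r - l)) < e"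
      if "ball 0 (max t0 0 + 1) \<subseteq> cbox a b" for a b
    proof -
      have ab: "a \<le> 0" "0 < b" "t0 \<le> b"
        using subsetD[OF that, of 0] subsetD[OF that, of "max t0 0 + 1/2"] by (auto simp: dist_real_def)
      from int_box[OF ab(1,2)] have "(f' has_integral (\<Psi> b - l)) (cbox a b)"
        using ab by (simp add: \<Phi>_def)
      moreover have "norm ((\<Psi> b - l) - (r - l)) < e"
        using t0[OF ab(3)] by (simp add: dist_norm)
      ultimately show ?thesis unfolding f'_def[abs_def] by blast
    qed
    then show "\<exists>B>0. \<forall>a b. ball 0 B \<subseteq> cbox a b \<longrightarrow>
        (\<exists>z. ((\<lambda>x. if x \<in> {0<..} then f x else 0) has_integral z) (cbox a b) \<and> norm (z - (r - l)) < e)"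
      by (intro exI[of _ "max t0 0 + 1"]) auto
  qed
  then show ?thesis by blast
qed

text \<open>The two bounds are integrable near \<open>0\<close> and near infinity, respectively; switching between them
  at \<open>a\<close> gives the homogeneity \<open>a\<^sup>\<theta>\<close> of the result.\<close>

lemma powr_dominated_integral:
  fixes f :: "real \<Rightarrow> 'b::banach"
  assumes \<theta>: "0 < \<theta>" "\<theta> < 1" and a: "0 < a"
    and f: "continuous_on {0<..} f"
    and le: "\<And>s. 0 < s \<Longrightarrow> norm (f s) \<le> k * s powr (\<theta> - 1)"
      "\<And>s. 0 < s \<Longrightarrow> norm (f s) \<le> k * (a * s powr (\<theta> - 2))"
  shows "f integrable_on {0<..}" and "norm (integral {0<..} f) \<le> k * (a powr \<theta> / (\<theta> * (1 - \<theta>)))"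
proof -
  define g where "g s = (if s \<le> a then s powr (\<theta> - 1) else a * s powr (\<theta> - 2))" for s
  have "((\<lambda>s. s powr (\<theta> - 1)) has_integral (a powr \<theta> / \<theta>)) {0..a}"
    using has_integral_powr_from_0[of "\<theta> - 1" a] \<theta> a by simp
  then have 1: "(g has_integral (a powr \<theta> / \<theta>)) {0..a}"
    by (rule has_integral_eq[rotated]) (simp add: g_def)
  have cont: "a * a powr (\<theta> - 2) = a powr (\<theta> - 1)"
    using a powr_add[of a 1 "\<theta> - 2"] by simp
  have "((\<lambda>s. s powr (\<theta> - 2)) has_integral (a powr (\<theta> - 1) / (1 - \<theta>))) {a..}"
  proof -
    have "- (a powr (\<theta> - 2 + 1)) / (\<theta> - 2 + 1) = a powr (\<theta> - 1) / (1 - \<theta>)"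
      using nonzero_minus_divide_divide[of "1 - \<theta>" "a powr (\<theta> - 1)"] \<theta> by simp
    then show ?thesis
      using has_integral_powr_to_inf[of "\<theta> - 2" a] \<theta> a by (simp only:)
  qed
  from has_integral_mult_right[OF this, of a]
  have *: "((\<lambda>s. a * s powr (\<theta> - 2)) has_integral (a powr \<theta> / (1 - \<theta>))) {a..}"
    using a powr_add[of a 1 "\<theta> - 1"] by simp
  have 2: "(g has_integral (a powr \<theta> / (1 - \<theta>))) {a..}"
    by (intro has_integral_eq[OF _ *]) (auto simp: g_def cont)
  have "(g has_integral (a powr \<theta> / \<theta> + a powr \<theta> / (1 - \<theta>))) ({0..a} \<union> {a..})"
    by (rule has_integral_Un[OF 1 2]) (use a in auto)
  also have "{0..a} \<union> {a..} = {0..}" using a by auto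
  also have "a powr \<theta> / \<theta> + a powr \<theta> / (1 - \<theta>) = a powr \<theta> / (\<theta> * (1 - \<theta>))"
    using \<theta> by (simp add: field_simps)
  finally have *: "(g has_integral (a powr \<theta> / (\<theta> * (1 - \<theta>)))) {0..}" .
  have "(g has_integral (a powr \<theta> / (\<theta> * (1 - \<theta>)))) {0<..}"
    by (rule has_integral_spike_set_eq[THEN iffD1, OF _ _ *])
      (auto intro: negligible_subset[of "{0}"])
  from has_integral_mult_right[OF this, of k]
  have kg: "((\<lambda>s. k * g s) has_integral (k * (a powr \<theta> / (\<theta> * (1 - \<theta>))))) {0<..}" .
  have fg: "norm (f s) \<le> k * g s" if "0 < s" for s
    using le[OF that] by (simp add: g_def)
  show int: "f integrable_on {0<..}"
    by (rule integrable_dominated_half_line[OF f has_integral_integrable[OF kg] fg])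
  show "norm (integral {0<..} f) \<le> k * (a powr \<theta> / (\<theta> * (1 - \<theta>)))"
    using integral_norm_bound_integral[OF int has_integral_integrable[OF kg]] fg
    unfolding integral_unique[OF kg] by simp
qed

section \<open>Functional calculus of a bounded sectorial operator\<close>

text \<open>Sectoriality of a bounded operator, expressed by resolvent bounds on the negative half-line:
  \<open>\<parallel>(s + B)\<^sup>-\<^sup>1\<parallel> \<le> K / s\<close> for \<open>s > 0\<close>.\<close>

locale sectorial =
  fixes B :: "'a::complex_hilbert \<Rightarrow> 'a" and K :: real
  assumes B_clinear: "bounded_clinear B"
    and K_ge_1: "1 \<le> K"
    and surj: "0 < s \<Longrightarrow> \<exists>x. s *\<^sub>R x + B x = y"
    and lower_bound: "0 < s \<Longrightarrow> s * norm x \<le> K * norm (s *\<^sub>R x + B x)"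
begin

abbreviation J :: "real \<Rightarrow> 'a \<Rightarrow> 'a"
  where "J s \<equiv> shift_inverse UNIV B (complex_of_real s)"

lemma B_linear: "bounded_linear B"
  by (simp add: B_clinear bounded_clinear_bounded_linear)

lemma K_ge_0: "0 \<le> K"
  using K_ge_1 by simp

lemma J_eq:
  assumes s: "0 < s"
  shows "J s (s *\<^sub>R x + B x) = x"
proof -
  have "inj (\<lambda>x. complex_of_real s *\<^sub>C x + B x)"
  proof (rule injI)
    fix x y assume "complex_of_real s *\<^sub>C x + B x = complex_of_real s *\<^sub>C y + B y"
    then have "s *\<^sub>R (x - y) + B (x - y) = 0"
      by (simp add: linear_simps[OF B_linear] algebra_simps)
    then have "s * norm (x - y) \<le> 0"
      using lower_bound[OF s, of "x - y"] by simp
    then show "x = y" using s by (simp add: mult_le_0_iff)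
  qed
  from inv_into_f_f[OF this, of x] show ?thesis by (simp add: shift_inverse_def)
qed

lemma J_inverse: "0 < s \<Longrightarrow> s *\<^sub>R J s y + B (J s y) = y"
  by (metis J_eq surj)

lemma norm_J: "0 < s \<Longrightarrow> s * norm (J s y) \<le> K * norm y"
  using lower_bound[of s "J s y"] by (simp add: J_inverse)

lemma norm_J': "0 < s \<Longrightarrow> norm (J s y) \<le> K / s * norm y"
  using norm_J[of s y] by (simp add: field_simps)

lemma B_J: "0 < s \<Longrightarrow> B (J s y) = y - s *\<^sub>R J s y"
  using J_inverse[of s y] by (simp add: algebra_simps)

lemma J_commute:
  assumes s: "0 < s" and C: "bounded_linear C" and comm: "\<And>x. C (B x) = B (C x)"
  shows "C (J s y) = J s (C y)"
proof -
  have "s *\<^sub>R C (J s y) + B (C (J s y)) = C (s *\<^sub>R J s y + B (J s y))"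
    by (simp only: linear_simps[OF C] comm)
  then show ?thesis using J_eq[OF s, of "C (J s y)"] by (simp add: J_inverse s)
qed

lemma J_B: "0 < s \<Longrightarrow> J s (B y) = B (J s y)"
  by (rule J_commute[symmetric]) (simp_all add: B_linear)

lemma J_clinear:
  assumes s: "0 < s"
  shows "bounded_clinear (J s)"
proof (rule bounded_clinearI[of _ "K / s"])
  fix x y c
  show "J s (x + y) = J s x + J s y"
  proof -
    have "s *\<^sub>R (J s x + J s y) + B (J s x + J s y)
        = (s *\<^sub>R J s x + B (J s x)) + (s *\<^sub>R J s y + B (J s y))"
      by (simp add: linear_simps[OF B_linear] algebra_simps)
    then show ?thesis using J_eq[OF s, of "J s x + J s y"] by (simp only: J_inverse[OF s])
  qed
  show "J s (c *\<^sub>C x) = c *\<^sub>C J s x"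
    by (rule J_commute[OF s, symmetric])
      (simp_all add: scaleC.bounded_linear_right bounded_clinear_scaleC[OF B_clinear])
  show "norm (J s x) \<le> norm x * (K / s)"
    using norm_J'[OF s, of x] by (simp add: mult.commute)
qed

lemma norm_B_J: "0 < s \<Longrightarrow> norm (B (J s y)) \<le> (1 + K) * norm y"
  using norm_triangle_ineq4[of y "s *\<^sub>R J s y"] norm_J[of s y]
  by (simp add: B_J distrib_right)

lemma J_continuous: "continuous_on {0<..} (\<lambda>s. J s y)"
  unfolding continuous_on_def
proof
  fix r :: real assume "r \<in> {0<..}"
  then have r: "0 < r" by simp
  have bound: "norm (J s y - J r y) \<le> \<bar>r - s\<bar> * (K / s * norm (J r y))" if s: "0 < s" for s
  proof -
    have "y = (s *\<^sub>R J r y + B (J r y)) + (r - s) *\<^sub>R J r y"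
      using J_inverse[OF r, of y] by (simp add: algebra_simps)
    then have "J s y = J s ((s *\<^sub>R J r y + B (J r y)) + (r - s) *\<^sub>R J r y)" by simp
    also have "\<dots> = J s (s *\<^sub>R J r y + B (J r y)) + (r - s) *\<^sub>R J s (J r y)"
      by (simp only: linear_simps[OF bounded_clinear_bounded_linear[OF J_clinear[OF s]]])
    also have "J s (s *\<^sub>R J r y + B (J r y)) = J r y"
      by (rule J_eq[OF s])
    finally have "J s y - J r y = (r - s) *\<^sub>R J s (J r y)" by simp
    then show ?thesis
      using mult_left_mono[OF norm_J'[OF s, of "J r y"], of "\<bar>r - s\<bar>"] by simp
  qed
  have "((\<lambda>s. \<bar>r - s\<bar> * (K / s * norm (J r y))) \<longlongrightarrow> \<bar>r - r\<bar> * (K / r * norm (J r y))) (at r within {0<..})"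
    using r by (intro tendsto_intros) auto
  then have lim: "((\<lambda>s. \<bar>r - s\<bar> * (K / s * norm (J r y))) \<longlongrightarrow> 0) (at r within {0<..})" by simp
  have "\<forall>\<^sub>F s in at r within {0<..}. norm (J s y - J r y) \<le> \<bar>r - s\<bar> * (K / s * norm (J r y))"
    unfolding eventually_at_filter by (intro always_eventually allI impI bound) simp
  from Lim_null_comparison[OF this lim]
  show "((\<lambda>s. J s y) \<longlongrightarrow> J r y) (at r within {0<..})"
    by (simp add: LIM_zero_cancel)
qed

text \<open>On an approximate eigenvector, functions of \<open>B\<close> act up to the same error like the
  functions of the approximate eigenvalue; this is the basic instance.\<close>

lemma J_B_approx:
  assumes s: "0 < s" and w: "B x = \<mu> *\<^sub>C x + w" and nz: "complex_of_real s + \<mu> \<noteq> 0"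
  shows "J s (B x) = (\<mu> / (complex_of_real s + \<mu>)) *\<^sub>C x
    + (complex_of_real s / (complex_of_real s + \<mu>)) *\<^sub>C J s w"
proof -
  define d where "d = complex_of_real s + \<mu>"
  note lin = linear_simps[OF bounded_clinear_bounded_linear[OF J_clinear[OF s]]]
  have "x = J s (d *\<^sub>C x + w)"
    using J_eq[OF s, of x] by (simp add: w d_def scaleC_add_left add.assoc)
  then have "x - J s w = d *\<^sub>C J s x"
    by (metis lin(1) add_diff_cancel_right' bounded_clinear_scaleC[OF J_clinear[OF s]])
  moreover have "(s / d) *\<^sub>C d *\<^sub>C J s x = s *\<^sub>R J s x" using nz by (simp add: d_def)
  ultimately have "s *\<^sub>R J s x = (s / d) *\<^sub>C (x - J s w)" by simp
  moreover have "J s (B x) = x - s *\<^sub>R J s x" using s by (simp add: J_B B_J)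
  ultimately have "J s (B x) = x - (s / d) *\<^sub>C (x - J s w)" by simp
  also have "\<dots> = (1 - s / d) *\<^sub>C x + (s / d) *\<^sub>C J s w"
    by (simp add: scaleC.diff_left scaleC.diff_right)
  also have "1 - s / d = \<mu> / d" using nz by (simp add: d_def field_simps)
  finally show ?thesis by (simp add: d_def)
qed

end

lemma cmod_of_real_add_ge:
  assumes "0 \<le> Re \<mu>" "0 \<le> s"
  shows "s \<le> cmod (complex_of_real s + \<mu>)" "cmod \<mu> \<le> cmod (complex_of_real s + \<mu>)"
proof -
  show "s \<le> cmod (complex_of_real s + \<mu>)"
    using complex_Re_le_cmod[of "complex_of_real s + \<mu>"] assms by simp
  show "cmod \<mu> \<le> cmod (complex_of_real s + \<mu>)"
    using assms by (simp add: cmod_def power_mono)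
qed

subsection \<open>Regularisations\<close>

context sectorial begin

text \<open>\<open>regularised r k = B (B (r + B)\<^sup>-\<^sup>1)\<^sup>k\<close> agrees with \<open>B\<close> up to \<open>O(r)\<close>, but vanishes at the origin
  to the order \<open>k + 1\<close>.\<close>

definition regularised :: "real \<Rightarrow> nat \<Rightarrow> 'a \<Rightarrow> 'a"
  where "regularised r k = B \<circ> ((\<lambda>x. B (J r x)) ^^ k)"

lemma B_J_clinear: "0 < r \<Longrightarrow> bounded_clinear (\<lambda>x. B (J r x))"
  using bounded_clinear_compose[OF B_clinear J_clinear] by (simp add: o_def)

lemma norm_B_J_power:
  assumes "0 < r"
  shows "norm (((\<lambda>x. B (J r x)) ^^ k) x) \<le> (1 + K) ^ k * norm x"
proof (induction k)
  case (Suc k)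
  have "norm (B (J r (((\<lambda>x. B (J r x)) ^^ k) x))) \<le> (1 + K) * ((1 + K) ^ k * norm x)"
    by (rule order_trans[OF norm_B_J[OF assms] mult_left_mono[OF Suc]]) (use K_ge_0 in simp)
  then show ?case by (simp add: mult.assoc)
qed simp

lemma regularised_clinear: "0 < r \<Longrightarrow> bounded_clinear (regularised r k)"
  unfolding regularised_def
  by (intro bounded_clinear_compose bounded_clinear_funpow B_clinear B_J_clinear)

lemma regularised_commute:
  assumes r: "0 < r" and C: "bounded_linear C" and comm: "\<And>x. C (B x) = B (C x)"
  shows "C (regularised r k x) = regularised r k (C x)"
proof -
  have "((\<lambda>x. B (J r x)) ^^ k) (C x) = C (((\<lambda>x. B (J r x)) ^^ k) x)"
    by (rule funpow_comm_apply) (simp only: comm J_commute[OF r C comm])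
  then show ?thesis by (simp add: regularised_def comm)
qed

lemma regularised_Suc: "0 < r \<Longrightarrow> regularised r (Suc k) x = B (J r (regularised r k x))"
  by (simp add: regularised_def J_B)

lemma norm_B_minus_regularised:
  assumes r: "0 < r"
  shows "norm (B x - regularised r k x) \<le> real k * (1 + K) ^ k * (r * norm x)"
proof (induction k)
  case 0
  then show ?case by (simp add: regularised_def)
next
  case (Suc k)
  let ?a = "\<lambda>x. B (J r x)"
  have "regularised r k x - regularised r (Suc k) x = r *\<^sub>R J r (regularised r k x)"
    using r by (simp add: regularised_Suc B_J)
  also have "J r (regularised r k x) = (?a ^^ Suc k) x"
    using r by (simp add: regularised_def J_B)
  finally have "norm (regularised r k x - regularised r (Suc k) x) \<le> r * ((1 + K) ^ Suc k * norm x)"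
    using norm_B_J_power[OF r, of "Suc k" x] r by (simp del: funpow.simps)
  moreover have "real k * (1 + K) ^ k * (r * norm x) \<le> real k * (1 + K) ^ Suc k * (r * norm x)"
    using r K_ge_0 by (intro mult_right_mono mult_left_mono power_increasing) auto
  moreover have "norm (B x - regularised r (Suc k) x)
      \<le> norm (B x - regularised r k x) + norm (regularised r k x - regularised r (Suc k) x)"
    using norm_triangle_ineq[of "B x - regularised r k x" "regularised r k x - regularised r (Suc k) x"]
    by simp
  ultimately show ?case using Suc by (simp add: algebra_simps del: power_Suc)
qed

text \<open>Passing from \<open>k\<close> to \<open>k + 1\<close> multiplies by \<open>B (r + B)\<^sup>-\<^sup>1\<close>, to which \<open>J_B_approx\<close> applies. The scalar
  factors that occur have modulus at most \<open>1\<close> because \<open>Re \<mu> \<ge> 0\<close>, which makes the error constant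
  independent of \<open>r\<close> and \<open>\<mu>\<close>.\<close>

lemma regularised_approx:
  assumes r: "0 < r" and w: "B x = \<mu> *\<^sub>C x + w" and \<mu>: "0 \<le> Re \<mu>"
  shows "norm (regularised r k x - (\<mu> * (\<mu> / (complex_of_real r + \<mu>)) ^ k) *\<^sub>C x)
    \<le> (real k * (1 + K) ^ k + 1) * norm w"
proof (induction k)
  case 0
  then show ?case using w by (simp add: regularised_def)
next
  case (Suc k)
  define d where "d = complex_of_real r + \<mu>"
  define q where "q = \<mu> / d"
  have d: "d \<noteq> 0" using r \<mu> by (auto simp: d_def complex_eq_iff)
  have q: "cmod q \<le> 1"
    using cmod_of_real_add_ge(2)[OF \<mu>, of r] r d by (simp add: q_def d_def norm_divide divide_le_eq_1)
  have rd: "cmod (r / d) \<le> 1"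
    using cmod_of_real_add_ge(1)[OF \<mu>, of r] r d by (simp add: d_def norm_divide divide_le_eq_1)
  note lin = linear_simps[OF bounded_clinear_bounded_linear[OF regularised_clinear[OF r]]]
  have J_comm: "J r (regularised r k y) = regularised r k (J r y)" for y
    by (rule regularised_commute[OF r])
      (simp_all add: bounded_clinear_bounded_linear J_clinear r J_B)
  have "regularised r (Suc k) x = regularised r k (J r (B x))"
    using r by (simp add: regularised_Suc J_comm J_B)
      (metis B_linear J_B regularised_commute r)
  also have "J r (B x) = q *\<^sub>C x + (r / d) *\<^sub>C J r w"
    using J_B_approx[OF r w] d by (simp add: d_def q_def)
  finally have "regularised r (Suc k) x - (\<mu> * q ^ Suc k) *\<^sub>C x
      = q *\<^sub>C (regularised r k x - (\<mu> * q ^ k) *\<^sub>C x) + (r / d) *\<^sub>C regularised r k (J r w)"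
    by (simp add: lin bounded_clinear_scaleC[OF regularised_clinear[OF r]] scaleC.diff_right mult_ac)
  also have "norm \<dots> \<le> cmod q * norm (regularised r k x - (\<mu> * q ^ k) *\<^sub>C x)
      + cmod (r / d) * norm (regularised r k (J r w))"
    by (metis norm_scaleC norm_triangle_ineq)
  also have "\<dots> \<le> 1 * ((real k * (1 + K) ^ k + 1) * norm w) + 1 * ((1 + K) ^ Suc k * norm w)"
  proof (intro add_mono mult_mono q rd)
    show "norm (regularised r k x - (\<mu> * q ^ k) *\<^sub>C x) \<le> (real k * (1 + K) ^ k + 1) * norm w"
      using Suc by (simp add: q_def d_def)
    have "regularised r k (J r w) = ((\<lambda>x. B (J r x)) ^^ Suc k) w"
      using r by (simp only: funpow_Suc_right) (simp add: regularised_def funpow_comm_apply J_B B_linear)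
    then show "norm (regularised r k (J r w)) \<le> (1 + K) ^ Suc k * norm w"
      using norm_B_J_power[OF r, of "Suc k" w] by simp
  qed auto
  also have "\<dots> \<le> (real (Suc k) * (1 + K) ^ Suc k + 1) * norm w"
  proof -
    have "real k * (1 + K) ^ k * norm w \<le> real k * (1 + K) ^ Suc k * norm w"
      using K_ge_0 by (intro mult_right_mono mult_left_mono power_increasing) auto
    then show ?thesis by (simp add: algebra_simps del: power_Suc)
  qed
  finally show ?case by (simp add: q_def d_def)
qed

text \<open>As \<open>q = \<bar>\<mu> / (r + \<mu>)\<bar>\<close> is at most \<open>1\<close> and at most \<open>\<bar>\<mu>\<bar> / r\<close>, \<open>q\<^sup>k \<le> q\<^bsup>\<alpha>-1\<^esup> \<le> (\<bar>\<mu>\<bar> / r)\<^bsup>\<alpha>-1\<^esup>\<close>.\<close>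

lemma regularised_symbol_le:
  assumes r: "0 < r" and \<mu>: "0 \<le> Re \<mu>" "\<mu> \<noteq> 0" and \<alpha>: "1 \<le> \<alpha>" "\<alpha> - 1 \<le> real k"
  shows "cmod (\<mu> * (\<mu> / (complex_of_real r + \<mu>)) ^ k) \<le> cmod \<mu> powr \<alpha> * r powr (1 - \<alpha>)"
proof -
  define d where "d = complex_of_real r + \<mu>"
  have d: "r \<le> cmod d" "cmod \<mu> \<le> cmod d"
    using cmod_of_real_add_ge[OF \<mu>(1), of r] r by (simp_all add: d_def)
  then have d0: "0 < cmod d" using r by linarith
  define q where "q = cmod \<mu> / cmod d"
  have q: "0 < q" "q \<le> 1" "q \<le> cmod \<mu> / r"
    using \<mu>(2) d d0 r by (auto simp: q_def divide_le_eq_1 intro!: divide_left_mono)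
  have "q ^ k = q powr real k" using q by (simp add: powr_realpow)
  also have "\<dots> \<le> q powr (\<alpha> - 1)" using q \<alpha> by (intro powr_mono') auto
  also have "\<dots> \<le> (cmod \<mu> / r) powr (\<alpha> - 1)" using q \<alpha> by (intro powr_mono2) auto
  also have "\<dots> = cmod \<mu> powr (\<alpha> - 1) * r powr (1 - \<alpha>)"
    using r by (simp add: powr_divide powr_minus_divide[of r "\<alpha> - 1", simplified])
  finally have "cmod \<mu> * q ^ k \<le> cmod \<mu> * (cmod \<mu> powr (\<alpha> - 1) * r powr (1 - \<alpha>))"
    by (intro mult_left_mono) auto
  also have "\<dots> = cmod \<mu> powr \<alpha> * r powr (1 - \<alpha>)"
    using \<mu>(2) powr_add[of "cmod \<mu>" 1 "\<alpha> - 1"] by simp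
  finally show ?thesis by (simp add: q_def d_def norm_mult norm_power norm_divide)
qed

end

context sectorial begin

subsection \<open>Fractional powers\<close>

lemma B_bound: obtains b where "0 \<le> b" "\<And>x. norm (B x) \<le> b * norm x"
  using bounded_linear.nonneg_bounded[OF B_linear] by (auto simp: mult.commute)

text \<open>Sectoriality bounds \<open>(s + B)\<^sup>-\<^sup>1 B x\<close> near \<open>0\<close>, and \<open>\<parallel>(s + B)\<^sup>-\<^sup>1\<parallel> \<le> K / s\<close> yields the additional decay
  at infinity.\<close>

lemma balakrishnan_integrable:
  assumes \<theta>: "0 < \<theta>" "\<theta> < 1"
  shows "(\<lambda>s. s powr (\<theta> - 1) *\<^sub>R J s (B x)) integrable_on {0<..}"
    and "norm (integral {0<..} (\<lambda>s. s powr (\<theta> - 1) *\<^sub>R J s (B x)))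
      \<le> (1 + K) * (norm x + norm (B x)) * (1 / (\<theta> * (1 - \<theta>)))"
proof -
  define k where "k = (1 + K) * (norm x + norm (B x))"
  have cont: "continuous_on {0<..} (\<lambda>s. s powr (\<theta> - 1) *\<^sub>R J s (B x))"
    by (intro continuous_intros J_continuous) auto
  have le1: "norm (s powr (\<theta> - 1) *\<^sub>R J s (B x)) \<le> k * s powr (\<theta> - 1)" if s: "0 < s" for s
  proof -
    have "norm (J s (B x)) \<le> (1 + K) * norm x"
      using norm_B_J[OF s, of x] s by (simp add: J_B)
    also have "\<dots> \<le> k" unfolding k_def using K_ge_0 by (intro mult_left_mono) auto
    finally have "s powr (\<theta> - 1) * norm (J s (B x)) \<le> s powr (\<theta> - 1) * k"
      by (rule mult_left_mono) simp
    then show ?thesis by (simp add: mult.commute)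
  qed
  have le2: "norm (s powr (\<theta> - 1) *\<^sub>R J s (B x)) \<le> k * (1 * s powr (\<theta> - 2))" if s: "0 < s" for s
  proof -
    have "norm (s powr (\<theta> - 1) *\<^sub>R J s (B x)) = s powr (\<theta> - 2) * (s * norm (J s (B x)))"
      using s powr_add[of s "\<theta> - 2" 1] by simp
    moreover have "s * norm (J s (B x)) \<le> k"
    proof -
      have "K * norm (B x) \<le> k" unfolding k_def using K_ge_0 by (intro mult_mono) auto
      with norm_J[OF s, of "B x"] show ?thesis by linarith
    qed
    from mult_left_mono[OF this, of "s powr (\<theta> - 2)"]
    have "s powr (\<theta> - 2) * (s * norm (J s (B x))) \<le> k * s powr (\<theta> - 2)" by (simp add: mult.commute)
    ultimately show ?thesis by (simp only: mult_1_left)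
  qed
  from powr_dominated_integral[OF \<theta> _ cont le1 le2]
  show "(\<lambda>s. s powr (\<theta> - 1) *\<^sub>R J s (B x)) integrable_on {0<..}"
    "norm (integral {0<..} (\<lambda>s. s powr (\<theta> - 1) *\<^sub>R J s (B x)))
      \<le> (1 + K) * (norm x + norm (B x)) * (1 / (\<theta> * (1 - \<theta>)))"
    by (simp_all add: k_def)
qed

lemma balakrishnan_commute:
  assumes \<theta>: "0 < \<theta>" "\<theta> < 1" and C: "bounded_linear C" and comm: "\<And>x. C (B x) = B (C x)"
  shows "C (balakrishnan_power \<theta> B x) = balakrishnan_power \<theta> B (C x)"
proof -
  have "C (integral {0<..} (\<lambda>s. s powr (\<theta> - 1) *\<^sub>R J s (B x)))
      = integral {0<..} (C \<circ> (\<lambda>s. s powr (\<theta> - 1) *\<^sub>R J s (B x)))"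
    by (rule integral_linear[OF balakrishnan_integrable(1)[OF \<theta>] C, symmetric])
  also have "\<dots> = integral {0<..} (\<lambda>s. s powr (\<theta> - 1) *\<^sub>R J s (B (C x)))"
    by (rule integral_cong) (simp add: linear_simps[OF C] J_commute[OF _ C comm] comm)
  finally show ?thesis
    by (simp add: balakrishnan_power_def linear_simps[OF C])
qed

lemma balakrishnan_clinear:
  assumes \<theta>: "0 < \<theta>" "\<theta> < 1"
  shows "bounded_clinear (balakrishnan_power \<theta> B)"
proof -
  obtain b where b: "0 \<le> b" "\<And>x. norm (B x) \<le> b * norm x" using B_bound by blast
  define k where "k = (1 + K) * (1 + b) * (1 / (\<theta> * (1 - \<theta>)))"
  show ?thesis
  proof (rule bounded_clinearI[of _ "\<bar>sin (pi * \<theta>) / pi\<bar> * k"])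
    fix x y c
    have "integral {0<..} (\<lambda>s. s powr (\<theta> - 1) *\<^sub>R J s (B (x + y)))
        = integral {0<..} (\<lambda>s. s powr (\<theta> - 1) *\<^sub>R J s (B x) + s powr (\<theta> - 1) *\<^sub>R J s (B y))"
      by (rule integral_cong)
        (simp add: linear_simps[OF B_linear]
          linear_simps[OF bounded_clinear_bounded_linear[OF J_clinear]] scaleR_add_right)
    also have "\<dots> = integral {0<..} (\<lambda>s. s powr (\<theta> - 1) *\<^sub>R J s (B x))
        + integral {0<..} (\<lambda>s. s powr (\<theta> - 1) *\<^sub>R J s (B y))"
      by (intro integral_add balakrishnan_integrable(1) \<theta>)
    finally show "balakrishnan_power \<theta> B (x + y) = balakrishnan_power \<theta> B x + balakrishnan_power \<theta> B y"
      by (simp add: balakrishnan_power_def scaleR_add_right)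
    show "balakrishnan_power \<theta> B (c *\<^sub>C x) = c *\<^sub>C balakrishnan_power \<theta> B x"
      by (rule balakrishnan_commute[OF \<theta>, symmetric])
        (simp_all add: scaleC.bounded_linear_right bounded_clinear_scaleC[OF B_clinear])
    have "(1 + K) * (norm x + norm (B x)) * (1 / (\<theta> * (1 - \<theta>))) \<le> k * norm x"
    proof -
      have "(1 + K) * (norm x + norm (B x)) \<le> (1 + K) * ((1 + b) * norm x)"
        using b(2)[of x] K_ge_0 by (intro mult_left_mono) (auto simp: distrib_right)
      then have "(1 + K) * (norm x + norm (B x)) * (1 / (\<theta> * (1 - \<theta>)))
          \<le> (1 + K) * ((1 + b) * norm x) * (1 / (\<theta> * (1 - \<theta>)))"
        using \<theta> by (intro mult_right_mono) auto
      then show ?thesis by (simp add: k_def mult_ac)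
    qed
    with balakrishnan_integrable(2)[OF \<theta>, of x]
    have "\<bar>sin (pi * \<theta>) / pi\<bar> * norm (integral {0<..} (\<lambda>s. s powr (\<theta> - 1) *\<^sub>R J s (B x)))
        \<le> \<bar>sin (pi * \<theta>) / pi\<bar> * (k * norm x)"
      by (intro mult_left_mono) auto
    then show "norm (balakrishnan_power \<theta> B x) \<le> norm x * (\<bar>sin (pi * \<theta>) / pi\<bar> * k)"
      by (simp only: balakrishnan_power_def norm_scaleR mult_ac)
  qed
qed

end

text \<open>The scalar integral \<open>\<integral>\<^sub>0\<^sup>\<infinity> s\<^bsup>\<theta>-1\<^esup> \<mu> / (s + \<mu>) ds\<close> equals \<open>\<pi> \<mu>\<^sup>\<theta> / sin (\<pi> \<theta>)\<close>. Its order of magnitude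
  suffices below, and this follows from crude estimates of the integrand.\<close>

definition scalar_balakrishnan :: "real \<Rightarrow> complex \<Rightarrow> complex"
  where "scalar_balakrishnan \<theta> \<mu> =
    integral {0<..} (\<lambda>s. s powr (\<theta> - 1) *\<^sub>R (\<mu> / (complex_of_real s + \<mu>)))"

context
  fixes \<theta> :: real and \<mu> :: complex
  assumes \<theta>: "0 < \<theta>" "\<theta> < 1" and \<mu>: "0 \<le> Re \<mu>" "\<mu> \<noteq> 0"
begin

lemma of_real_add_nonzero: "0 < s \<Longrightarrow> complex_of_real s + \<mu> \<noteq> 0"
  using cmod_of_real_add_ge(1)[OF \<mu>(1), of s] by auto

lemma scalar_balakrishnan_integrable:
  shows "(\<lambda>s. s powr (\<theta> - 1) *\<^sub>R (\<mu> / (complex_of_real s + \<mu>))) integrable_on {0<..}"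
    and scalar_balakrishnan_le: "cmod (scalar_balakrishnan \<theta> \<mu>) \<le> cmod \<mu> powr \<theta> / (\<theta> * (1 - \<theta>))"
proof -
  have cont: "continuous_on {0<..} (\<lambda>s. s powr (\<theta> - 1) *\<^sub>R (\<mu> / (complex_of_real s + \<mu>)))"
    by (intro continuous_intros) (auto simp: of_real_add_nonzero)
  have pos: "0 < cmod (complex_of_real s + \<mu>)" if "0 < s" for s
    using of_real_add_nonzero[OF that] by simp
  have le1: "norm (s powr (\<theta> - 1) *\<^sub>R (\<mu> / (complex_of_real s + \<mu>))) \<le> 1 * s powr (\<theta> - 1)"
    if s: "0 < s" for s
  proof -
    have "cmod \<mu> / cmod (complex_of_real s + \<mu>) \<le> 1"
      using cmod_of_real_add_ge(2)[OF \<mu>(1), of s] s pos[OF s] by simp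
    then have "s powr (\<theta> - 1) * (cmod \<mu> / cmod (complex_of_real s + \<mu>)) \<le> s powr (\<theta> - 1) * 1"
      by (rule mult_left_mono) simp
    then show ?thesis by (simp add: norm_divide)
  qed
  have le2: "norm (s powr (\<theta> - 1) *\<^sub>R (\<mu> / (complex_of_real s + \<mu>))) \<le> 1 * (cmod \<mu> * s powr (\<theta> - 2))"
    if s: "0 < s" for s
  proof -
    have "cmod \<mu> / cmod (complex_of_real s + \<mu>) \<le> cmod \<mu> / s"
      using cmod_of_real_add_ge(1)[OF \<mu>(1), of s] s pos[OF s] by (intro divide_left_mono) auto
    then have "s powr (\<theta> - 1) * (cmod \<mu> / cmod (complex_of_real s + \<mu>)) \<le> s powr (\<theta> - 1) * (cmod \<mu> / s)"
      by (rule mult_left_mono) simp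
    also have "\<dots> = cmod \<mu> * s powr (\<theta> - 2)"
      using s powr_add[of s "\<theta> - 2" 1] by simp
    finally show ?thesis by (simp add: norm_divide)
  qed
  from powr_dominated_integral[OF \<theta> _ cont le1 le2]
  show "(\<lambda>s. s powr (\<theta> - 1) *\<^sub>R (\<mu> / (complex_of_real s + \<mu>))) integrable_on {0<..}"
    "cmod (scalar_balakrishnan \<theta> \<mu>) \<le> cmod \<mu> powr \<theta> / (\<theta> * (1 - \<theta>))"
    using \<mu>(2) by (simp_all add: scalar_balakrishnan_def)
qed

text \<open>The real part of the integrand is nonnegative, and on the interval from \<open>\<bar>\<mu>\<bar>\<close> to \<open>2 \<bar>\<mu>\<bar>\<close> it is at
  least \<open>s\<^bsup>\<theta>-1\<^esup> / 9\<close>.\<close>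

lemma scalar_balakrishnan_ge: "cmod \<mu> powr \<theta> / 18 \<le> cmod (scalar_balakrishnan \<theta> \<mu>)"
proof -
  define m where "m = cmod \<mu>"
  have m: "0 < m" using \<mu>(2) by (simp add: m_def)
  have m_sq: "m\<^sup>2 = (Re \<mu>)\<^sup>2 + (Im \<mu>)\<^sup>2" by (simp add: m_def cmod_power2)
  define f where "f s = s powr (\<theta> - 1) * Re (\<mu> / (complex_of_real s + \<mu>))" for s
  have Re: "Re (\<mu> / (complex_of_real s + \<mu>)) \<ge> (m / (s + m))\<^sup>2" if s: "0 < s" for s
  proof -
    have d: "0 < (cmod (complex_of_real s + \<mu>))\<^sup>2" using of_real_add_nonzero[OF s] by simp
    have "Re (\<mu> / (complex_of_real s + \<mu>)) = (s * Re \<mu> + m\<^sup>2) / (cmod (complex_of_real s + \<mu>))\<^sup>2"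
      by (simp add: Re_divide' m_sq power2_eq_square[of "Re \<mu>"] power2_eq_square[of "Im \<mu>"] algebra_simps)
    moreover have "m\<^sup>2 / (s + m)\<^sup>2 \<le> (s * Re \<mu> + m\<^sup>2) / (cmod (complex_of_real s + \<mu>))\<^sup>2"
    proof (rule frac_le)
      show "(cmod (complex_of_real s + \<mu>))\<^sup>2 \<le> (s + m)\<^sup>2"
        using norm_triangle_ineq[of "complex_of_real s" \<mu>] s by (intro power_mono) (auto simp: m_def)
    qed (use \<mu>(1) s d in auto)
    ultimately show ?thesis by (simp add: power_divide)
  qed
  have "(f has_integral Re (scalar_balakrishnan \<theta> \<mu>)) {0<..}"
    using has_integral_linear[OF integrable_integral[OF scalar_balakrishnan_integrable(1)] bounded_linear_Re]
    by (simp add: f_def[abs_def] scalar_balakrishnan_def o_def)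
  then have f: "f integrable_on {0<..}" "integral {0<..} f = Re (scalar_balakrishnan \<theta> \<mu>)"
    by (auto simp: has_integral_iff)
  have f_nonneg: "0 \<le> f s" if "0 < s" for s
    using order_trans[OF zero_le_power2 Re[OF that]] by (simp add: f_def)
  have f_m: "f integrable_on {m..2*m}"
    by (rule integrable_on_subinterval[OF f(1)]) (use m in auto)
  have "m powr \<theta> / 18 \<le> ((2 * m) powr (\<theta> - 1) * (1/9)) * (2 * m - m)"
  proof -
    have "(2 * m) powr (\<theta> - 1) * (1/9) * (2 * m - m) = 2 powr (\<theta> - 1) * (m powr (\<theta> - 1) * m) / 9"
      using m by (simp add: powr_mult)
    also have "m powr (\<theta> - 1) * m = m powr \<theta>"
      using m powr_add[of m "\<theta> - 1" 1] by simp
    finally show ?thesis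
      using powr_mono[of "-1" "\<theta> - 1" "2::real"] \<theta> m
        mult_right_mono[of "1/2" "2 powr (\<theta> - 1)" "m powr \<theta>"] by (simp add: powr_minus)
  qed
  also have "\<dots> = integral {m..2*m} (\<lambda>s. (2 * m) powr (\<theta> - 1) * (1/9))"
    using m by simp
  also have "\<dots> \<le> integral {m..2*m} f"
  proof (rule integral_le)
    fix s assume s: "s \<in> {m..2*m}"
    have "(2 * m) powr (\<theta> - 1) \<le> s powr (\<theta> - 1)"
      using s m \<theta> by (intro powr_mono2') auto
    moreover have "1/9 \<le> (m / (s + m))\<^sup>2"
    proof -
      have "1/3 \<le> m / (s + m)" using s m by (simp add: field_simps)
      from power_mono[OF this, of 2] show ?thesis by (simp add: power_divide)
    qed
    ultimately show "(2 * m) powr (\<theta> - 1) * (1/9) \<le> f s"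
      unfolding f_def using Re[of s] s m by (intro mult_mono) auto
  qed (use f_m in auto)
  also have "\<dots> \<le> integral {0<..} f"
    by (rule integral_subset_le[OF _ f_m f(1)]) (use m f_nonneg in auto)
  also have "\<dots> \<le> cmod (scalar_balakrishnan \<theta> \<mu>)"
    unfolding f(2) by (rule complex_Re_le_cmod)
  finally show ?thesis by (simp add: m_def)
qed

end

context sectorial begin

text \<open>Integration of \<open>J_B_approx\<close>. The error integrand is at most
  \<open>K \<parallel>w\<parallel> s\<^bsup>\<theta>-1\<^esup> min (1 / \<bar>\<mu>\<bar>) (1 / s)\<close>, whose integral has the order \<open>\<bar>\<mu>\<bar>\<^bsup>\<theta>-1\<^esup>\<close>.\<close>

lemma balakrishnan_approx:
  assumes \<theta>: "0 < \<theta>" "\<theta> < 1" and \<mu>: "0 \<le> Re \<mu>" "\<mu> \<noteq> 0" and w: "B x = \<mu> *\<^sub>C x + w"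
  shows "norm (balakrishnan_power \<theta> B x - ((sin (pi * \<theta>) / pi) * scalar_balakrishnan \<theta> \<mu>) *\<^sub>C x)
    \<le> K / (\<theta> * (1 - \<theta>)) * cmod \<mu> powr (\<theta> - 1) * norm w"
proof -
  define f where "f s = (s powr (\<theta> - 1)) *\<^sub>R (complex_of_real s / (complex_of_real s + \<mu>)) *\<^sub>C J s w" for s
  define k where "k = K * norm w / cmod \<mu>"
  have k: "0 \<le> k" using K_ge_0 by (simp add: k_def)
  have cont: "continuous_on {0<..} f"
    unfolding f_def by (intro continuous_intros scaleC.continuous_on J_continuous)
      (auto simp: of_real_add_nonzero[OF \<theta> \<mu>])
  have f_le: "norm (f s) \<le> k * (s powr (\<theta> - 1) * (cmod \<mu> / cmod (complex_of_real s + \<mu>)))"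
    if s: "0 < s" for s
  proof -
    have "norm (f s) = s powr (\<theta> - 1) / cmod (complex_of_real s + \<mu>) * (s * norm (J s w))"
      using s by (simp add: f_def norm_scaleC norm_divide)
    also have "\<dots> \<le> s powr (\<theta> - 1) / cmod (complex_of_real s + \<mu>) * (K * norm w)"
      by (intro mult_left_mono norm_J s) simp
    also have "\<dots> = k * (s powr (\<theta> - 1) * (cmod \<mu> / cmod (complex_of_real s + \<mu>)))"
      using \<mu>(2) by (simp add: k_def)
    finally show ?thesis .
  qed
  have pos: "0 < cmod (complex_of_real s + \<mu>)" if "0 < s" for s
    using of_real_add_nonzero[OF \<theta> \<mu> that] by simp
  have le1: "norm (f s) \<le> k * s powr (\<theta> - 1)" if s: "0 < s" for s
  proof -
    have "cmod \<mu> / cmod (complex_of_real s + \<mu>) \<le> 1"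
      using cmod_of_real_add_ge(2)[OF \<mu>(1), of s] s pos[OF s] by simp
    then have "k * (s powr (\<theta> - 1) * (cmod \<mu> / cmod (complex_of_real s + \<mu>))) \<le> k * (s powr (\<theta> - 1) * 1)"
      using k by (intro mult_left_mono) auto
    with f_le[OF s] show ?thesis by simp
  qed
  have le2: "norm (f s) \<le> k * (cmod \<mu> * s powr (\<theta> - 2))" if s: "0 < s" for s
  proof -
    have "cmod \<mu> / cmod (complex_of_real s + \<mu>) \<le> cmod \<mu> / s"
      using cmod_of_real_add_ge(1)[OF \<mu>(1), of s] s pos[OF s] by (intro divide_left_mono) auto
    then have "k * (s powr (\<theta> - 1) * (cmod \<mu> / cmod (complex_of_real s + \<mu>)))
        \<le> k * (s powr (\<theta> - 1) * (cmod \<mu> / s))"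
      using k by (intro mult_left_mono) auto
    also have "s powr (\<theta> - 1) * (cmod \<mu> / s) = cmod \<mu> * s powr (\<theta> - 2)"
      using s powr_add[of s "\<theta> - 2" 1] by simp
    finally show ?thesis using f_le[OF s] by simp
  qed
  have "0 < cmod \<mu>" using \<mu> by simp
  note int = powr_dominated_integral[OF \<theta> this cont le1 le2]
  have scalar: "((\<lambda>s. (s powr (\<theta> - 1) *\<^sub>R (\<mu> / (complex_of_real s + \<mu>))) *\<^sub>C x)
      has_integral scalar_balakrishnan \<theta> \<mu> *\<^sub>C x) {0<..}"
    using has_integral_linear[OF integrable_integral[OF scalar_balakrishnan_integrable(1)[OF \<theta> \<mu>]]
        scaleC.bounded_linear_left[of x]]
    by (simp add: o_def scalar_balakrishnan_def)
  have "integral {0<..} (\<lambda>s. s powr (\<theta> - 1) *\<^sub>R J s (B x))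
      = integral {0<..} (\<lambda>s. (s powr (\<theta> - 1) *\<^sub>R (\<mu> / (complex_of_real s + \<mu>))) *\<^sub>C x + f s)"
    by (rule integral_cong)
      (simp add: J_B_approx[OF _ w] of_real_add_nonzero[OF \<theta> \<mu>] f_def scaleR_add_right scaleC.scaleR_left)
  also have "\<dots> = scalar_balakrishnan \<theta> \<mu> *\<^sub>C x + integral {0<..} f"
    using integral_add[OF has_integral_integrable[OF scalar] int(1)] by (simp add: integral_unique[OF scalar])
  finally have int_eq: "integral {0<..} (\<lambda>s. s powr (\<theta> - 1) *\<^sub>R J s (B x))
      = scalar_balakrishnan \<theta> \<mu> *\<^sub>C x + integral {0<..} f" .
  have eq: "balakrishnan_power \<theta> B x - ((sin (pi * \<theta>) / pi) * scalar_balakrishnan \<theta> \<mu>) *\<^sub>C x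
      = (sin (pi * \<theta>) / pi) *\<^sub>R integral {0<..} f"
  proof -
    have "(sin (pi * \<theta>) / pi) *\<^sub>R scalar_balakrishnan \<theta> \<mu> *\<^sub>C x
        = ((sin (pi * \<theta>) / pi) * scalar_balakrishnan \<theta> \<mu>) *\<^sub>C x"
      by (simp only: scaleR_scaleC scaleC_scaleC of_real_divide)
    with int_eq show ?thesis
      by (simp only: balakrishnan_power_def scaleR_add_right add_diff_cancel_left')
  qed
  have "\<bar>sin (pi * \<theta>) / pi\<bar> \<le> 1"
    using abs_sin_le_one[of "pi * \<theta>"] pi_ge_two by (simp add: abs_divide divide_le_eq_1 del: abs_sin_le_one)
  then have "\<bar>sin (pi * \<theta>) / pi\<bar> * norm (integral {0<..} f) \<le> 1 * (k * (cmod \<mu> powr \<theta> / (\<theta> * (1 - \<theta>))))"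
    using int(2) by (intro mult_mono) auto
  also have "\<dots> = K / (\<theta> * (1 - \<theta>)) * (cmod \<mu> powr \<theta> / cmod \<mu>) * norm w"
    by (simp add: k_def mult_ac)
  also have "cmod \<mu> powr \<theta> / cmod \<mu> = cmod \<mu> powr (\<theta> - 1)"
    using \<mu>(2) by (simp add: powr_diff)
  finally show ?thesis unfolding eq norm_scaleR .
qed

lemma norm_power_approx:
  assumes w: "B x = \<mu> *\<^sub>C x + w" and \<mu>: "cmod \<mu> \<le> 1" and b: "1 \<le> b" "\<And>x. norm (B x) \<le> b * norm x"
  shows "norm ((B ^^ n) x - \<mu> ^ n *\<^sub>C x) \<le> real n * b ^ n * norm w"
proof (induction n)
  case (Suc n)
  have "(B ^^ Suc n) x - \<mu> ^ Suc n *\<^sub>C x = B ((B ^^ n) x - \<mu> ^ n *\<^sub>C x) + \<mu> ^ n *\<^sub>C w"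
    by (simp add: linear_simps[OF B_linear] bounded_clinear_scaleC[OF B_clinear] w scaleC_add_right mult_ac)
  also have "norm \<dots> \<le> norm (B ((B ^^ n) x - \<mu> ^ n *\<^sub>C x)) + norm (\<mu> ^ n *\<^sub>C w)"
    by (rule norm_triangle_ineq)
  also have "\<dots> \<le> b * (real n * b ^ n * norm w) + b ^ Suc n * norm w"
  proof (rule add_mono)
    show "norm (B ((B ^^ n) x - \<mu> ^ n *\<^sub>C x)) \<le> b * (real n * b ^ n * norm w)"
      using b(1) by (intro order_trans[OF b(2) mult_left_mono[OF Suc]]) simp
    have "cmod \<mu> ^ n \<le> b ^ Suc n"
      using power_le_one[of "cmod \<mu>" n] \<mu> one_le_power[OF b(1), of "Suc n"] by (simp del: power_Suc)
    then show "norm (\<mu> ^ n *\<^sub>C w) \<le> b ^ Suc n * norm w"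
      by (simp add: norm_scaleC norm_power mult_right_mono del: power_Suc)
  qed
  finally show ?case by (simp add: algebra_simps)
qed simp

lemma frac_power_clinear: "bounded_clinear (frac_power \<alpha> B)"
proof -
  have "0 < frac \<alpha>" if "frac \<alpha> \<noteq> 0" using that frac_ge_0[of \<alpha>] by linarith
  then show ?thesis
    unfolding frac_power_def
    by (auto intro!: bounded_clinear_compose bounded_clinear_funpow B_clinear balakrishnan_clinear
        bounded_clinear_id simp: frac_lt_1)
qed

lemma frac_power_commute:
  assumes C: "bounded_linear C" and comm: "\<And>x. C (B x) = B (C x)"
  shows "C (frac_power \<alpha> B x) = frac_power \<alpha> B (C x)"
proof -
  have "(B ^^ n) (C y) = C ((B ^^ n) y)" for n y
    by (rule funpow_comm_apply) (simp add: comm)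
  moreover have "0 < frac \<alpha>" if "frac \<alpha> \<noteq> 0" using that frac_ge_0[of \<alpha>] by linarith
  ultimately show ?thesis
    by (auto simp: frac_power_def balakrishnan_commute[OF _ _ C comm, symmetric] frac_lt_1)
qed

text \<open>For \<open>\<alpha> = n + \<theta>\<close> the error is \<open>(B\<^sup>n - \<mu>\<^sup>n) B\<^sup>\<theta> x + \<mu>\<^sup>n (B\<^sup>\<theta> - c) x\<close>. In this order the singular factor
  \<open>\<bar>\<mu>\<bar>\<^bsup>\<theta>-1\<^esup>\<close> of the second term is compensated by \<open>\<bar>\<mu>\<bar>\<^sup>n\<close>, because \<open>n \<ge> 1\<close>.\<close>

lemma frac_power_approx:
  assumes \<alpha>: "1 \<le> \<alpha>"
  obtains L a b where "0 \<le> L" "0 < a" "0 < b"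
    "\<And>\<mu> x w. B x = \<mu> *\<^sub>C x + w \<Longrightarrow> 0 \<le> Re \<mu> \<Longrightarrow> \<mu> \<noteq> 0 \<Longrightarrow> cmod \<mu> \<le> 1 \<Longrightarrow>
      \<exists>c. a * cmod \<mu> powr \<alpha> \<le> cmod c \<and> cmod c \<le> b * cmod \<mu> powr \<alpha> \<and>
        norm (frac_power \<alpha> B x - c *\<^sub>C x) \<le> L * norm w"
proof -
  define n where "n = nat \<lfloor>\<alpha>\<rfloor>"
  have n: "1 \<le> n" "real n = \<lfloor>\<alpha>\<rfloor>" using \<alpha> by (auto simp: n_def le_nat_iff le_floor_iff)
  obtain \<beta> where \<beta>: "1 \<le> \<beta>" "\<And>x. norm (B x) \<le> \<beta> * norm x"
  proof -
    obtain b where "0 \<le> b" "\<And>x. norm (B x) \<le> b * norm x" using B_bound by blast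
    then have "norm (B x) \<le> (1 + b) * norm x" for x
      using order_trans[of "norm (B x)" "b * norm x" "(1 + b) * norm x"] by (simp add: mult_right_mono)
    with \<open>0 \<le> b\<close> show ?thesis by (intro that[of "1 + b"]) auto
  qed
  define N where "N = real n * \<beta> ^ n"
  have N: "0 \<le> N" using \<beta>(1) by (simp add: N_def)
  show ?thesis
  proof (cases "frac \<alpha> = 0")
    case True
    then have "\<alpha> = real n" using n(2) by (simp add: frac_def)
    show ?thesis
    proof (rule that[of N 1 1])
      fix \<mu> x w assume *: "B x = \<mu> *\<^sub>C x + w" "\<mu> \<noteq> 0" "cmod \<mu> \<le> 1"
      have "norm (frac_power \<alpha> B x - \<mu> ^ n *\<^sub>C x) \<le> N * norm w"
        using norm_power_approx[OF *(1,3) \<beta>] True by (simp add: frac_power_def n_def N_def)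
      moreover have "cmod (\<mu> ^ n) = cmod \<mu> powr \<alpha>"
        using *(2) by (simp add: \<open>\<alpha> = real n\<close> norm_power powr_realpow)
      ultimately show "\<exists>c. 1 * cmod \<mu> powr \<alpha> \<le> cmod c \<and> cmod c \<le> 1 * cmod \<mu> powr \<alpha> \<and>
          norm (frac_power \<alpha> B x - c *\<^sub>C x) \<le> N * norm w"
        by (intro exI[of _ "\<mu> ^ n"]) simp
    qed (simp_all add: N)
  next
    case False
    define \<theta> where "\<theta> = frac \<alpha>"
    have \<theta>: "0 < \<theta>" "\<theta> < 1" using False frac_ge_0[of \<alpha>] frac_lt_1[of \<alpha>] unfolding \<theta>_def by linarith+
    have \<alpha>_eq: "\<alpha> = real n + \<theta>" using n(2) by (simp add: \<theta>_def frac_def)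
    define S where "S = balakrishnan_power \<theta> B"
    define \<sigma> where "\<sigma> = sin (pi * \<theta>) / pi"
    have \<sigma>: "0 < \<sigma>" using \<theta> sin_gt_zero[of "pi * \<theta>"] by (simp add: \<sigma>_def)
    obtain \<kappa> where \<kappa>: "0 \<le> \<kappa>" "\<And>x. norm (S x) \<le> \<kappa> * norm x"
      using bounded_linear.nonneg_bounded[OF bounded_clinear_bounded_linear[OF balakrishnan_clinear[OF \<theta>]]]
      by (auto simp: S_def mult.commute)
    define L where "L = N * \<kappa> + K / (\<theta> * (1 - \<theta>))"
    have L: "0 \<le> L" using N \<kappa>(1) K_ge_0 \<theta> by (simp add: L_def)
    have S_B: "B (S x) = S (B x)" for x
      unfolding S_def by (rule balakrishnan_commute[OF \<theta> B_linear]) simp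
    show ?thesis
    proof (rule that[of L "\<sigma> / 18" "\<sigma> / (\<theta> * (1 - \<theta>))"])
      fix \<mu> x w assume *: "B x = \<mu> *\<^sub>C x + w" "0 \<le> Re \<mu>" "\<mu> \<noteq> 0" "cmod \<mu> \<le> 1"
      define m where "m = complex_of_real \<sigma> * scalar_balakrishnan \<theta> \<mu>"
      define c where "c = \<mu> ^ n * m"
      have "B (S x) = \<mu> *\<^sub>C S x + S w"
        using balakrishnan_clinear[OF \<theta>]
        by (simp add: S_B *(1) linear_simps[OF bounded_clinear_bounded_linear] bounded_clinear_scaleC
            flip: S_def)
      from norm_power_approx[OF this *(4) \<beta>, of n]
      have 1: "norm ((B ^^ n) (S x) - \<mu> ^ n *\<^sub>C S x) \<le> N * (\<kappa> * norm w)"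
        using mult_left_mono[OF \<kappa>(2)[of w] N] by (simp add: N_def)
      have "norm (S x - m *\<^sub>C x) \<le> K / (\<theta> * (1 - \<theta>)) * cmod \<mu> powr (\<theta> - 1) * norm w"
        using balakrishnan_approx[OF \<theta> *(2,3,1)] by (simp add: S_def m_def \<sigma>_def)
      then have "cmod \<mu> ^ n * norm (S x - m *\<^sub>C x)
          \<le> cmod \<mu> ^ n * (K / (\<theta> * (1 - \<theta>)) * cmod \<mu> powr (\<theta> - 1) * norm w)"
        by (rule mult_left_mono) simp
      also have "\<dots> = cmod \<mu> powr (real n + (\<theta> - 1)) * (K / (\<theta> * (1 - \<theta>)) * norm w)"
        using *(3) by (simp add: powr_add powr_realpow)
      also have "\<dots> \<le> 1 * (K / (\<theta> * (1 - \<theta>)) * norm w)"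
        using *(3,4) n(1) \<theta> K_ge_0 by (intro mult_right_mono powr_le1) auto
      finally have 2: "norm (\<mu> ^ n *\<^sub>C (S x - m *\<^sub>C x)) \<le> K / (\<theta> * (1 - \<theta>)) * norm w"
        by (simp add: norm_scaleC norm_power)
      have "frac_power \<alpha> B x - c *\<^sub>C x
          = ((B ^^ n) (S x) - \<mu> ^ n *\<^sub>C S x) + \<mu> ^ n *\<^sub>C (S x - m *\<^sub>C x)"
        using False by (simp add: frac_power_def n_def S_def \<theta>_def c_def scaleC.diff_right)
      then have "norm (frac_power \<alpha> B x - c *\<^sub>C x)
          \<le> norm ((B ^^ n) (S x) - \<mu> ^ n *\<^sub>C S x) + norm (\<mu> ^ n *\<^sub>C (S x - m *\<^sub>C x))"
        by (simp only: norm_triangle_ineq)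
      also have "\<dots> \<le> L * norm w" using 1 2 by (simp add: L_def distrib_right)
      finally have "norm (frac_power \<alpha> B x - c *\<^sub>C x) \<le> L * norm w" .
      moreover have \<mu>_powr: "cmod \<mu> powr \<alpha> = cmod \<mu> ^ n * cmod \<mu> powr \<theta>"
        using *(3) by (simp add: \<alpha>_eq powr_add powr_realpow)
      have "\<sigma> / 18 * cmod \<mu> powr \<alpha> \<le> cmod c"
        using mult_left_mono[OF scalar_balakrishnan_ge[OF \<theta> *(2,3)], of "\<sigma> * cmod \<mu> ^ n"] \<sigma>
        by (simp add: c_def m_def norm_mult norm_power \<mu>_powr mult_ac)
      moreover have "cmod c \<le> \<sigma> / (\<theta> * (1 - \<theta>)) * cmod \<mu> powr \<alpha>"
        using mult_left_mono[OF scalar_balakrishnan_le[OF \<theta> *(2,3)], of "\<sigma> * cmod \<mu> ^ n"] \<sigma>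
        by (simp add: c_def m_def norm_mult norm_power \<mu>_powr mult_ac)
      ultimately show "\<exists>c. \<sigma> / 18 * cmod \<mu> powr \<alpha> \<le> cmod c \<and> cmod c \<le> \<sigma> / (\<theta> * (1 - \<theta>)) * cmod \<mu> powr \<alpha> \<and>
          norm (frac_power \<alpha> B x - c *\<^sub>C x) \<le> L * norm w" by blast
    qed (use L \<sigma> \<theta> in auto)
  qed
qed

end

section \<open>Resolvent growth and decay\<close>

subsection \<open>Approximate eigenvectors of \<open>B(A)\<close>\<close>

context bounded_semigroup begin

lemma B_op_eq: "B_op D A x = x - R 1 x"
  using R_inverse[of 1 x] by (simp add: B_op_def algebra_simps)

lemma B_op_A: "B_op D A x = A (R 1 x)"
  by (simp add: B_op_def)

lemma B_op_clinear: "bounded_clinear (B_op D A)"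
proof -
  have "B_op D A = (\<lambda>x. x - R 1 x)" by (rule ext) (rule B_op_eq)
  then show ?thesis
    using bounded_clinear_diff[OF bounded_clinear_ident R_clinear[of 1]] by simp
qed

text \<open>With \<open>q = s / (s + 1)\<close> one has \<open>s + B(A) = (s + 1) (q + A) (1 + A)\<^sup>-\<^sup>1\<close>, so that the resolvents of
  \<open>B(A)\<close> at positive numbers are controlled by those of \<open>A\<close> on the interval from \<open>0\<close> to \<open>1\<close>.\<close>

lemma sectorial_B_op: "sectorial (B_op D A) M"
proof
  show "bounded_clinear (B_op D A)" by (rule B_op_clinear)
  show "1 \<le> M" by (rule M_ge_1)
  fix s :: real assume s: "0 < s"
  define q where "q = s / (s + 1)"
  have q: "0 < q" "(s + 1) * q = s" using s by (auto simp: q_def)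
  have key: "s *\<^sub>R (r + A r) + A r = (s + 1) *\<^sub>R (q *\<^sub>R r + A r)" for r
    by (simp only: scaleR_add_right scaleR_scaleR q(2)) (simp add: algebra_simps)
  show "\<exists>x. s *\<^sub>R x + B_op D A x = y" for y
  proof -
    obtain r where r: "r \<in> D" "q *\<^sub>R r + A r = (1 / (s + 1)) *\<^sub>R y"
      using surj_shift[OF q(1)] by metis
    have "R 1 (r + A r) = r" using R_eq[of 1 r] r(1) by simp
    then have "s *\<^sub>R (r + A r) + B_op D A (r + A r) = y"
      using s by (simp only: B_op_A key r(2)) simp
    then show ?thesis by blast
  qed
  show "s * norm z \<le> M * norm (s *\<^sub>R z + B_op D A z)" for z
  proof -
    define r where "r = R 1 z"
    define y where "y = s *\<^sub>R z + B_op D A z"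
    have r: "r \<in> D" "z = r + A r"
      using R_D[of 1 z] R_inverse[of 1 z] by (simp_all add: r_def)
    have y1: "y = (s + 1) *\<^sub>R (q *\<^sub>R r + A r)"
      unfolding y_def B_op_A r_def[symmetric] using key[of r] by (simp only: r(2)[symmetric])
    have "y + r = (s + 1) *\<^sub>R z"
      unfolding y_def B_op_eq r_def[symmetric] by (simp add: algebra_simps)
    then have "(s + 1) * norm z \<le> norm y + norm r"
      using s norm_triangle_ineq[of y r] by (metis abs_of_pos add_pos_pos norm_scaleR zero_less_one)
    then have "s * ((s + 1) * norm z) \<le> s * norm y + s * norm r"
      using s by (simp add: mult_left_mono flip: distrib_left)
    also have "s * norm r \<le> M * norm y"
    proof -
      have "(s + 1) * (q * norm r) \<le> (s + 1) * (M * norm (q *\<^sub>R r + A r))"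
        using norm_dissipative[OF _ r(1), of "complex_of_real q"] q s by (intro mult_left_mono) auto
      also have "\<dots> = M * norm y" using s by (simp add: y1)
      finally show ?thesis by (simp only: mult.assoc[symmetric] q(2))
    qed
    also have "s * norm y + M * norm y \<le> (s + 1) * (M * norm y)"
      using mult_right_mono[OF M_ge_1, of "s * norm y"] s by (simp add: algebra_simps)
    finally have "(s + 1) * (s * norm z) \<le> (s + 1) * (M * norm y)" by (simp add: mult_ac)
    then show ?thesis using s by (simp add: y_def)
  qed
qed

end

sublocale bounded_semigroup \<subseteq> B: sectorial "B_op D A" M
  by (rule sectorial_B_op)

text \<open>The value at \<open>z = - i s\<close> of the function \<open>z / (1 + z)\<close> that defines \<open>B(A)\<close>.\<close>

definition B_symbol :: "real \<Rightarrow> complex"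
  where "B_symbol s = - (\<i> * s) / (1 - \<i> * s)"

lemma
  assumes s: "s \<noteq> 0"
  shows B_symbol_nonzero: "B_symbol s \<noteq> 0"
    and Re_B_symbol: "0 \<le> Re (B_symbol s)"
    and cmod_B_symbol_le_1: "cmod (B_symbol s) \<le> 1"
    and cmod_B_symbol_le: "cmod (B_symbol s) \<le> \<bar>s\<bar>"
    and inverse_cmod_B_symbol: "1 / cmod (B_symbol s) \<le> 1 + 1 / \<bar>s\<bar>"
proof -
  define d where "d = cmod (1 - \<i> * complex_of_real s)"
  have d: "1 \<le> d" "\<bar>s\<bar> \<le> d" "d \<le> 1 + \<bar>s\<bar>"
    using complex_Re_le_cmod[of "1 - \<i> * complex_of_real s"] abs_Im_le_cmod[of "1 - \<i> * complex_of_real s"]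
      norm_triangle_ineq4[of 1 "\<i> * complex_of_real s"]
    by (simp_all add: d_def norm_mult)
  have eq: "cmod (B_symbol s) = \<bar>s\<bar> / d"
    by (simp add: B_symbol_def d_def norm_divide norm_mult)
  show "B_symbol s \<noteq> 0" using s d eq by auto
  show "0 \<le> Re (B_symbol s)"
    by (simp add: B_symbol_def Re_divide')
  show "cmod (B_symbol s) \<le> 1" using d by (simp add: eq divide_le_eq_1)
  show "cmod (B_symbol s) \<le> \<bar>s\<bar>"
    using d s divide_left_mono[of 1 d "\<bar>s\<bar>"] by (simp add: eq)
  show "1 / cmod (B_symbol s) \<le> 1 + 1 / \<bar>s\<bar>"
    using d s by (simp add: eq divide_le_eq distrib_right)
qed

lemma B_symbol_powr_le:
  assumes s: "s \<noteq> 0" and \<alpha>: "0 \<le> \<alpha>"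
  shows "cmod (B_symbol s) powr \<alpha> * (1 + \<bar>s\<bar> powr (- \<alpha>)) \<le> 2"
proof -
  have 1: "cmod (B_symbol s) powr \<alpha> \<le> 1"
    using cmod_B_symbol_le_1[OF s] \<alpha> by (intro powr_le1) auto
  have "cmod (B_symbol s) powr \<alpha> \<le> \<bar>s\<bar> powr \<alpha>"
    using cmod_B_symbol_le[OF s] \<alpha> by (intro powr_mono2) auto
  then have "cmod (B_symbol s) powr \<alpha> * \<bar>s\<bar> powr (- \<alpha>) \<le> \<bar>s\<bar> powr \<alpha> * \<bar>s\<bar> powr (- \<alpha>)"
    by (rule mult_right_mono) simp
  also have "\<dots> = 1" using s by (simp flip: powr_add)
  finally show ?thesis using 1 by (simp add: distrib_left)
qed

lemma inverse_B_symbol_powr_le: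
  assumes s: "s \<noteq> 0" and \<alpha>: "0 \<le> \<alpha>"
  shows "(1 / cmod (B_symbol s)) powr \<alpha> \<le> 2 powr \<alpha> * (1 + \<bar>s\<bar> powr (- \<alpha>))"
proof (cases "\<bar>s\<bar> \<le> 1")
  case True
  then have "1 \<le> 1 / \<bar>s\<bar>" using s by simp
  then have "1 + 1 / \<bar>s\<bar> \<le> 2 * (1 / \<bar>s\<bar>)" by simp
  then have "(1 / cmod (B_symbol s)) powr \<alpha> \<le> (2 * (1 / \<bar>s\<bar>)) powr \<alpha>"
    using inverse_cmod_B_symbol[OF s] \<alpha> by (intro powr_mono2) auto
  also have "\<dots> = 2 powr \<alpha> * (1 / \<bar>s\<bar>) powr \<alpha>" by (rule powr_mult)
  also have "(1 / \<bar>s\<bar>) powr \<alpha> = \<bar>s\<bar> powr (- \<alpha>)"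
    using s by (simp add: powr_divide powr_minus_divide)
  finally show ?thesis by (simp add: distrib_left add_increasing)
next
  case False
  then have "1 + 1 / \<bar>s\<bar> \<le> 2" by (simp add: field_simps)
  then have "(1 / cmod (B_symbol s)) powr \<alpha> \<le> 2 powr \<alpha>"
    using inverse_cmod_B_symbol[OF s] \<alpha> by (intro powr_mono2) auto
  then show ?thesis by (simp add: distrib_left add_increasing2)
qed

context bounded_semigroup begin

text \<open>Applying \<open>(1 + A)\<^sup>-\<^sup>1\<close> to \<open>y = (1 + A) x - (1 - i s) x\<close> expresses \<open>(1 + A)\<^sup>-\<^sup>1 x = x - B(A) x\<close> in terms of
  \<open>x\<close> and \<open>(1 + A)\<^sup>-\<^sup>1 y\<close>.\<close>

lemma B_op_approx_eigenvector:
  assumes x: "x \<in> D"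
  obtains w where "B_op D A x = B_symbol s *\<^sub>C x + w"
    "norm w \<le> M * norm ((\<i> * complex_of_real s) *\<^sub>C x + A x)"
proof -
  define y where "y = (\<i> * complex_of_real s) *\<^sub>C x + A x"
  define d where "d = 1 - \<i> * complex_of_real s"
  have d: "1 \<le> cmod d" using complex_Re_le_cmod[of d] by (simp add: d_def)
  then have d0: "d \<noteq> 0" by auto
  have "y = (1 *\<^sub>R x + A x) - d *\<^sub>C x"
    by (simp add: y_def d_def scaleC.diff_left)
  then have "R 1 y = x - d *\<^sub>C R 1 x"
    using R_eq[of 1 x] x R_clinear[of 1]
    by (simp only: linear_simps[OF bounded_clinear_bounded_linear] bounded_clinear_scaleC zero_less_one)
  then have "(1 / d) *\<^sub>C d *\<^sub>C R 1 x = (1 / d) *\<^sub>C (x - R 1 y)" by simp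
  then have "R 1 x = (1 / d) *\<^sub>C x - (1 / d) *\<^sub>C R 1 y"
    using d0 by (simp add: scaleC.diff_right)
  then have "B_op D A x = (1 - 1 / d) *\<^sub>C x + (1 / d) *\<^sub>C R 1 y"
    by (simp add: B_op_eq scaleC.diff_left)
  moreover have "1 - 1 / d = B_symbol s" using d0 by (simp add: B_symbol_def d_def field_simps)
  moreover have "norm ((1 / d) *\<^sub>C R 1 y) \<le> M * norm y"
  proof -
    have "norm ((1 / d) *\<^sub>C R 1 y) \<le> 1 * norm (R 1 y)"
      unfolding norm_scaleC using d by (intro mult_right_mono) (auto simp: norm_divide divide_le_eq_1)
    with norm_R[of 1 y] show ?thesis by simp
  qed
  ultimately show ?thesis using that by (simp add: y_def)
qed

lemma T_B_op: "0 \<le> t \<Longrightarrow> T t (B_op D A x) = B_op D A (T t x)"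
  using R_commute[of 1 "T t" x] by (simp add: B_op_eq linear_simps[OF T_linear] T_linear T_comm)

text \<open>The resolvent condition (i) as one inequality for all \<open>s \<noteq> 0\<close>; \<open>1 + \<bar>s\<bar>\<^bsup>-\<alpha>\<^esup>\<close> combines the behaviour at
  the origin with boundedness at infinity.\<close>

definition resolvent_growth :: "real \<Rightarrow> bool"
  where "resolvent_growth \<alpha> \<longleftrightarrow> (\<exists>k\<ge>0. \<forall>s x. s \<noteq> 0 \<longrightarrow> x \<in> D \<longrightarrow>
    norm x \<le> k * (1 + \<bar>s\<bar> powr (- \<alpha>)) * norm ((\<i> * complex_of_real s) *\<^sub>C x + A x))"

subsection \<open>From resolvent growth to decay\<close>

text \<open>The resolvent may grow like \<open>\<bar>s\<bar>\<^bsup>-\<alpha>\<^esup>\<close> at the origin, but \<open>\<bar>c\<bar> = O(\<bar>s\<bar>\<^sup>\<alpha>)\<close> compensates this.\<close>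

lemma multiplier_bound:
  assumes growth: "norm x \<le> k * (1 + \<bar>s\<bar> powr (- \<alpha>)) * norm y"
    and c: "cmod c \<le> b * cmod (B_symbol s) powr \<alpha>" and approx: "norm (z - c *\<^sub>C x) \<le> L * norm y"
    and "0 \<le> k" "0 \<le> b" "s \<noteq> 0" "0 \<le> \<alpha>"
  shows "norm (z :: 'a) \<le> (2 * b * k + L) * norm y"
proof -
  have "norm (c *\<^sub>C x) \<le> (b * cmod (B_symbol s) powr \<alpha>) * (k * (1 + \<bar>s\<bar> powr (- \<alpha>)) * norm y)"
    unfolding norm_scaleC using c growth assms(4,5) by (intro mult_mono) auto
  also have "\<dots> = b * k * (cmod (B_symbol s) powr \<alpha> * (1 + \<bar>s\<bar> powr (- \<alpha>))) * norm y"
    by (simp only: mult_ac)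
  also have "\<dots> \<le> b * k * 2 * norm y"
    using assms by (intro mult_right_mono mult_left_mono B_symbol_powr_le) auto
  finally have "norm (c *\<^sub>C x) \<le> 2 * b * k * norm y" by (simp add: mult_ac)
  then show ?thesis
    using approx norm_triangle_ineq[of "z - c *\<^sub>C x" "c *\<^sub>C x"] by (simp add: distrib_right)
qed

lemma frac_power_decay:
  assumes \<alpha>: "1 \<le> \<alpha>" and growth: "resolvent_growth \<alpha>"
  obtains c where "0 \<le> c" "\<And>t x. 0 < t \<Longrightarrow> norm (T t (frac_power \<alpha> (B_op D A) x)) \<le> c * (1 / t) * norm x"
proof -
  obtain k where k: "0 \<le> k" "\<And>s x. s \<noteq> 0 \<Longrightarrow> x \<in> D \<Longrightarrow>
      norm x \<le> k * (1 + \<bar>s\<bar> powr (- \<alpha>)) * norm ((\<i> * complex_of_real s) *\<^sub>C x + A x)"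
    using growth by (auto simp: resolvent_growth_def)
  from B.frac_power_approx[OF \<alpha>]
  obtain L a b where L: "0 \<le> L" "0 < b" and approx:
    "\<And>\<mu> x w. B_op D A x = \<mu> *\<^sub>C x + w \<Longrightarrow> 0 \<le> Re \<mu> \<Longrightarrow> \<mu> \<noteq> 0 \<Longrightarrow> cmod \<mu> \<le> 1 \<Longrightarrow>
      \<exists>c. a * cmod \<mu> powr \<alpha> \<le> cmod c \<and> cmod c \<le> b * cmod \<mu> powr \<alpha> \<and>
        norm (frac_power \<alpha> (B_op D A) x - c *\<^sub>C x) \<le> L * norm w"
    by metis
  interpret F: dominated_operator T D A M "frac_power \<alpha> (B_op D A)" "2 * b * k + L * M"
  proof
    show "0 \<le> 2 * b * k + L * M" using k(1) L M_ge_0 by simp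
    show "frac_power \<alpha> (B_op D A) (T t x) = T t (frac_power \<alpha> (B_op D A) x)" if "0 \<le> t" for t x
      by (rule B.frac_power_commute[symmetric]) (simp_all add: that T_linear T_B_op)
    fix s :: real and x assume s: "s \<noteq> 0" and x: "x \<in> D"
    define y where "y = (\<i> * complex_of_real s) *\<^sub>C x + A x"
    obtain w where w: "B_op D A x = B_symbol s *\<^sub>C x + w" "norm w \<le> M * norm y"
      unfolding y_def by (rule B_op_approx_eigenvector[OF x])
    obtain c where c: "cmod c \<le> b * cmod (B_symbol s) powr \<alpha>"
      "norm (frac_power \<alpha> (B_op D A) x - c *\<^sub>C x) \<le> L * norm w"
      using approx[OF w(1) Re_B_symbol[OF s] B_symbol_nonzero[OF s] cmod_B_symbol_le_1[OF s]] by blast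
    have "norm (frac_power \<alpha> (B_op D A) x - c *\<^sub>C x) \<le> L * M * norm y"
      using c(2) mult_left_mono[OF w(2) L(1)] by (simp add: mult.assoc)
    from multiplier_bound[OF k(2)[OF s x, folded y_def] c(1) this k(1) _ s] L \<alpha>
    show "norm (frac_power \<alpha> (B_op D A) x) \<le> (2 * b * k + L * M) * norm ((\<i> * complex_of_real s) *\<^sub>C x + A x)"
      by (simp add: y_def)
  qed (rule B.frac_power_clinear)
  show ?thesis
  proof (rule that)
    show "0 \<le> 3 * (2 * b * k + L * M) * (1 + M) * M\<^sup>2"
      using F.K_nonneg M_ge_0 by simp
    show "norm (T t (frac_power \<alpha> (B_op D A) x)) \<le> 3 * (2 * b * k + L * M) * (1 + M) * M\<^sup>2 * (1 / t) * norm x"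
      if "0 < t" for t x
      using F.decay[OF that, of x] by simp
  qed
qed

text \<open>For \<open>B(A)\<close> itself the operator is replaced by a regularisation at the scale \<open>r = t\<^bsup>-1/\<alpha>\<^esup>\<close>,
  which balances the error \<open>O(r)\<close> of the replacement with the decay \<open>O(r\<^bsup>1-\<alpha>\<^esup> / t)\<close> of the
  regularised operator.\<close>

lemma B_op_decay:
  assumes \<alpha>: "1 \<le> \<alpha>" and growth: "resolvent_growth \<alpha>"
  obtains c where "0 \<le> c" "\<And>t x. 1 \<le> t \<Longrightarrow> norm (T t (B_op D A x)) \<le> c * t powr (- 1 / \<alpha>) * norm x"
proof -
  obtain k where k: "0 \<le> k" "\<And>s x. s \<noteq> 0 \<Longrightarrow> x \<in> D \<Longrightarrow>
      norm x \<le> k * (1 + \<bar>s\<bar> powr (- \<alpha>)) * norm ((\<i> * complex_of_real s) *\<^sub>C x + A x)"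
    using growth by (auto simp: resolvent_growth_def)
  define n where "n = nat \<lceil>\<alpha>\<rceil>"
  have n: "\<alpha> - 1 \<le> real n" unfolding n_def using \<alpha> by linarith
  define L where "L = real n * (1 + M) ^ n"
  have L: "0 \<le> L" using M_ge_0 by (simp add: L_def)
  define q where "q = 3 * (2 * k + (L + 1) * M) * (1 + M) * M\<^sup>2"
  have q: "0 \<le> q" using k(1) L M_ge_0 by (simp add: q_def)
  have bound: "norm (T t (B_op D A x)) \<le> (M * L + q) * t powr (- 1 / \<alpha>) * norm x" if t: "1 \<le> t" for t x
  proof -
    define r where "r = t powr (- 1 / \<alpha>)"
    have r: "0 < r" "r \<le> 1"
      using t \<alpha> powr_mono[of "- 1 / \<alpha>" 0 t] by (auto simp: r_def)
    have r1: "1 \<le> r powr (1 - \<alpha>)"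
      using powr_mono_both'[of 0 "1 - \<alpha>" r r] powr_mono'[of "1 - \<alpha>" 0 r] r \<alpha> by auto
    have rt: "r powr (1 - \<alpha>) / t = r"
    proof -
      have "- 1 / \<alpha> * (1 - \<alpha>) = - 1 / \<alpha> + 1" using \<alpha> by (simp add: field_simps)
      then have "r powr (1 - \<alpha>) = r * t"
        using t powr_add[of t "- 1 / \<alpha>" 1] by (simp only: r_def powr_powr) simp
      then show ?thesis using t by simp
    qed
    define K' where "K' = 2 * r powr (1 - \<alpha>) * k + (L + 1) * M"
    interpret F: dominated_operator T D A M "B.regularised r n" K'
    proof
      show "bounded_clinear (B.regularised r n)" by (rule B.regularised_clinear[OF r(1)])
      show "0 \<le> K'" using k(1) L M_ge_0 by (simp add: K'_def)
      show "B.regularised r n (T t x) = T t (B.regularised r n x)" if "0 \<le> t" for t x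
        by (rule B.regularised_commute[OF r(1), symmetric]) (simp_all add: that T_linear T_B_op)
      fix s :: real and x assume s: "s \<noteq> 0" and x: "x \<in> D"
      define y where "y = (\<i> * complex_of_real s) *\<^sub>C x + A x"
      obtain w where w: "B_op D A x = B_symbol s *\<^sub>C x + w" "norm w \<le> M * norm y"
        unfolding y_def by (rule B_op_approx_eigenvector[OF x])
      define c where "c = B_symbol s * (B_symbol s / (complex_of_real r + B_symbol s)) ^ n"
      have "cmod c \<le> r powr (1 - \<alpha>) * cmod (B_symbol s) powr \<alpha>"
        using B.regularised_symbol_le[OF r(1) Re_B_symbol[OF s] B_symbol_nonzero[OF s] \<alpha> n]
        by (simp add: c_def mult.commute)
      moreover have "norm (B.regularised r n x - c *\<^sub>C x) \<le> (L + 1) * norm w"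
        using B.regularised_approx[OF r(1) w(1) Re_B_symbol[OF s]] by (simp add: c_def L_def)
      then have "norm (B.regularised r n x - c *\<^sub>C x) \<le> (L + 1) * M * norm y"
        using order_trans[OF _ mult_left_mono[OF w(2), of "L + 1"]] L by (simp only: mult.assoc)
      ultimately show "norm (B.regularised r n x) \<le> K' * norm ((\<i> * complex_of_real s) *\<^sub>C x + A x)"
        using multiplier_bound[OF k(2)[OF s x, folded y_def] _ _ k(1) _ s] \<alpha> unfolding K'_def y_def by simp
    qed
    have t0: "0 < t" using t by simp
    have "K' \<le> r powr (1 - \<alpha>) * (2 * k + (L + 1) * M)"
      using mult_right_mono[OF r1, of "(L + 1) * M"] L M_ge_0 by (simp add: K'_def algebra_simps)
    then have "3 * K' * (1 + M) * M\<^sup>2 / t \<le> 3 * (r powr (1 - \<alpha>) * (2 * k + (L + 1) * M)) * (1 + M) * M\<^sup>2 / t"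
      using M_ge_0 t0 by (intro divide_right_mono mult_right_mono mult_left_mono) auto
    also have "\<dots> = q * (r powr (1 - \<alpha>) / t)" by (simp add: q_def)
    finally have "norm (T t (B.regularised r n x)) \<le> q * r * norm x"
      using order_trans[OF F.decay[OF t0] mult_right_mono] by (simp only: rt) auto
    moreover have "norm (T t (B_op D A x - B.regularised r n x)) \<le> M * L * r * norm x"
    proof -
      have "norm (T t (B_op D A x - B.regularised r n x)) \<le> M * norm (B_op D A x - B.regularised r n x)"
        using t0 by (intro norm_T) simp
      also have "\<dots> \<le> M * (L * (r * norm x))"
        unfolding L_def by (intro mult_left_mono B.norm_B_minus_regularised r M_ge_0)
      finally show ?thesis by (simp add: mult.assoc)
    qed
    moreover have "T t (B_op D A x) = T t (B_op D A x - B.regularised r n x) + T t (B.regularised r n x)"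
      using t0 by (simp add: linear_simps[OF T_linear])
    ultimately have "norm (T t (B_op D A x)) \<le> M * L * r * norm x + q * r * norm x"
      by (metis add_mono norm_triangle_le)
    then show ?thesis by (simp add: r_def distrib_right)
  qed
  show ?thesis
    by (rule that[OF _ bound]) (use L q M_ge_0 in simp)
qed

subsection \<open>From decay to resolvent growth\<close>

text \<open>In \<open>norm_le_orbit_plus\<close>, multiplied by \<open>\<bar>c\<bar>\<close>, the vector \<open>c T(t) x\<close> is \<open>T(t) C x\<close> up to a multiple of
  \<open>\<parallel>(i s + A) x\<parallel>\<close>; the decay absorbs it into the left-hand side when \<open>t\<close> has the order \<open>\<bar>c\<bar>\<^bsup>-\<gamma>\<^esup>\<close>, that is \<open>\<bar>s\<bar>\<^bsup>-\<kappa>\<gamma>\<^esup>\<close> for small \<open>s\<close>.\<close>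

lemma resolvent_growth_if_decay:
  assumes decay: "\<And>t x. t0 \<le> t \<Longrightarrow> norm (T t (C x)) \<le> p * t powr (- 1 / \<gamma>) * norm x"
    and approx: "\<And>s x. s \<noteq> 0 \<Longrightarrow> x \<in> D \<Longrightarrow> \<exists>c. a * cmod (B_symbol s) powr \<kappa> \<le> cmod c \<and>
      norm (C x - c *\<^sub>C x) \<le> L * norm ((\<i> * complex_of_real s) *\<^sub>C x + A x)"
    and t0: "0 < t0" and p: "0 \<le> p" and L: "0 \<le> L" and a: "0 < a" and \<kappa>: "0 < \<kappa>" and \<gamma>: "1 \<le> \<gamma>"
  shows "resolvent_growth (\<kappa> * \<gamma>)"
proof -
  define \<alpha> where "\<alpha> = \<kappa> * \<gamma>"
  have \<alpha>: "0 \<le> \<alpha>" "\<kappa> \<le> \<alpha>" using \<kappa> \<gamma> by (auto simp: \<alpha>_def)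
  define P where "P = 2 * (p + 1)"
  have P: "0 < P" using p by (simp add: P_def)
  define k where "k = 2 * M * (L / a * 2 powr \<alpha> + t0 + (P / a) powr \<gamma> * 2 powr \<alpha>)"
  have "norm x \<le> k * (1 + \<bar>s\<bar> powr (- \<alpha>)) * norm ((\<i> * complex_of_real s) *\<^sub>C x + A x)"
    if s: "s \<noteq> 0" and x: "x \<in> D" for s x
  proof -
    define y where "y = (\<i> * complex_of_real s) *\<^sub>C x + A x"
    define m where "m = 1 / cmod (B_symbol s)"
    define g where "g = 1 + \<bar>s\<bar> powr (- \<alpha>)"
    have m: "1 \<le> m" "cmod (B_symbol s) = 1 / m"
      using cmod_B_symbol_le_1[OF s] B_symbol_nonzero[OF s] by (auto simp: m_def)
    have mg: "m powr \<alpha> \<le> 2 powr \<alpha> * g"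
      unfolding m_def g_def by (rule inverse_B_symbol_powr_le[OF s \<alpha>(1)])
    obtain c where c: "a * cmod (B_symbol s) powr \<kappa> \<le> cmod c" "norm (C x - c *\<^sub>C x) \<le> L * norm y"
      using approx[OF s x] by (auto simp: y_def)
    have c_inv: "1 / cmod c \<le> m powr \<kappa> / a" and c0: "0 < cmod c"
    proof -
      have *: "a / m powr \<kappa> \<le> cmod c" using c(1) m by (simp add: powr_divide)
      moreover have pos: "0 < a / m powr \<kappa>" using a m by simp
      ultimately show "0 < cmod c" by linarith
      show "1 / cmod c \<le> m powr \<kappa> / a"
        using le_imp_inverse_le[OF * pos] by (simp add: divide_inverse mult.commute)
    qed
    \<comment> \<open>large enough to make the decay rate at \<open>t\<close> at most \<open>\<bar>c\<bar> / 2\<close>, see \<open>small\<close>\<close>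
    define t where "t = t0 + (P / cmod c) powr \<gamma>"
    have t: "t0 \<le> t" "0 < t" using t0 by (auto simp: t_def add_pos_nonneg)
    have small: "p * t powr (- 1 / \<gamma>) \<le> cmod c / 2"
    proof -
      have "t powr (- 1 / \<gamma>) \<le> ((P / cmod c) powr \<gamma>) powr (- 1 / \<gamma>)"
        using P c0 t0 \<gamma> by (intro powr_mono2') (auto simp: t_def)
      also have "\<dots> = cmod c / P"
        using \<gamma> P c0 by (simp add: powr_powr powr_minus divide_inverse)
      finally have "p * t powr (- 1 / \<gamma>) \<le> p * (cmod c / P)" using p by (rule mult_left_mono)
      also have "\<dots> = p / (p + 1) * (cmod c / 2)" by (simp add: P_def)
      also have "\<dots> \<le> 1 * (cmod c / 2)" using p by (intro mult_right_mono) auto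
      finally show ?thesis by simp
    qed
    have "cmod c * norm (T t x) = norm (T t (c *\<^sub>C x))"
      using t by (simp add: bounded_clinear_scaleC[OF T_clinear] norm_scaleC)
    also have "T t (c *\<^sub>C x) = T t (C x) - T t (C x - c *\<^sub>C x)"
      using t by (simp add: linear_simps[OF T_linear])
    also have "norm \<dots> \<le> norm (T t (C x)) + norm (T t (C x - c *\<^sub>C x))"
      by (rule norm_triangle_ineq4)
    also have "norm (T t (C x)) \<le> cmod c / 2 * norm x"
      by (rule order_trans[OF decay[OF t(1)] mult_right_mono[OF small]]) simp
    also have "norm (T t (C x - c *\<^sub>C x)) \<le> M * (L * norm y)"
      using t by (intro order_trans[OF norm_T mult_left_mono[OF c(2) M_ge_0]]) simp
    finally have "cmod c * norm (T t x) \<le> cmod c / 2 * norm x + M * (L * norm y)" by simp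
    moreover have "cmod c * norm x \<le> cmod c * (norm (T t x) + M * t * norm y)"
      unfolding y_def using t by (intro mult_left_mono norm_le_orbit_plus x) auto
    ultimately have "cmod c * norm x \<le> cmod c / 2 * norm x + M * (L * norm y) + cmod c * (M * t * norm y)"
      by (simp add: distrib_left)
    then have "cmod c * norm x \<le> cmod c * (2 * M * (L * (1 / cmod c) + t) * norm y)"
      using c0 by (simp add: algebra_simps)
    then have "norm x \<le> 2 * M * (L * (1 / cmod c) + t) * norm y" using c0 by simp
    also have "\<dots> \<le> k * g * norm y"
    proof (rule mult_right_mono)
      have "L * (1 / cmod c) \<le> L * (m powr \<alpha> / a)"
        using c_inv a powr_mono[OF \<alpha>(2) m(1)] L
        by (intro mult_left_mono order_trans[OF c_inv] divide_right_mono) auto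
      also have "\<dots> \<le> L * (2 powr \<alpha> * g / a)"
        using mg a L by (intro mult_left_mono divide_right_mono) auto
      finally have 1: "L * (1 / cmod c) \<le> L / a * 2 powr \<alpha> * g" by simp
      have "(P / cmod c) powr \<gamma> \<le> (P / a * m powr \<kappa>) powr \<gamma>"
        using mult_left_mono[OF c_inv, of P] P c0 \<gamma> by (intro powr_mono2) auto
      also have "\<dots> = (P / a) powr \<gamma> * m powr \<alpha>"
        using P a by (subst powr_mult) (auto simp: powr_powr \<alpha>_def)
      also have "\<dots> \<le> (P / a) powr \<gamma> * (2 powr \<alpha> * g)"
        using mg by (intro mult_left_mono) auto
      finally have 2: "(P / cmod c) powr \<gamma> \<le> (P / a) powr \<gamma> * 2 powr \<alpha> * g" by simp
      have 3: "t0 \<le> t0 * g" using t0 by (simp add: g_def)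
      have "L * (1 / cmod c) + t \<le> (L / a * 2 powr \<alpha> + t0 + (P / a) powr \<gamma> * 2 powr \<alpha>) * g"
        unfolding t_def using add_mono[OF 1 add_mono[OF 3 2]] by (simp add: algebra_simps)
      then have "2 * M * (L * (1 / cmod c) + t)
          \<le> 2 * M * ((L / a * 2 powr \<alpha> + t0 + (P / a) powr \<gamma> * 2 powr \<alpha>) * g)"
        using M_ge_0 by (intro mult_left_mono) auto
      then show "2 * M * (L * (1 / cmod c) + t) \<le> k * g" by (simp only: k_def mult.assoc)
    qed simp
    finally show ?thesis by (simp add: y_def g_def)
  qed
  moreover have "0 \<le> k" using M_ge_0 L a t0 by (simp add: k_def)
  ultimately show ?thesis
    unfolding resolvent_growth_def \<alpha>_def[symmetric] by blast
qed

lemma resolvent_growth_if_frac_power_decay: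
  assumes \<alpha>: "1 \<le> \<alpha>" and t0: "0 < t0" and p: "0 \<le> p"
    and decay: "\<And>t x. t0 \<le> t \<Longrightarrow> norm (T t (frac_power \<alpha> (B_op D A) x)) \<le> p * (1 / t) * norm x"
  shows "resolvent_growth \<alpha>"
proof -
  from B.frac_power_approx[OF \<alpha>]
  obtain L a b where L: "0 \<le> L" "0 < a" and approx:
    "\<And>\<mu> x w. B_op D A x = \<mu> *\<^sub>C x + w \<Longrightarrow> 0 \<le> Re \<mu> \<Longrightarrow> \<mu> \<noteq> 0 \<Longrightarrow> cmod \<mu> \<le> 1 \<Longrightarrow>
      \<exists>c. a * cmod \<mu> powr \<alpha> \<le> cmod c \<and> cmod c \<le> b * cmod \<mu> powr \<alpha> \<and>
        norm (frac_power \<alpha> (B_op D A) x - c *\<^sub>C x) \<le> L * norm w"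
    by metis
  have "resolvent_growth (\<alpha> * 1)"
  proof (rule resolvent_growth_if_decay)
    show "norm (T t (frac_power \<alpha> (B_op D A) x)) \<le> p * t powr (- 1 / 1) * norm x" if "t0 \<le> t" for t x
      using decay[OF that, of x] t0 that by (simp add: powr_minus_divide)
    show "\<exists>c. a * cmod (B_symbol s) powr \<alpha> \<le> cmod c \<and>
        norm (frac_power \<alpha> (B_op D A) x - c *\<^sub>C x) \<le> L * M * norm ((\<i> * complex_of_real s) *\<^sub>C x + A x)"
      if s: "s \<noteq> 0" and x: "x \<in> D" for s x
    proof -
      obtain w where w: "B_op D A x = B_symbol s *\<^sub>C x + w"
        "norm w \<le> M * norm ((\<i> * complex_of_real s) *\<^sub>C x + A x)"
        by (rule B_op_approx_eigenvector[OF x])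
      obtain c where "a * cmod (B_symbol s) powr \<alpha> \<le> cmod c"
        "norm (frac_power \<alpha> (B_op D A) x - c *\<^sub>C x) \<le> L * norm w"
        using approx[OF w(1) Re_B_symbol[OF s] B_symbol_nonzero[OF s] cmod_B_symbol_le_1[OF s]] by blast
      then show ?thesis
        using mult_left_mono[OF w(2) L(1)] by (intro exI[of _ c]) (simp add: mult.assoc)
    qed
  qed (use assms L M_ge_0 in auto)
  then show ?thesis by simp
qed

lemma resolvent_growth_if_B_op_decay:
  assumes \<alpha>: "1 \<le> \<alpha>" and t0: "0 < t0" and p: "0 \<le> p"
    and decay: "\<And>t x. t0 \<le> t \<Longrightarrow> norm (T t (B_op D A x)) \<le> p * t powr (- 1 / \<alpha>) * norm x"
  shows "resolvent_growth \<alpha>"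
proof -
  have "resolvent_growth (1 * \<alpha>)"
  proof (rule resolvent_growth_if_decay[OF decay])
    show "\<exists>c. 1 * cmod (B_symbol s) powr 1 \<le> cmod c \<and>
        norm (B_op D A x - c *\<^sub>C x) \<le> M * norm ((\<i> * complex_of_real s) *\<^sub>C x + A x)"
      if s: "s \<noteq> 0" and x: "x \<in> D" for s x
    proof -
      obtain w where w: "B_op D A x = B_symbol s *\<^sub>C x + w"
        "norm w \<le> M * norm ((\<i> * complex_of_real s) *\<^sub>C x + A x)"
        by (rule B_op_approx_eigenvector[OF x])
      then show ?thesis by (intro exI[of _ "B_symbol s"]) simp
    qed
  qed (use assms M_ge_0 in auto)
  then show ?thesis by simp
qed

end

subsection \<open>Landau symbols\<close>

lemma bigo_onorm_iff:
  fixes F :: "real \<Rightarrow> 'b::real_normed_vector \<Rightarrow> 'b" and g :: "real \<Rightarrow> real"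
  assumes F: "\<And>t. 0 < t \<Longrightarrow> bounded_linear (F t)" and g: "\<And>t. 0 < t \<Longrightarrow> 0 < g t"
  shows "(\<lambda>t. onorm (F t)) \<in> O[at_top](g) \<longleftrightarrow>
    (\<exists>c\<ge>0. \<exists>t0>0. \<forall>t\<ge>t0. \<forall>x. norm (F t x) \<le> c * g t * norm x)"
proof
  assume "(\<lambda>t. onorm (F t)) \<in> O[at_top](g)"
  then obtain c where c: "0 < c" "\<forall>\<^sub>F t in at_top. norm (onorm (F t)) \<le> c * norm (g t)"
    by (auto elim: landau_o.bigE)
  then obtain t1 where t1: "\<And>t. t1 \<le> t \<Longrightarrow> norm (onorm (F t)) \<le> c * norm (g t)"
    by (auto simp: eventually_at_top_linorder)
  have "norm (F t x) \<le> c * g t * norm x" if t: "max t1 1 \<le> t" for t x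
  proof -
    have "onorm (F t) \<le> c * g t" using t1[of t] g[of t] t by simp
    then have "onorm (F t) * norm x \<le> c * g t * norm x"
      by (rule mult_right_mono) simp
    with onorm[OF F[of t], of x] t show ?thesis by linarith
  qed
  with c(1) show "\<exists>c\<ge>0. \<exists>t0>0. \<forall>t\<ge>t0. \<forall>x. norm (F t x) \<le> c * g t * norm x"
    by (intro exI[of _ c] conjI exI[of _ "max t1 1"]) auto
next
  assume "\<exists>c\<ge>0. \<exists>t0>0. \<forall>t\<ge>t0. \<forall>x. norm (F t x) \<le> c * g t * norm x"
  then obtain c t0 where *: "0 \<le> c" "0 < t0" "\<And>t x. t0 \<le> t \<Longrightarrow> norm (F t x) \<le> c * g t * norm x"
    by blast
  have "norm (onorm (F t)) \<le> c * norm (g t)" if t: "t0 \<le> t" for t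
  proof -
    have pos: "0 < t" using t *(2) by linarith
    have "onorm (F t) \<le> c * g t"
    proof (rule onorm_bound)
      show "0 \<le> c * g t" using *(1) g[OF pos] by simp
    qed (rule *(3)[OF t])
    then show ?thesis using onorm_pos_le[OF F[OF pos]] g[OF pos] by simp
  qed
  then show "(\<lambda>t. onorm (F t)) \<in> O[at_top](g)"
    by (intro bigoI[of _ c]) (auto simp: eventually_at_top_linorder)
qed

context bounded_semigroup begin

abbreviation resolvent_norm :: "real \<Rightarrow> real"
  where "resolvent_norm s \<equiv> onorm (shift_inverse D A (\<i> * complex_of_real s))"

context
  assumes spectrum: "op_spectrum D A \<inter> range (\<lambda>s::real. \<i> * complex_of_real s) = {0}"
begin

text \<open>The resolvent set refers to \<open>z - A\<close> and \<open>shift_inverse\<close> to \<open>z + A\<close>: the point \<open>i s\<close> for the latter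
  corresponds to the point \<open>- i s\<close> for the former, and the two inverses differ by a sign.\<close>

lemma imaginary_resolvent:
  assumes s: "s \<noteq> 0"
  shows shift_inverse_linear: "bounded_linear (shift_inverse D A (\<i> * complex_of_real s))"
    and shift_inverse_D: "shift_inverse D A (\<i> * complex_of_real s) y \<in> D"
    and shift_inverse_right: "(\<i> * complex_of_real s) *\<^sub>C shift_inverse D A (\<i> * complex_of_real s) y
      + A (shift_inverse D A (\<i> * complex_of_real s) y) = y"
    and shift_inverse_left: "x \<in> D \<Longrightarrow>
      shift_inverse D A (\<i> * complex_of_real s) ((\<i> * complex_of_real s) *\<^sub>C x + A x) = x"
proof -
  define z where "z = \<i> * complex_of_real (- s)"
  define f where "f x = z *\<^sub>C x - A x" for x
  define g where "g x = (\<i> * complex_of_real s) *\<^sub>C x + A x" for x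
  have "z \<noteq> 0" using s by (simp add: z_def)
  moreover have "z \<in> range (\<lambda>s::real. \<i> * complex_of_real s)" unfolding z_def by blast
  ultimately have "z \<in> op_resolvent_set D A" using spectrum by (auto simp: op_spectrum_def)
  then have f: "bij_betw f D UNIV" "bounded_clinear (inv_into D f)"
    by (simp_all add: op_resolvent_set_def f_def[abs_def])
  have gf: "g x = - f x" for x
    by (simp add: f_def g_def z_def scaleC.minus_left)
  have inj: "inj_on g D" using f(1) by (auto simp: bij_betw_def inj_on_def gf)
  have left: "inv_into D g (g x) = x" if "x \<in> D" for x
    using inv_into_f_f[OF inj that] .
  have f_inv: "inv_into D f y \<in> D" "f (inv_into D f y) = y" for y
    using f(1) inv_into_into[of y f D] f_inv_into_f[of y f D] by (auto simp: bij_betw_def)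
  have g_inv: "inv_into D g y = inv_into D f (- y)" for y
    using left[OF f_inv(1)[of "- y"]] by (simp add: gf f_inv(2))
  have sg: "shift_inverse D A (\<i> * complex_of_real s) = inv_into D g"
    by (simp add: shift_inverse_def g_def[abs_def])
  have "bounded_linear (\<lambda>y. inv_into D f (- y))"
    by (intro bounded_linear_compose[OF bounded_clinear_bounded_linear[OF f(2)]] bounded_linear_minus
        bounded_linear_ident)
  moreover have "shift_inverse D A (\<i> * complex_of_real s) = (\<lambda>y. inv_into D f (- y))"
    by (rule ext) (simp add: sg g_inv)
  ultimately show "bounded_linear (shift_inverse D A (\<i> * complex_of_real s))"
    by simp
  show "shift_inverse D A (\<i> * complex_of_real s) y \<in> D"
    by (simp add: sg g_inv f_inv)
  have "g (inv_into D g y) = y"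
    by (simp add: g_inv gf f_inv)
  then show "(\<i> * complex_of_real s) *\<^sub>C shift_inverse D A (\<i> * complex_of_real s) y
      + A (shift_inverse D A (\<i> * complex_of_real s) y) = y"
    by (simp add: sg) (simp add: g_def)
  show "x \<in> D \<Longrightarrow> shift_inverse D A (\<i> * complex_of_real s) ((\<i> * complex_of_real s) *\<^sub>C x + A x) = x"
    using left by (simp add: sg) (simp add: g_def)
qed

lemma norm_le_resolvent_norm:
  "s \<noteq> 0 \<Longrightarrow> x \<in> D \<Longrightarrow> norm x \<le> resolvent_norm s * norm ((\<i> * complex_of_real s) *\<^sub>C x + A x)"
  using onorm[OF shift_inverse_linear, of s "(\<i> * complex_of_real s) *\<^sub>C x + A x"]
  by (simp add: shift_inverse_left)

lemma resolvent_norm_le: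
  assumes "s \<noteq> 0" "0 \<le> c"
    and "\<And>x. x \<in> D \<Longrightarrow> norm x \<le> c * norm ((\<i> * complex_of_real s) *\<^sub>C x + A x)"
  shows "resolvent_norm s \<le> c"
  by (rule onorm_bound[OF assms(2)])
    (use assms(3)[OF shift_inverse_D[OF assms(1)]] in \<open>simp add: shift_inverse_right[OF assms(1)]\<close>)

lemma resolvent_norm_nonneg: "s \<noteq> 0 \<Longrightarrow> 0 \<le> resolvent_norm s"
  by (rule onorm_pos_le[OF shift_inverse_linear])

text \<open>The resolvent at \<open>s'\<close> differs from the one at \<open>s\<close> by a Neumann series; in terms of lower bounds for
  \<open>i s + A\<close> this is the absorption of the perturbation \<open>\<bar>s' - s\<bar> \<parallel>x\<parallel>\<close>.\<close>

lemma resolvent_norm_locally_bounded: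
  assumes s: "s \<noteq> 0"
  obtains e c where "0 < e" "0 \<le> c" "\<And>s'. s' \<noteq> 0 \<Longrightarrow> \<bar>s' - s\<bar> < e \<Longrightarrow> resolvent_norm s' \<le> c"
proof -
  define r where "r = resolvent_norm s + 1"
  have r: "0 < r" using resolvent_norm_nonneg[OF s] by (simp add: r_def)
  have "resolvent_norm s' \<le> 2 * r" if s': "s' \<noteq> 0" "\<bar>s' - s\<bar> < 1 / (2 * r)" for s'
  proof (rule resolvent_norm_le[OF s'(1)])
    fix x assume x: "x \<in> D"
    define y where "y = (\<i> * complex_of_real s') *\<^sub>C x + A x"
    have "(\<i> * complex_of_real s) *\<^sub>C x + A x = y - (\<i> * complex_of_real (s' - s)) *\<^sub>C x"
      by (simp add: y_def scaleC.diff_left right_diff_distrib)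
    moreover have "norm (y - (\<i> * complex_of_real (s' - s)) *\<^sub>C x) \<le> norm y + \<bar>s' - s\<bar> * norm x"
      using norm_triangle_ineq4[of y "(\<i> * complex_of_real (s' - s)) *\<^sub>C x"]
      by (simp only: norm_scaleC norm_mult norm_ii norm_of_real mult_1_left)
    ultimately have "norm x \<le> resolvent_norm s * (norm y + \<bar>s' - s\<bar> * norm x)"
      using order_trans[OF norm_le_resolvent_norm[OF s x] mult_left_mono[OF _ resolvent_norm_nonneg[OF s]]]
      by simp
    also have "\<dots> \<le> r * (norm y + \<bar>s' - s\<bar> * norm x)"
      by (intro mult_right_mono) (auto simp: r_def)
    also have "\<dots> \<le> r * (norm y + 1 / (2 * r) * norm x)"
      using s'(2) r by (intro mult_left_mono add_left_mono mult_right_mono) auto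
    also have "\<dots> = r * norm y + norm x / 2" using r by (simp add: distrib_left)
    finally show "norm x \<le> 2 * r * norm ((\<i> * complex_of_real s') *\<^sub>C x + A x)"
      by (simp add: y_def)
  qed (use r in simp)
  then show ?thesis using r by (intro that[of "1 / (2 * r)" "2 * r"]) auto
qed

lemma resolvent_norm_bounded_on_compact:
  assumes S: "compact S" "0 \<notin> S"
  obtains c where "0 \<le> c" "\<And>s. s \<in> S \<Longrightarrow> resolvent_norm s \<le> c"
proof -
  have "\<forall>s\<in>S. \<exists>e c. 0 < e \<and> 0 \<le> c \<and> (\<forall>s'. s' \<noteq> 0 \<longrightarrow> \<bar>s' - s\<bar> < e \<longrightarrow> resolvent_norm s' \<le> c)"
    using resolvent_norm_locally_bounded S(2) by metis
  then obtain e c where ec: "\<And>s. s \<in> S \<Longrightarrow> 0 < e s" "\<And>s. s \<in> S \<Longrightarrow> 0 \<le> c s"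
    "\<And>s s'. s \<in> S \<Longrightarrow> s' \<noteq> 0 \<Longrightarrow> \<bar>s' - s\<bar> < e s \<Longrightarrow> resolvent_norm s' \<le> c s"
    by metis
  obtain S' where S': "S' \<subseteq> S" "finite S'" "S \<subseteq> (\<Union>s\<in>S'. ball s (e s))"
  proof (rule compactE_image[OF S(1), of S "\<lambda>s. ball s (e s)"])
    show "S \<subseteq> (\<Union>s\<in>S. ball s (e s))" using ec(1) by force
  qed auto
  have "resolvent_norm s \<le> sum c S'" if s: "s \<in> S" for s
  proof -
    obtain s0 where s0: "s0 \<in> S'" "\<bar>s - s0\<bar> < e s0"
      using S'(3) s by (auto simp: dist_real_def abs_minus_commute)
    then have "resolvent_norm s \<le> c s0" using ec(3)[of s0 s] S' S(2) s by auto
    also have "c s0 \<le> sum c S'" using s0(1) S' ec(2) by (intro member_le_sum) auto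
    finally show ?thesis .
  qed
  moreover have "0 \<le> sum c S'" using ec(2) S'(1) by (intro sum_nonneg) auto
  ultimately show ?thesis using that by blast
qed

text \<open>The two asymptotic conditions leave a compact set of \<open>s\<close> away from the origin, on which the
  resolvent is bounded because it is locally bounded.\<close>

lemma resolvent_growth_iff:
  assumes \<alpha>: "0 \<le> \<alpha>"
  shows "resolvent_growth \<alpha> \<longleftrightarrow>
    resolvent_norm \<in> O[at 0](\<lambda>s. \<bar>s\<bar> powr (- \<alpha>)) \<and> resolvent_norm \<in> O[at_infinity](\<lambda>s. 1)"
proof
  assume "resolvent_growth \<alpha>"
  then obtain k where k: "0 \<le> k" "\<And>s x. s \<noteq> 0 \<Longrightarrow> x \<in> D \<Longrightarrow>
      norm x \<le> k * (1 + \<bar>s\<bar> powr (- \<alpha>)) * norm ((\<i> * complex_of_real s) *\<^sub>C x + A x)"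
    by (auto simp: resolvent_growth_def)
  have le: "norm (resolvent_norm s) \<le> k * (1 + \<bar>s\<bar> powr (- \<alpha>))" if "s \<noteq> 0" for s
    using resolvent_norm_le[OF that _ k(2)[OF that]] resolvent_norm_nonneg[OF that] k(1)
    by simp
  have near: "1 \<le> \<bar>s\<bar> powr (- \<alpha>)" if "s \<noteq> 0" "\<bar>s\<bar> \<le> 1" for s :: real
    using powr_mono'[of "- \<alpha>" 0 "\<bar>s\<bar>"] that \<alpha> by simp
  have far: "\<bar>s\<bar> powr (- \<alpha>) \<le> 1" if "1 \<le> \<bar>s\<bar>" for s :: real
    using powr_mono[of "- \<alpha>" 0 "\<bar>s\<bar>"] that \<alpha> by (auto split: if_splits)
  have "resolvent_norm \<in> O[at 0](\<lambda>s. \<bar>s\<bar> powr (- \<alpha>))"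
  proof (rule bigoI)
    show "\<forall>\<^sub>F s in at 0. norm (resolvent_norm s) \<le> 2 * k * norm (\<bar>s\<bar> powr (- \<alpha>))"
      unfolding eventually_at
    proof (intro exI[of _ 1] conjI ballI impI)
      fix s :: real assume s: "s \<noteq> 0 \<and> dist s 0 < 1"
      then have "k * (1 + \<bar>s\<bar> powr (- \<alpha>)) \<le> k * (2 * \<bar>s\<bar> powr (- \<alpha>))"
        using k(1) near[of s] by (intro mult_left_mono) auto
      with le[of s] s show "norm (resolvent_norm s) \<le> 2 * k * norm (\<bar>s\<bar> powr (- \<alpha>))" by simp
    qed simp
  qed
  moreover have "resolvent_norm \<in> O[at_infinity](\<lambda>s. 1)"
  proof (rule bigoI)
    show "\<forall>\<^sub>F s in at_infinity. norm (resolvent_norm s) \<le> 2 * k * norm (1::real)"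
      unfolding eventually_at_infinity
    proof (intro exI[of _ 1] allI impI)
      fix s :: real assume s: "1 \<le> norm s"
      then have "k * (1 + \<bar>s\<bar> powr (- \<alpha>)) \<le> k * 2"
        using k(1) far[of s] by (intro mult_left_mono) auto
      with le[of s] s show "norm (resolvent_norm s) \<le> 2 * k * norm (1::real)" by fastforce
    qed
  qed
  ultimately show "resolvent_norm \<in> O[at 0](\<lambda>s. \<bar>s\<bar> powr (- \<alpha>)) \<and> resolvent_norm \<in> O[at_infinity](\<lambda>s. 1)"
    by blast
next
  assume O: "resolvent_norm \<in> O[at 0](\<lambda>s. \<bar>s\<bar> powr (- \<alpha>)) \<and> resolvent_norm \<in> O[at_infinity](\<lambda>s. 1)"
  then obtain c1 where c1: "0 < c1" "\<forall>\<^sub>F s in at 0. norm (resolvent_norm s) \<le> c1 * norm (\<bar>s\<bar> powr (- \<alpha>))"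
    by (auto elim: landau_o.bigE)
  then obtain d where d: "0 < d" "\<And>s. s \<noteq> 0 \<Longrightarrow> \<bar>s\<bar> < d \<Longrightarrow> norm (resolvent_norm s) \<le> c1 * norm (\<bar>s\<bar> powr (- \<alpha>))"
    by (auto simp: eventually_at)
  obtain c2 where c2: "0 < c2" "\<forall>\<^sub>F s in at_infinity. norm (resolvent_norm s) \<le> c2 * norm (1::real)"
    using O by (auto elim: landau_o.bigE)
  then obtain b where b: "\<And>s. b \<le> \<bar>s\<bar> \<Longrightarrow> norm (resolvent_norm s) \<le> c2"
    by (auto simp: eventually_at_infinity)
  have "compact ({-b..-d} \<union> {d..b})" "0 \<notin> {-b..-d} \<union> {d..b}"
    using d(1) by (auto intro: compact_Un)
  then obtain c3 where c3: "0 \<le> c3" "\<And>s. s \<in> {-b..-d} \<union> {d..b} \<Longrightarrow> resolvent_norm s \<le> c3"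
    using resolvent_norm_bounded_on_compact by metis
  define k where "k = c1 + c2 + c3"
  have "resolvent_norm s \<le> k * (1 + \<bar>s\<bar> powr (- \<alpha>))" if s: "s \<noteq> 0" for s
  proof -
    consider "\<bar>s\<bar> < d" | "b \<le> \<bar>s\<bar>" | "s \<in> {-b..-d} \<union> {d..b}" by force
    then have "resolvent_norm s \<le> c1 * \<bar>s\<bar> powr (- \<alpha>) + c2 + c3"
    proof cases
      case 1
      then show ?thesis using d(2)[OF s] c2(1) c3(1) by fastforce
    next
      case 2
      have "0 \<le> c1 * \<bar>s\<bar> powr (- \<alpha>)" using c1(1) by simp
      then show ?thesis using b[OF 2] c3(1) by auto
    next
      case 3
      have "0 \<le> c1 * \<bar>s\<bar> powr (- \<alpha>)" using c1(1) by simp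
      then show ?thesis using c3(2)[OF 3] c2(1) by linarith
    qed
    also have "\<dots> \<le> k * (1 + \<bar>s\<bar> powr (- \<alpha>))"
      using c1(1) c2(1) c3(1) by (simp add: k_def algebra_simps)
    finally show ?thesis .
  qed
  then have "norm x \<le> k * (1 + \<bar>s\<bar> powr (- \<alpha>)) * norm ((\<i> * complex_of_real s) *\<^sub>C x + A x)"
    if "s \<noteq> 0" "x \<in> D" for s x
    using norm_le_resolvent_norm[OF that] that(1) by (meson mult_right_mono norm_ge_zero order_trans)
  moreover have "0 \<le> k" using c1(1) c2(1) c3(1) by (simp add: k_def)
  ultimately show "resolvent_growth \<alpha>" unfolding resolvent_growth_def by blast
qed

end

lemma resolvent_growth_iff_frac_power_decay:
  assumes \<alpha>: "1 \<le> \<alpha>"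
  shows "resolvent_growth \<alpha> \<longleftrightarrow>
    (\<lambda>t. onorm (T t \<circ> frac_power \<alpha> (B_op D A))) \<in> O[at_top](\<lambda>t. 1 / t)"
proof -
  have F: "bounded_linear (T t \<circ> frac_power \<alpha> (B_op D A))" if "0 < t" for t
    using that by (intro bounded_clinear_bounded_linear bounded_clinear_compose T_clinear B.frac_power_clinear) simp
  show ?thesis
  proof (subst bigo_onorm_iff[OF F])
    show "resolvent_growth \<alpha> \<longleftrightarrow> (\<exists>c\<ge>0. \<exists>t0>0. \<forall>t\<ge>t0. \<forall>x.
        norm ((T t \<circ> frac_power \<alpha> (B_op D A)) x) \<le> c * (1 / t) * norm x)"
    proof
      assume "resolvent_growth \<alpha>"
      from frac_power_decay[OF \<alpha> this] obtain c where "0 \<le> c"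
        "\<And>t x. 0 < t \<Longrightarrow> norm (T t (frac_power \<alpha> (B_op D A) x)) \<le> c * (1 / t) * norm x" by metis
      then show "\<exists>c\<ge>0. \<exists>t0>0. \<forall>t\<ge>t0. \<forall>x.
          norm ((T t \<circ> frac_power \<alpha> (B_op D A)) x) \<le> c * (1 / t) * norm x"
        by (intro exI[of _ c] conjI exI[of _ 1]) auto
    next
      assume "\<exists>c\<ge>0. \<exists>t0>0. \<forall>t\<ge>t0. \<forall>x.
          norm ((T t \<circ> frac_power \<alpha> (B_op D A)) x) \<le> c * (1 / t) * norm x"
      then show "resolvent_growth \<alpha>"
        by (auto simp del: times_divide_eq_right intro: resolvent_growth_if_frac_power_decay[OF \<alpha>])
    qed
  qed simp_all
qed

lemma resolvent_growth_iff_B_op_decay: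
  assumes \<alpha>: "1 \<le> \<alpha>"
  shows "resolvent_growth \<alpha> \<longleftrightarrow>
    (\<lambda>t. onorm (T t \<circ> B_op D A)) \<in> O[at_top](\<lambda>t. t powr (- 1 / \<alpha>))"
proof -
  have F: "bounded_linear (T t \<circ> B_op D A)" if "0 < t" for t
    using that by (intro bounded_clinear_bounded_linear bounded_clinear_compose T_clinear B_op_clinear) simp
  show ?thesis
  proof (subst bigo_onorm_iff[OF F])
    show "resolvent_growth \<alpha> \<longleftrightarrow> (\<exists>c\<ge>0. \<exists>t0>0. \<forall>t\<ge>t0. \<forall>x.
        norm ((T t \<circ> B_op D A) x) \<le> c * t powr (- 1 / \<alpha>) * norm x)"
    proof
      assume "resolvent_growth \<alpha>"
      from B_op_decay[OF \<alpha> this] obtain c where "0 \<le> c"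
        "\<And>t x. 1 \<le> t \<Longrightarrow> norm (T t (B_op D A x)) \<le> c * t powr (- 1 / \<alpha>) * norm x" by metis
      then show "\<exists>c\<ge>0. \<exists>t0>0. \<forall>t\<ge>t0. \<forall>x.
          norm ((T t \<circ> B_op D A) x) \<le> c * t powr (- 1 / \<alpha>) * norm x"
        by (intro exI[of _ c] conjI exI[of _ 1]) auto
    next
      assume "\<exists>c\<ge>0. \<exists>t0>0. \<forall>t\<ge>t0. \<forall>x.
          norm ((T t \<circ> B_op D A) x) \<le> c * t powr (- 1 / \<alpha>) * norm x"
      then obtain c t0 where "0 \<le> c" "0 < t0"
        "\<And>t x. t0 \<le> t \<Longrightarrow> norm (T t (B_op D A x)) \<le> c * t powr (- 1 / \<alpha>) * norm x"
        by auto
      then show "resolvent_growth \<alpha>"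
        by (intro resolvent_growth_if_B_op_decay[OF \<alpha>, of t0 c]) auto
    qed
  qed simp_all
qed

end

theorem theorem7p6:
  fixes T :: "real \<Rightarrow> 'a::complex_hilbert \<Rightarrow> 'a"
    and D :: "'a set" and A :: "'a \<Rightarrow> 'a" and \<alpha> :: real
  assumes "bounded_C0_semigroup T"
    and "is_generator T D (\<lambda>x. - A x)"
    and "op_spectrum D A \<inter> range (\<lambda>s::real. \<i> * complex_of_real s) = {0}"
    and "\<alpha> \<ge> 1"
  shows "((\<lambda>s::real. onorm (shift_inverse D A (\<i> * complex_of_real s)))
            \<in> O[at 0](\<lambda>s. \<bar>s\<bar> powr (- \<alpha>)) \<and>
          (\<lambda>s::real. onorm (shift_inverse D A (\<i> * complex_of_real s)))
            \<in> O[at_infinity](\<lambda>s. 1)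
          \<longleftrightarrow>
          (\<lambda>t::real. onorm (T t \<circ> frac_power \<alpha> (B_op D A))) \<in> O[at_top](\<lambda>t. 1 / t)) \<and>
         ((\<lambda>t::real. onorm (T t \<circ> frac_power \<alpha> (B_op D A))) \<in> O[at_top](\<lambda>t. 1 / t)
          \<longleftrightarrow>
          (\<lambda>t::real. onorm (T t \<circ> B_op D A)) \<in> O[at_top](\<lambda>t. t powr (- 1 / \<alpha>)))"
proof -
  from assms(1) obtain M where M: "C0_semigroup T" "\<And>t. 0 \<le> t \<Longrightarrow> onorm (T t) \<le> M"
    by (auto simp: bounded_C0_semigroup_def)
  interpret bounded_semigroup T D A "max 1 M"
  proof
    fix t :: real and x :: 'a assume t: "0 \<le> t"
    have "bounded_linear (T t)"
      using M(1) t by (simp add: C0_semigroup_def bounded_clinear_def)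
    then have "norm (T t x) \<le> onorm (T t) * norm x" by (rule onorm)
    also have "\<dots> \<le> max 1 M * norm x"
      using M(2)[OF t] by (intro mult_right_mono) auto
    finally show "norm (T t x) \<le> max 1 M * norm x" .
  qed (use M(1) assms(2) in auto)
  show ?thesis
    using resolvent_growth_iff[OF assms(3), of \<alpha>] resolvent_growth_iff_frac_power_decay[OF assms(4)]
      resolvent_growth_iff_B_op_decay[OF assms(4)] assms(4)
    by simp
qed

end
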